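(* For the full quantum flag manifold $\mathcal{O}_q(\mathrm{F}_3)$ endowed with the differential calculus $\Omega^\bullet_q(\mathrm{F}_3)$, the affine space of left $\mathcal{O}_q(\mathrm{SU}_3)$-covariant connections on $\Omega^1_q(\mathrm{F}_3)$ has dimension $12$, and the affine space of torsion-free left $\mathcal{O}_q(\mathrm{SU}_3)$-covariant connections on $\Omega^1_q(\mathrm{F}_3)$ has dimension $6$.
   Context: For a differential calculus $(\Omega^\bullet,\mathrm{d})$ over an algebra $B$, a connection on $\Omega^1$ is a $\mathbb{C}$-linear map $\nabla:\Omega^1\to\Omega^1\otimes_B\Omega^1$ with $\nabla(b\omega)=\mathrm{d}b\otimes\omega+b\nabla(\omega)$. It is left $A$-covariant if it is a left $A$-comodule map, and torsion-free if $\wedge\circ\nabla=\mathrm{d}$ on $\Omega^1$. Let $q\in\mathbb{R}\setminus\{-1,0,1\}$. Let $\Delta^+=\{\alpha_1,\alpha_2,\alpha_1+\alpha_2\}$ be the positive roots of $\mathfrak{sl}_3$, with Cartan matrix $a_{11}=a_{22}=2$, $a_{12}=a_{21}=-1$. $U_q(\mathfrak{sl}_3)$ is the complex algebra generated by $E_i,F_i,K_i^{\pm1}$ ($i=1,2$) with $K_iK_j=K_jK_i$, $K_iE_j=q^{a_{ij}}E_jK_i$, $K_iF_j=q^{-a_{ij}}F_jK_i$, $[E_i,F_j]=\delta_{ij}\frac{K_i-K_i^{-1}}{q-q^{-1}}$, and $E_i^2E_j-(q+q^{-1})E_iE_jE_i+E_jE_i^2=0$, $F_i^2F_j-(q+q^{-1})F_iF_jF_i+F_jF_i^2=0$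 for $i\ne j$. It is a Hopf $*$-algebra with $\Delta(E_i)=E_i\otimes K_i+1\otimes E_i$, $\Delta(F_i)=F_i\otimes1+K_i^{-1}\otimes F_i$, $\Delta(K_i)=K_i\otimes K_i$, $\varepsilon(E_i)=\varepsilon(F_i)=0$, $\varepsilon(K_i)=1$, $E_i^*=K_iF_i$, $F_i^*=E_iK_i^{-1}$, $K_i^*=K_i$. $A:=\mathcal{O}_q(\mathrm{SU}_3)$ is the Hopf subalgebra of the Hopf dual of $U_q(\mathfrak{sl}_3)$ generated by $u_{ij}$ ($1\le i,j\le3$), where $\Delta(u_{ij})=\sum_a u_{ia}\otimes u_{aj}$ and the only nonzero pairings of the $u_{ij}$ with the generators are $\langle E_1,u_{21}\rangle=\langle E_2,u_{32}\rangle=\langle F_1,u_{12}\rangle=\langle F_2,u_{23}\rangle=1$, $\langle K_i^{\pm1},u_{jj}\rangle=q^{\pm(\delta_{i,j-1}-\delta_{ij})}$. Put $X\triangleright a:=a_{(1)}\langle X,a_{(2)}\rangle$. Then $B:=\mathcal{O}_q(\mathrm{F}_3):=\{b\in A: K_i^{\pm1}\triangleright b=b,\ i=1,2\}$. Put $E_{\alpha_i}:=E_i$, $E_{\alpha_1+\alpha_2}:=E_2E_1-q^{-1}E_1E_2$, $F_\gamma:=E_\gamma^*$, and $T:=\mathrm{span}_{\mathbb{C}}\{E_\gamma,F_\gamma:\gamma\in\Delta^+\}$. $T$ defines the left $A$-covariant first-order differential calculus $\Omega^1_q(\mathrm{SU}_3)=A\otimes\Lambda^1$ over $A$: $\Lambda^1:=A^+/\{y\in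 A^+:X(y)=0\ \forall X\in T\}$ (with $A^+=\ker\varepsilon$) is a right $A$-module with basis $\{e_\gamma,f_\gamma\}$ dual to $\{E_\gamma,F_\gamma\}$, the bimodule structure is $a(b\otimes v)c=abc_{(1)}\otimes vc_{(2)}$, the left coaction is $\Delta\otimes\mathrm{id}$, and $\mathrm{d}a=\sum_\gamma (E_\gamma\triangleright a)\otimes e_\gamma+(F_\gamma\triangleright a)\otimes f_\gamma$. $\Omega^1_q(\mathrm{F}_3)$ is its restriction to $B$ (the $B$-sub-bimodule generated by $\mathrm{d}b$, $b\in B$). $\Omega^\bullet_q(\mathrm{F}_3)$ is the maximal prolongation of $\Omega^1_q(\mathrm{F}_3)$: the quotient of the tensor algebra of the $B$-bimodule $\Omega^1_q(\mathrm{F}_3)$ by the two-sided ideal generated by all $\sum_i\mathrm{d}b_i\otimes\mathrm{d}c_i$ with $b_i,c_i\in B$, $\sum_ib_i\,\mathrm{d}c_i=0$; it is left $A$-covariant. *)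

theory Defs
  imports Complex_Main "HOL-Library.Poly_Mapping" "HOL-Library.Product_Plus"
    "HOL-Library.Function_Algebras"
begin

section \<open>Complex vector spaces, quotients and tensor products\<close>

class complex_vector = ab_group_add +
  fixes scaleC :: "complex \<Rightarrow> 'a \<Rightarrow> 'a"  (infixr \<open>*\<^sub>C\<close> 75)
  assumes scaleC_add_right: "c *\<^sub>C (x + y) = c *\<^sub>C x + c *\<^sub>C y"
    and scaleC_add_left: "(c + c') *\<^sub>C x = c *\<^sub>C x + c' *\<^sub>C x"
    and scaleC_scaleC: "c *\<^sub>C (c' *\<^sub>C x) = (c * c') *\<^sub>C x"
    and scaleC_one: "1 *\<^sub>C x = x"

global_interpretation cvec: vector_space "scaleC :: complex \<Rightarrow> 'a \<Rightarrow> 'a::complex_vector"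
  by unfold_locales (simp_all add: scaleC_add_right scaleC_add_left scaleC_scaleC scaleC_one)

abbreviation clinear :: "('a::complex_vector \<Rightarrow> 'b::complex_vector) \<Rightarrow> bool"
  where "clinear \<equiv> Vector_Spaces.linear scaleC scaleC"

instantiation complex :: complex_vector
begin
definition scaleC_complex :: "complex \<Rightarrow> complex \<Rightarrow> complex"
  where "scaleC_complex c z = c * z"
instance by standard (simp_all add: scaleC_complex_def algebra_simps)
end

instantiation "fun" :: (type, complex_vector) complex_vector
begin
definition scaleC_fun :: "complex \<Rightarrow> ('a \<Rightarrow> 'b) \<Rightarrow> 'a \<Rightarrow> 'b"
  where "scaleC_fun c f = (\<lambda>x. c *\<^sub>C f x)"
instance
  by standard
    (simp_all add: scaleC_fun_def fun_eq_iff scaleC_add_right scaleC_add_left scaleC_scaleC scaleC_one)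
end

instantiation poly_mapping :: (type, complex_vector) complex_vector
begin
definition scaleC_poly_mapping :: "complex \<Rightarrow> ('a \<Rightarrow>\<^sub>0 'b) \<Rightarrow> 'a \<Rightarrow>\<^sub>0 'b"
  where "scaleC_poly_mapping c x = Poly_Mapping.map (scaleC c) x"

lemma lookup_scaleC: "Poly_Mapping.lookup (c *\<^sub>C x) k = c *\<^sub>C Poly_Mapping.lookup x k" for x :: "'a \<Rightarrow>\<^sub>0 'b"
  by (simp add: scaleC_poly_mapping_def Poly_Mapping.map.rep_eq when_def)

instance
  by standard
    (simp_all add: poly_mapping_eq_iff fun_eq_iff lookup_scaleC lookup_add
      scaleC_add_right scaleC_add_left scaleC_scaleC scaleC_one)
end

definition lext :: "('k \<Rightarrow> 'b::complex_vector) \<Rightarrow> ('k \<Rightarrow>\<^sub>0 complex) \<Rightarrow> 'b"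
  where "lext f t = (\<Sum>k\<in>Poly_Mapping.keys t. Poly_Mapping.lookup t k *\<^sub>C f k)"

text \<open>
  The quotient of a complex vector space by a subspace \<open>W\<close> is realized inside the space itself, as
  the range of a chosen linear idempotent with kernel \<open>W\<close>; the idempotent is the quotient map.
  Thus every element of the quotient is one of its own representatives, and a map defined on
  representatives is applied to a class by applying it to the class itself.
\<close>

definition qmap :: "'a::complex_vector set \<Rightarrow> 'a \<Rightarrow> 'a"
  where "qmap W = (SOME p. clinear p \<and> p \<circ> p = p \<and> {x. p x = 0} = W)"

lemma qmap_exists:
  fixes W :: "'a::complex_vector set"
  assumes W: "cvec.subspace W"
  shows "\<exists>p. clinear p \<and> p \<circ> p = p \<and> {x. p x = 0} = W"
proof -
  interpret vp: vector_space_pair "scaleC :: complex \<Rightarrow> 'a \<Rightarrow> 'a" "scaleC :: complex \<Rightarrow> 'a \<Rightarrow> 'a"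
    by unfold_locales
  obtain S where S: "S \<subseteq> W" "cvec.independent S" "W \<subseteq> cvec.span S"
    using cvec.maximal_independent_subset[of W] by blast
  have spS: "cvec.span S = W"
    using S W by (meson cvec.span_minimal subset_antisym)
  obtain Bs where Bs: "S \<subseteq> Bs" "cvec.independent Bs" "UNIV \<subseteq> cvec.span Bs"
    using cvec.maximal_independent_subset_extend[of S UNIV] S(2) by auto
  obtain p where p: "clinear p" "\<forall>x\<in>Bs. p x = (if x \<in> S then 0 else x)"
    using vp.linear_independent_extend[OF Bs(2), of "\<lambda>x. if x \<in> S then 0 else x"] by blast
  interpret p: Vector_Spaces.linear scaleC scaleC p by (rule p(1))
  have pW: "p x = 0" if "x \<in> W" for x
  proof (rule vp.linear_eq_0_on_span[OF p(1)])
    show "p y = 0" if "y \<in> S" for y using p(2) Bs(1) that by auto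
    show "x \<in> cvec.span S" using that spS by simp
  qed
  have diff: "x - p x \<in> W" for x
  proof -
    have "x \<in> cvec.span Bs" using Bs(3) by auto
    then show ?thesis
    proof (induction rule: cvec.span_induct_alt)
      case base
      then show ?case using W by (simp add: p.zero cvec.subspace_0)
    next
      case (step c x y)
      have "x - p x \<in> W"
        using p(2) step(1) S(1) W by (auto simp: cvec.subspace_0)
      then have "c *\<^sub>C (x - p x) + (y - p y) \<in> W"
        using step W by (simp add: cvec.subspace_add cvec.subspace_scale)
      then show ?case
        by (simp add: p.add p.scale algebra_simps cvec.scale_right_diff_distrib)
    qed
  qed
  have "p (p x) = p x" for x
    using pW[OF diff[of x]] by (simp add: p.diff)
  moreover have "x \<in> W" if "p x = 0" for x
    using diff[of x] that by simp
  ultimately show ?thesis using p(1) pW by (intro exI[of _ p]) (auto simp: fun_eq_iff)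
qed

lemma qmap:
  fixes W :: "'a::complex_vector set"
  assumes "cvec.subspace W"
  shows "clinear (qmap W)" "qmap W (qmap W x) = qmap W x" "qmap W x = 0 \<longleftrightarrow> x \<in> W"
proof -
  have "clinear (qmap W) \<and> qmap W \<circ> qmap W = qmap W \<and> {x. qmap W x = 0} = W"
    unfolding qmap_def by (rule someI_ex[OF qmap_exists[OF assms]])
  then show "clinear (qmap W)" "qmap W (qmap W x) = qmap W x" "qmap W x = 0 \<longleftrightarrow> x \<in> W"
    by (auto simp: fun_eq_iff)
qed

text \<open>
  For subspaces \<open>M\<close>, \<open>N\<close> the tensor product is the free vector space on \<open>M \<times> N\<close> modulo
  a space of relations.
\<close>

definition bilinear_rels :: "'m::complex_vector set \<Rightarrow> 'n::complex_vector set \<Rightarrow> ('m \<times> 'n \<Rightarrow>\<^sub>0 complex) set"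
  where "bilinear_rels M N =
    {Poly_Mapping.single (x + x', y) 1 - Poly_Mapping.single (x, y) 1 - Poly_Mapping.single (x', y) 1
      | x x' y. x \<in> M \<and> x' \<in> M \<and> y \<in> N} \<union>
    {Poly_Mapping.single (x, y + y') 1 - Poly_Mapping.single (x, y) 1 - Poly_Mapping.single (x, y') 1
      | x y y'. x \<in> M \<and> y \<in> N \<and> y' \<in> N} \<union>
    {Poly_Mapping.single (c *\<^sub>C x, y) 1 - Poly_Mapping.single (x, y) c | c x y. x \<in> M \<and> y \<in> N} \<union>
    {Poly_Mapping.single (x, c *\<^sub>C y) 1 - Poly_Mapping.single (x, y) c | c x y. x \<in> M \<and> y \<in> N}"

definition balanced_rels ::
  "'b set \<Rightarrow> ('m \<Rightarrow> 'b \<Rightarrow> 'm) \<Rightarrow> ('b \<Rightarrow> 'n \<Rightarrow> 'n) \<Rightarrow> 'm set \<Rightarrow> 'n set \<Rightarrow> ('m \<times> 'n \<Rightarrow>\<^sub>0 complex) set"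
  where "balanced_rels B r l M N =
    {Poly_Mapping.single (r x b, y) 1 - Poly_Mapping.single (x, l b y) 1
      | x b y. x \<in> M \<and> b \<in> B \<and> y \<in> N}"

definition tens :: "('m \<times> 'n \<Rightarrow>\<^sub>0 complex) set \<Rightarrow> 'm \<Rightarrow> 'n \<Rightarrow> ('m \<times> 'n \<Rightarrow>\<^sub>0 complex)"
  where "tens R x y = qmap (cvec.span R) (Poly_Mapping.single (x, y) 1)"

definition tens_space ::
  "('m \<times> 'n \<Rightarrow>\<^sub>0 complex) set \<Rightarrow> 'm set \<Rightarrow> 'n set \<Rightarrow> ('m \<times> 'n \<Rightarrow>\<^sub>0 complex) set"
  where "tens_space R M N = cvec.span {tens R x y | x y. x \<in> M \<and> y \<in> N}"

definition has_affine_dim :: "'a::complex_vector set \<Rightarrow> nat \<Rightarrow> bool"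
  where "has_affine_dim S n \<longleftrightarrow>
    (\<exists>x0 Bs. finite Bs \<and> cvec.independent Bs \<and> card Bs = n \<and> S = (\<lambda>v. x0 + v) ` cvec.span Bs)"


section \<open>The quantized enveloping algebra\<close>

datatype node = N1 | N2

datatype gen = gE node | gF node | gK node | gKinv node

datatype word = Word (letters: "gen list")

instantiation word :: monoid_add
begin
definition zero_word :: word where "zero_word = Word []"
definition plus_word :: "word \<Rightarrow> word \<Rightarrow> word" where "plus_word v w = Word (letters v @ letters w)"
instance by standard (simp_all add: zero_word_def plus_word_def)
end

text \<open>
  The free algebra on the generators is the monoid algebra of words, and its tensor square is the
  monoid algebra of pairs of words. Elements of the quantized enveloping algebra are represented in
  the free algebra; functionals on it are functionals on the free algebra that vanish on the ideal
  of relations.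
\<close>

type_synonym free = "word \<Rightarrow>\<^sub>0 complex"
type_synonym free2 = "word \<times> word \<Rightarrow>\<^sub>0 complex"

definition wd :: "word \<Rightarrow> free" where "wd w = Poly_Mapping.single w 1"

definition gn :: "gen \<Rightarrow> free" where "gn g = wd (Word [g])"

abbreviation E :: "node \<Rightarrow> free" where "E i \<equiv> gn (gE i)"
abbreviation F :: "node \<Rightarrow> free" where "F i \<equiv> gn (gF i)"
abbreviation K :: "node \<Rightarrow> free" where "K i \<equiv> gn (gK i)"
abbreviation Kinv :: "node \<Rightarrow> free" where "Kinv i \<equiv> gn (gKinv i)"

definition cartan :: "node \<Rightarrow> node \<Rightarrow> int" where "cartan i j = (if i = j then 2 else -1)"

definition qpow :: "real \<Rightarrow> int \<Rightarrow> complex" where "qpow q k = complex_of_real (q powi k)"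

definition uq_rels :: "real \<Rightarrow> free set"
  where "uq_rels q =
    (\<Union>i. {K i * Kinv i - 1, Kinv i * K i - 1}) \<union>
    (\<Union>i j. {K i * K j - K j * K i,
            K i * E j - qpow q (cartan i j) *\<^sub>C (E j * K i),
            K i * F j - qpow q (- cartan i j) *\<^sub>C (F j * K i),
            E i * F j - F j * E i -
              (if i = j then (1 / (qpow q 1 - qpow q (-1))) *\<^sub>C (K i - Kinv i) else 0)}) \<union>
    (\<Union>i. \<Union>j\<in>-{i}.
           {E i * E i * E j - (qpow q 1 + qpow q (-1)) *\<^sub>C (E i * E j * E i) + E j * E i * E i,
            F i * F i * F j - (qpow q 1 + qpow q (-1)) *\<^sub>C (F i * F j * F i) + F j * F i * F i})"

definition uq_ideal :: "real \<Rightarrow> free set"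
  where "uq_ideal q = cvec.span {x * r * y | x r y. r \<in> uq_rels q}"

definition tens_free :: "free \<Rightarrow> free \<Rightarrow> free2"
  where "tens_free x y = lext (\<lambda>v. lext (\<lambda>w. Poly_Mapping.single (v, w) 1) y) x"

fun comult_gen :: "gen \<Rightarrow> free2" where
  "comult_gen (gE i) = tens_free (E i) (K i) + tens_free 1 (E i)"
| "comult_gen (gF i) = tens_free (F i) 1 + tens_free (Kinv i) (F i)"
| "comult_gen (gK i) = tens_free (K i) (K i)"
| "comult_gen (gKinv i) = tens_free (Kinv i) (Kinv i)"

fun counit_gen :: "gen \<Rightarrow> complex" where
  "counit_gen (gE i) = 0"
| "counit_gen (gF i) = 0"
| "counit_gen (gK i) = 1"
| "counit_gen (gKinv i) = 1"

text \<open>The antipode is the one determined by the coproduct and the counit.\<close>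

fun antipode_gen :: "gen \<Rightarrow> free" where
  "antipode_gen (gE i) = - (E i * Kinv i)"
| "antipode_gen (gF i) = - (K i * F i)"
| "antipode_gen (gK i) = Kinv i"
| "antipode_gen (gKinv i) = K i"

fun star_gen :: "gen \<Rightarrow> free" where
  "star_gen (gE i) = K i * F i"
| "star_gen (gF i) = E i * Kinv i"
| "star_gen (gK i) = K i"
| "star_gen (gKinv i) = Kinv i"

definition comult :: "free \<Rightarrow> free2"
  where "comult = lext (\<lambda>w. prod_list (map comult_gen (letters w)))"

definition counit :: "free \<Rightarrow> complex"
  where "counit = lext (\<lambda>w. prod_list (map counit_gen (letters w)))"

definition antipode :: "free \<Rightarrow> free"
  where "antipode = lext (\<lambda>w. prod_list (map antipode_gen (rev (letters w))))"

definition star :: "free \<Rightarrow> free"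
  where "star x = (\<Sum>w\<in>Poly_Mapping.keys x.
    cnj (Poly_Mapping.lookup x w) *\<^sub>C prod_list (map star_gen (rev (letters w))))"


section \<open>The quantum group and the quantum flag manifold\<close>

type_synonym func = "free \<Rightarrow> complex"

definition uq_dual :: "real \<Rightarrow> func set"
  where "uq_dual q = {\<phi>. clinear \<phi> \<and> (\<forall>x\<in>uq_ideal q. \<phi> x = 0)}"

definition comult_in :: "func set \<Rightarrow> func \<Rightarrow> bool"
  where "comult_in S \<phi> \<longleftrightarrow> (\<exists>n a b. (\<forall>i<n. a i \<in> S \<and> b i \<in> S) \<and>
    (\<forall>x y. \<phi> (x * y) = (\<Sum>i<(n::nat). a i x * b i y)))"

definition hopf_dual :: "real \<Rightarrow> func set"
  where "hopf_dual q = {\<phi> \<in> uq_dual q. comult_in (uq_dual q) \<phi>}"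

definition conv :: "func \<Rightarrow> func \<Rightarrow> func"  (infixl \<open>\<star>\<close> 70)
  where "(\<phi> \<star> \<psi>) x = lext (\<lambda>(v, w). \<phi> (wd v) * \<psi> (wd w)) (comult x)"

definition hopf_subalgebra :: "real \<Rightarrow> func set \<Rightarrow> bool"
  where "hopf_subalgebra q S \<longleftrightarrow>
    S \<subseteq> hopf_dual q \<and> cvec.subspace S \<and> counit \<in> S \<and> (\<forall>\<phi>\<in>S. \<forall>\<psi>\<in>S. \<phi> \<star> \<psi> \<in> S) \<and>
    (\<forall>\<phi>\<in>S. comult_in S \<phi>) \<and> (\<forall>\<phi>\<in>S. \<phi> \<circ> antipode \<in> S)"

fun num :: "node \<Rightarrow> nat" where
  "num N1 = 1"
| "num N2 = 2"

fun pair_gen :: "real \<Rightarrow> gen \<Rightarrow> nat \<Rightarrow> nat \<Rightarrow> complex" where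
  "pair_gen q (gE v) i j = of_bool (i = num v + 1 \<and> j = num v)"
| "pair_gen q (gF v) i j = of_bool (i = num v \<and> j = num v + 1)"
| "pair_gen q (gK v) i j =
    (if i = j then qpow q (of_bool (num v + 1 = j) - of_bool (num v = j)) else 0)"
| "pair_gen q (gKinv v) i j =
    (if i = j then qpow q (- (of_bool (num v + 1 = j) - of_bool (num v = j))) else 0)"

text \<open>The coproduct of the \<open>u i j\<close> makes their pairing with a word a matrix product.\<close>

fun pair_word :: "real \<Rightarrow> gen list \<Rightarrow> nat \<Rightarrow> nat \<Rightarrow> complex" where
  "pair_word q [] i j = of_bool (i = j)"
| "pair_word q (g # gs) i j = (\<Sum>a\<in>{1..3}. pair_gen q g i a * pair_word q gs a j)"

definition u :: "real \<Rightarrow> nat \<Rightarrow> nat \<Rightarrow> func"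
  where "u q i j = lext (\<lambda>w. pair_word q (letters w) i j)"

definition OSU3 :: "real \<Rightarrow> func set"
  where "OSU3 q = hopf_subalgebra q hull {u q i j | i j. i \<in> {1..3} \<and> j \<in> {1..3}}"

text \<open>
  Sweedler's \<open>a\<^sub>(\<^sub>1\<^sub>)\<close> is evaluated at \<open>y\<close> and \<open>a\<^sub>(\<^sub>2\<^sub>)\<close> at \<open>x\<close> by evaluating \<open>a\<close> at \<open>y * x\<close>.
\<close>

definition act :: "free \<Rightarrow> func \<Rightarrow> func"  (infixr \<open>\<triangleright>\<close> 75)
  where "x \<triangleright> a = (\<lambda>y. a (y * x))"

definition OF3 :: "real \<Rightarrow> func set"
  where "OF3 q = {b \<in> OSU3 q. \<forall>i. K i \<triangleright> b = b \<and> Kinv i \<triangleright> b = b}"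


section \<open>The first-order calculus\<close>

datatype root = R1 | R2 | R12

datatype tix = Ix_E root | Ix_F root

fun Eroot :: "real \<Rightarrow> root \<Rightarrow> free" where
  "Eroot q R1 = E N1"
| "Eroot q R2 = E N2"
| "Eroot q R12 = E N2 * E N1 - qpow q (-1) *\<^sub>C (E N1 * E N2)"

fun tangent :: "real \<Rightarrow> tix \<Rightarrow> free" where
  "tangent q (Ix_E g) = Eroot q g"
| "tangent q (Ix_F g) = star (Eroot q g)"

text \<open>
  A family \<open>\<omega>\<close> of elements of \<open>OSU3 q\<close> indexed by \<open>tix\<close> stands for the element
  \<open>\<Sum>k. \<omega> k \<otimes> e k\<close> of the free left module on the basis of \<open>\<Lambda>\<^sup>1\<close> dual to \<open>tangent q\<close>. The class
  of \<open>y\<close> in \<open>\<Lambda>\<^sup>1\<close> has coordinates \<open>y (tangent q k)\<close>; the right action on \<open>\<Lambda>\<^sup>1\<close> is computed on a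
  representative of each basis element.
\<close>

type_synonym form = "tix \<Rightarrow> func"

definition dual_rep :: "real \<Rightarrow> tix \<Rightarrow> func"
  where "dual_rep q k =
    (SOME y. y \<in> OSU3 q \<and> y 1 = 0 \<and> (\<forall>j. y (tangent q j) = of_bool (j = k)))"

definition lmul :: "func \<Rightarrow> form \<Rightarrow> form"
  where "lmul a \<omega> = (\<lambda>k. a \<star> \<omega> k)"

text \<open>
  The component at \<open>j\<close> of \<open>(a \<otimes> e k) c = a c\<^sub>(\<^sub>1\<^sub>) \<otimes> e k c\<^sub>(\<^sub>2\<^sub>)\<close>; the inner function is
  \<open>c\<^sub>(\<^sub>1\<^sub>)\<close> times the coordinate at \<open>j\<close> of \<open>e k c\<^sub>(\<^sub>2\<^sub>)\<close>.
\<close>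

definition rmul :: "real \<Rightarrow> form \<Rightarrow> func \<Rightarrow> form"
  where "rmul q \<omega> c = (\<lambda>j. \<Sum>k\<in>UNIV.
    \<omega> k \<star> (\<lambda>z. (dual_rep q k \<star> (\<lambda>y. c (z * y))) (tangent q j)))"

definition dd :: "real \<Rightarrow> func \<Rightarrow> form"
  where "dd q a = (\<lambda>k. tangent q k \<triangleright> a)"

definition Om1 :: "real \<Rightarrow> form set"
  where "Om1 q = cvec.span {lmul b (rmul q (dd q c) b') | b c b'. b \<in> OF3 q \<and> c \<in> OF3 q \<and> b' \<in> OF3 q}"


section \<open>The tensor square over the flag manifold and the two-forms\<close>

type_synonym form2 = "form \<times> form \<Rightarrow>\<^sub>0 complex"

definition relsB :: "real \<Rightarrow> form2 set"
  where "relsB q = bilinear_rels (Om1 q) (Om1 q) \<union> balanced_rels (OF3 q) (rmul q) lmul (Om1 q) (Om1 q)"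

definition tensB :: "real \<Rightarrow> form \<Rightarrow> form \<Rightarrow> form2"
  where "tensB q = tens (relsB q)"

definition Om1_Om1 :: "real \<Rightarrow> form2 set"
  where "Om1_Om1 q = tens_space (relsB q) (Om1 q) (Om1 q)"

definition lmul2 :: "real \<Rightarrow> func \<Rightarrow> form2 \<Rightarrow> form2"
  where "lmul2 q b = lext (\<lambda>(\<omega>, \<eta>). tensB q (lmul b \<omega>) \<eta>)"

definition rmul2 :: "real \<Rightarrow> form2 \<Rightarrow> func \<Rightarrow> form2"
  where "rmul2 q t b = lext (\<lambda>(\<omega>, \<eta>). tensB q \<omega> (rmul q \<eta> b)) t"

text \<open>
  The ideal of the tensor algebra defining the maximal prolongation is generated in degree two, so
  its degree-two part is the sub-bimodule of \<open>Om1_Om1 q\<close> generated by the same elements, and the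
  two-forms are the image of \<open>Om1_Om1 q\<close> under \<open>wedge q\<close>.
\<close>

definition prolong_gens :: "real \<Rightarrow> form2 set"
  where "prolong_gens q =
    {\<Sum>i<n. tensB q (dd q (b i)) (dd q (c i)) | (n::nat) b c.
      (\<forall>i<n. b i \<in> OF3 q \<and> c i \<in> OF3 q) \<and> (\<Sum>i<n. lmul (b i) (dd q (c i))) = 0}"

definition prolong_rels :: "real \<Rightarrow> form2 set"
  where "prolong_rels q =
    cvec.span {lmul2 q b (rmul2 q t c) | b t c. b \<in> OF3 q \<and> t \<in> prolong_gens q \<and> c \<in> OF3 q}"

definition wedge :: "real \<Rightarrow> form2 \<Rightarrow> form2"
  where "wedge q = qmap (prolong_rels q)"

definition dd1 :: "real \<Rightarrow> form \<Rightarrow> form2"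
  where "dd1 q \<omega> = (THE \<theta>. \<exists>(n::nat) b c. (\<forall>i<n. b i \<in> OF3 q \<and> c i \<in> OF3 q) \<and>
    \<omega> = (\<Sum>i<n. lmul (b i) (dd q (c i))) \<and>
    \<theta> = wedge q (\<Sum>i<n. tensB q (dd q (b i)) (dd q (c i))))"


section \<open>Covariance and connections\<close>

definition relsA1 :: "real \<Rightarrow> (func \<times> form \<Rightarrow>\<^sub>0 complex) set"
  where "relsA1 q = bilinear_rels (OSU3 q) (Om1 q)"

definition relsA2 :: "real \<Rightarrow> (func \<times> form2 \<Rightarrow>\<^sub>0 complex) set"
  where "relsA2 q = bilinear_rels (OSU3 q) (Om1_Om1 q)"

text \<open>
  The coaction \<open>\<Delta> \<otimes> id\<close> on \<open>Om1 q\<close>: the unique element of the tensor product of \<open>OSU3 q\<close> and \<open>Om1 q\<close>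
  whose components agree with the coproducts of the components of \<open>\<omega>\<close>, the latter being
  determined by their values on pairs \<open>(x, y)\<close>.
\<close>

definition coact1 :: "real \<Rightarrow> form \<Rightarrow> (func \<times> form \<Rightarrow>\<^sub>0 complex)"
  where "coact1 q \<omega> = (THE t. t \<in> tens_space (relsA1 q) (OSU3 q) (Om1 q) \<and>
    (\<forall>k x y. \<omega> k (x * y) = lext (\<lambda>(a, \<eta>). a x * \<eta> k y) t))"

definition coact2 :: "real \<Rightarrow> form2 \<Rightarrow> (func \<times> form2 \<Rightarrow>\<^sub>0 complex)"
  where "coact2 q = lext (\<lambda>(\<omega>, \<eta>).
    lext (\<lambda>(a, \<omega>'). lext (\<lambda>(b, \<eta>'). tens (relsA2 q) (a \<star> b) (tensB q \<omega>' \<eta>')) (coact1 q \<eta>))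
      (coact1 q \<omega>))"

text \<open>
  Maps on \<open>Om1 q\<close> are extended by zero, so that equality of functions is equality on \<open>Om1 q\<close>.
\<close>

definition connection :: "real \<Rightarrow> (form \<Rightarrow> form2) \<Rightarrow> bool"
  where "connection q D \<longleftrightarrow>
    (\<forall>\<omega>. \<omega> \<notin> Om1 q \<longrightarrow> D \<omega> = 0) \<and>
    (\<forall>\<omega>\<in>Om1 q. D \<omega> \<in> Om1_Om1 q) \<and>
    (\<forall>\<omega>\<in>Om1 q. \<forall>\<eta>\<in>Om1 q. D (\<omega> + \<eta>) = D \<omega> + D \<eta>) \<and>
    (\<forall>c. \<forall>\<omega>\<in>Om1 q. D (c *\<^sub>C \<omega>) = c *\<^sub>C D \<omega>) \<and>
    (\<forall>b\<in>OF3 q. \<forall>\<omega>\<in>Om1 q. D (lmul b \<omega>) = tensB q (dd q b) \<omega> + lmul2 q b (D \<omega>))"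

definition left_covariant :: "real \<Rightarrow> (form \<Rightarrow> form2) \<Rightarrow> bool"
  where "left_covariant q D \<longleftrightarrow>
    (\<forall>\<omega>\<in>Om1 q. coact2 q (D \<omega>) = lext (\<lambda>(a, \<eta>). tens (relsA2 q) a (D \<eta>)) (coact1 q \<omega>))"

definition torsion_free :: "real \<Rightarrow> (form \<Rightarrow> form2) \<Rightarrow> bool"
  where "torsion_free q D \<longleftrightarrow> (\<forall>\<omega>\<in>Om1 q. wedge q (D \<omega>) = dd1 q \<omega>)"

end

theory Submission
  imports Defs
begin

text \<open>
  Write \<open>A\<close> for the quantum group and \<open>B\<close> for the flag manifold, the weight zero part of \<open>A\<close>. The
  matrix coefficients give partitions of unity of every weight, which replace faithful flatness:
  they identify the one-forms with the families \<open>(\<omega> k)\<close> where \<open>\<omega> k\<close> has the weight of the tangent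
  vector \<open>T k\<close>, and their tensor square with the families \<open>(\<Theta> l k)\<close> where \<open>\<Theta> l k\<close> has the sum of the
  two weights. Under these identifications \<open>\<omega> \<mapsto> (T k \<triangleright> \<omega> l)\<close> is a covariant connection. By
  covariance, a left linear covariant map from one-forms to the tensor square is determined by its
  values at the counit; it has constant coefficients, which vanish unless the weight of \<open>T m\<close> is that
  of \<open>T k\<close> plus that of \<open>T l\<close>. Each of the six roots is a sum of two roots in exactly one way up to
  order, which gives dimension 12.

  For each root \<open>m = k + l\<close> there is exactly one relation \<open>T k T l + x T l T k = \<kappa> T m\<close> on \<open>B\<close>. The
  Leibniz rule shows that the generators of the prolongation relations already form a bimodule, and
  in the degree of a root they are cut out by the transpose of this relation. Hence vanishing
  torsion is one inhomogeneous linear condition per root, which leaves dimension 6.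
\<close>

section \<open>Linear extension and duality on the free algebra\<close>

text \<open>The partitions of unity come from one identity. For \<open>y\<close> in \<open>B\<close>
  the form \<open>S(y(1)) dy(2)\<close> is left invariant with coefficients \<open>y(T j)\<close>.
  Functions \<open>y = \<Sum>j. z j * U m j * S(U j n)\<close> dual to the tangent vectors thus
  express basis forms through differentials from \<open>B\<close>, and all antipodes are computable
  because the square of the antipode only rescales the matrix coefficients.

  The quadratic relations hold on \<open>B\<close> only, since commuting an E past an F leaves
  powers of \<open>K i\<close>, which act as 1 there. They bound the prolongation relations from
  above. The bound from below needs explicit elements: a function \<open>y\<close> in
  \<open>B\<close> that vanishes on all tangent vectors but not on the product of the two whose
  roots have sum \<open>m\<close>. Then \<open>S(y(1)) dy(2) = 0\<close>, and differentiating this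
  gives a nonzero prolongation relation in degree \<open>m\<close>.

  The quantum group is given only as a least Hopf subalgebra of functionals. Identities in it are
  therefore checked on words, by translating with one generator at a time. Every comparison of
  weights rests on \<open>q\<close> not being a root of unity.\<close>

lemma clinearI:
  assumes "\<And>x y. f (x + y) = f x + f y" "\<And>c x. f (c *\<^sub>C x) = c *\<^sub>C f x"
  shows "clinear f"
  by unfold_locales (use assms in auto)

lemma clinear_add: "clinear f \<Longrightarrow> f (x + y) = f x + f y"
  by (simp add: Vector_Spaces.linear_iff)

lemma clinear_scale: "clinear f \<Longrightarrow> f (c *\<^sub>C x) = c *\<^sub>C f x"
  by (simp add: Vector_Spaces.linear_iff)

lemma clinear_module_hom: "clinear f \<Longrightarrow> module_hom scaleC scaleC f"
  by (simp add: Vector_Spaces.linear_def)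

lemmas clinear_zero = module_hom.zero[OF clinear_module_hom]
  and clinear_neg = module_hom.neg[OF clinear_module_hom]
  and clinear_diff = module_hom.diff[OF clinear_module_hom]
  and clinear_sum = module_hom.sum[OF clinear_module_hom]

lemma scaleC_fun_apply: "(c *\<^sub>C f) x = c *\<^sub>C f x"
  by (simp add: scaleC_fun_def)

lemma sum_fun_apply: "(\<Sum>i\<in>I. f i) x = (\<Sum>i\<in>I. f i x)"
  by (induction I rule: infinite_finite_induct) auto

lemma clinear_comp: "clinear f \<Longrightarrow> clinear g \<Longrightarrow> clinear (\<lambda>x. f (g x))"
  by (simp add: clinearI clinear_add clinear_scale)

lemma clinear_plus: "clinear f \<Longrightarrow> clinear g \<Longrightarrow> clinear (f + g)"
  by (rule clinearI) (simp_all add: clinear_add clinear_scale algebra_simps scaleC_add_right)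

lemma clinear_scaleC: "clinear f \<Longrightarrow> clinear (c *\<^sub>C f)"
  by (rule clinearI)
    (simp_all add: clinear_add clinear_scale scaleC_add_right scaleC_scaleC mult.commute scaleC_fun_apply)

lemma clinear_0: "clinear 0"
  by (rule clinearI) simp_all

lemma clinear_eq_on_span:
  assumes "clinear f" "clinear g" "\<And>x. x \<in> S \<Longrightarrow> f x = g x" "x \<in> cvec.span S"
  shows "f x = g x"
  using assms(4)
  by (induction rule: cvec.span_induct_alt)
    (use assms in \<open>auto simp: clinear_zero clinear_add clinear_scale\<close>)

lemma clinear_span_subset:
  assumes "clinear f" "cvec.subspace V" "\<And>x. x \<in> S \<Longrightarrow> f x \<in> V" "x \<in> cvec.span S"
  shows "f x \<in> V"
  using assms(4)
  by (induction rule: cvec.span_induct_alt)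
    (use assms in \<open>auto simp: clinear_zero clinear_add clinear_scale
       intro: cvec.subspace_0 cvec.subspace_add cvec.subspace_scale\<close>)

lemma sum_single: "t = (\<Sum>k\<in>Poly_Mapping.keys t. Poly_Mapping.single k (Poly_Mapping.lookup t k))"
  by (rule poly_mapping_eqI) (auto simp: lookup_sum lookup_single when_def in_keys_iff sum.delta)

lemma lext_superset:
  assumes "finite S" "Poly_Mapping.keys t \<subseteq> S"
  shows "lext f t = (\<Sum>k\<in>S. Poly_Mapping.lookup t k *\<^sub>C f k)"
  unfolding lext_def
  by (rule sum.mono_neutral_left) (use assms in \<open>auto simp: in_keys_iff\<close>)

lemma lext_linear: "clinear (lext f)"
proof (rule clinearI)
  fix x y :: "'a \<Rightarrow>\<^sub>0 complex" and c
  let ?S = "Poly_Mapping.keys x \<union> Poly_Mapping.keys y"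
  have "Poly_Mapping.keys (x + y) \<subseteq> ?S" by (rule Poly_Mapping.keys_add)
  then show "lext f (x + y) = lext f x + lext f y"
    by (simp add: lext_superset[of ?S] lookup_add scaleC_add_left sum.distrib)
  have "Poly_Mapping.keys (c *\<^sub>C x) \<subseteq> Poly_Mapping.keys x"
    by (auto simp: in_keys_iff lookup_scaleC scaleC_complex_def)
  then show "lext f (c *\<^sub>C x) = c *\<^sub>C lext f x"
    by (simp add: lext_superset[of "Poly_Mapping.keys x"] lookup_scaleC cvec.scale_sum_right
        scaleC_scaleC scaleC_complex_def)
qed

lemmas lext_add = clinear_add[OF lext_linear]
  and lext_scale = clinear_scale[OF lext_linear]
  and lext_zero [simp] = clinear_zero[OF lext_linear]
  and lext_diff = clinear_diff[OF lext_linear]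
  and lext_sum = clinear_sum[OF lext_linear]

lemma lext_single [simp]: "lext f (Poly_Mapping.single k c) = c *\<^sub>C f k"
  by (simp add: lext_def)

lemma scaleC_single: "c *\<^sub>C Poly_Mapping.single k d = Poly_Mapping.single k (c * d)"
  by (rule poly_mapping_eqI) (auto simp: lookup_scaleC lookup_single when_def scaleC_complex_def)

lemma lext_eta: "clinear f \<Longrightarrow> lext (\<lambda>k. f (Poly_Mapping.single k 1)) t = f t"
  by (subst (2) sum_single)
    (simp add: lext_def clinear_sum clinear_scale[symmetric] scaleC_single)

lemma clinear_eqI:
  fixes f g :: "('k \<Rightarrow>\<^sub>0 complex) \<Rightarrow> 'b::complex_vector"
  assumes "clinear f" "clinear g" "\<And>k. f (Poly_Mapping.single k 1) = g (Poly_Mapping.single k 1)"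
  shows "f = g"
proof
  fix t
  have "f t = lext (\<lambda>k. f (Poly_Mapping.single k 1)) t" by (rule lext_eta[OF assms(1), symmetric])
  also have "\<dots> = lext (\<lambda>k. g (Poly_Mapping.single k 1)) t" by (simp only: assms(3))
  also have "\<dots> = g t" by (rule lext_eta[OF assms(2)])
  finally show "f t = g t" .
qed

lemma lext_fun_add: "lext (\<lambda>k. f k + g k) t = lext f t + lext g t"
  unfolding lext_def by (simp add: scaleC_add_right sum.distrib)

lemma lext_fun_scale: "lext (\<lambda>k. c *\<^sub>C f k) t = c *\<^sub>C lext f t"
  unfolding lext_def cvec.scale_sum_right by (rule sum.cong[OF refl]) (rule cvec.scale_left_commute)

subsection \<open>Multiplication of words\<close>

lemma scaleC_mult_left: "(c *\<^sub>C x) * y = c *\<^sub>C (x * y)" for x y :: "'a::monoid_add \<Rightarrow>\<^sub>0 complex"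
proof -
  have "c *\<^sub>C z = Poly_Mapping.single 0 c * z" for z :: "'a \<Rightarrow>\<^sub>0 complex"
  proof -
    have "(\<lambda>z. c *\<^sub>C z) = (\<lambda>z :: 'a \<Rightarrow>\<^sub>0 complex. Poly_Mapping.map ((*) c) z)"
      by (auto simp: scaleC_poly_mapping_def scaleC_complex_def[abs_def])
    then show ?thesis by (simp add: mult_map_scale_conv_mult fun_eq_iff scaleC_fun_apply)
  qed
  then show ?thesis by (simp add: mult.assoc)
qed

lemma clinear_mult_left: "clinear (\<lambda>x. x * y)" for y :: "'a::monoid_add \<Rightarrow>\<^sub>0 complex"
  by (rule clinearI) (simp_all add: scaleC_mult_left distrib_right)

text \<open>Scalars sit at the empty word, which is central, so scaling is also a multiplication
  from the right.\<close>

lemma clinear_mult_right: "clinear (\<lambda>y. x * y)" for x :: "'a::monoid_add \<Rightarrow>\<^sub>0 complex"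
proof -
  have "(\<lambda>z. z * Poly_Mapping.single 0 c) = (\<lambda>z :: 'a \<Rightarrow>\<^sub>0 complex. c *\<^sub>C z)" for c
  proof (rule clinear_eqI[OF clinear_mult_left])
    show "clinear (\<lambda>z :: 'a \<Rightarrow>\<^sub>0 complex. c *\<^sub>C z)"
      by (rule clinearI) (simp_all add: scaleC_add_right scaleC_scaleC mult.commute scaleC_fun_apply)
  qed (simp add: mult_single scaleC_single)
  then have *: "c *\<^sub>C z = z * Poly_Mapping.single 0 c" for c and z :: "'a \<Rightarrow>\<^sub>0 complex"
    by (simp add: fun_eq_iff scaleC_fun_apply)
  show ?thesis
    by (rule clinearI) (simp_all add: * distrib_left mult.assoc)
qed

lemmas scaleC_mult_right = clinear_scale[OF clinear_mult_right]

lemma one_eq_wd: "1 = wd 0"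
  by (simp add: wd_def)

lemma wd_mult: "wd v * wd w = wd (v + w)"
  by (simp add: wd_def mult_single)

lemma wd_Cons: "wd (Word (g # gs)) = gn g * wd (Word gs)"
  by (simp add: gn_def wd_mult plus_word_def)

lemma wd_snoc: "wd (Word (gs @ [g])) = wd (Word gs) * gn g"
  by (simp add: gn_def wd_mult plus_word_def)

lemma wd_Nil: "wd (Word []) = 1"
  by (simp add: one_eq_wd zero_word_def)

lemma lext_wd [simp]: "lext f (wd w) = f w"
  by (simp add: wd_def scaleC_one)

lemma clinear_eq_wdI:
  assumes "clinear f" "clinear g" "\<And>gs. f (wd (Word gs)) = g (wd (Word gs))"
  shows "f = g"
proof (rule clinear_eqI[OF assms(1,2)])
  show "f (Poly_Mapping.single k 1) = g (Poly_Mapping.single k 1)" for k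
    using assms(3)[of "letters k"] by (simp add: wd_def)
qed

text \<open>Bilinear expressions are compared on pairs of words; the product formulas for
  \<open>comult\<close>, \<open>counit\<close>, \<open>antipode\<close> and \<open>u\<close> are
  proved this way.\<close>

lemma clinear_mult_eqI:
  assumes "\<And>y. clinear (\<lambda>x. f x y)" "\<And>x. clinear (f x)"
    "\<And>y. clinear (\<lambda>x. g x y)" "\<And>x. clinear (g x)"
    "\<And>v w. f (wd v) (wd w) = g (wd v) (wd w)"
  shows "f x y = g x y"
proof -
  have "(\<lambda>x. f x (wd (Word gs))) = (\<lambda>x. g x (wd (Word gs)))" for gs
    by (rule clinear_eq_wdI) (use assms in auto)
  then have "f x = g x"
    by (intro clinear_eq_wdI) (use assms in \<open>auto simp: fun_eq_iff scaleC_fun_apply\<close>)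
  then show ?thesis by simp
qed

section \<open>The convolution product\<close>

text \<open>Evaluates the first Sweedler leg of \<open>a\<close> at \<open>x\<close>, whereas
  \<open>x \<triangleright> a\<close> evaluates the second.\<close>

definition ltr :: "free \<Rightarrow> func \<Rightarrow> func"
  where "ltr x a = (\<lambda>y. a (x * y))"

definition tens_func :: "func \<Rightarrow> func \<Rightarrow> free2 \<Rightarrow> complex"
  where "tens_func \<phi> \<psi> = lext (\<lambda>(v, w). \<phi> (wd v) * \<psi> (wd w))"

lemma conv_tens_func: "(\<phi> \<star> \<psi>) x = tens_func \<phi> \<psi> (comult x)"
  by (simp add: conv_def tens_func_def)

lemma clinear_tens_func: "clinear (tens_func \<phi> \<psi>)"
  by (simp add: tens_func_def lext_linear)

lemma clinear_ltr: "clinear a \<Longrightarrow> clinear (ltr x a)"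
  unfolding ltr_def by (rule clinear_comp[OF _ clinear_mult_right])

lemma clinear_act: "clinear a \<Longrightarrow> clinear (x \<triangleright> a)"
  unfolding act_def by (rule clinear_comp[OF _ clinear_mult_left])

lemma tens_free_wd: "tens_free (wd v) (wd w) = Poly_Mapping.single (v, w) 1"
  by (simp add: tens_free_def)

lemma clinear_tens_free_left: "clinear (\<lambda>x. tens_free x y)"
  unfolding tens_free_def by (rule lext_linear)

lemma clinear_tens_free_right: "clinear (tens_free x)"
  unfolding tens_free_def by (rule clinearI) (simp_all only: lext_add lext_scale lext_fun_add lext_fun_scale)

text \<open>Multiplication in the tensor square becomes translation in each leg. As the coproduct is
  multiplicative, this yields the twisted Leibniz rules \<open>act_conv\<close> and
  \<open>ltr_conv\<close>.\<close>

lemma tens_func_mult: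
  assumes "clinear \<phi>" "clinear \<psi>"
  shows "tens_func \<phi> \<psi> (tens_free a b * t) = tens_func (ltr a \<phi>) (ltr b \<psi>) t"
    and "tens_func \<phi> \<psi> (t * tens_free a b) = tens_func (a \<triangleright> \<phi>) (b \<triangleright> \<psi>) t"
proof -
  note lin = clinear_comp[OF clinear_tens_func clinear_comp[OF clinear_mult_left clinear_tens_free_left]]
    clinear_comp[OF clinear_tens_func clinear_comp[OF clinear_mult_left clinear_tens_free_right]]
    clinear_comp[OF clinear_tens_func clinear_comp[OF clinear_mult_right clinear_tens_free_left]]
    clinear_comp[OF clinear_tens_func clinear_comp[OF clinear_mult_right clinear_tens_free_right]]
  have word: "tens_func \<phi> \<psi> (tens_free a b * Poly_Mapping.single (v, w) 1) =
      \<phi> (a * wd v) * \<psi> (b * wd w)" for v w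
  proof (rule clinear_mult_eqI[of "\<lambda>a b. tens_func \<phi> \<psi> (tens_free a b * Poly_Mapping.single (v, w) 1)"])
    fix v' w'
    show "tens_func \<phi> \<psi> (tens_free (wd v') (wd w') * Poly_Mapping.single (v, w) 1) =
      \<phi> (wd v' * wd v) * \<psi> (wd w' * wd w)"
      by (simp add: tens_free_wd mult_single tens_func_def scaleC_one wd_mult)
  qed (use assms lin in \<open>auto intro!: clinearI
       simp: clinear_add distrib_right scaleC_mult_left clinear_scale scaleC_complex_def algebra_simps\<close>)
  have word': "tens_func \<phi> \<psi> (Poly_Mapping.single (v, w) 1 * tens_free a b) =
      \<phi> (wd v * a) * \<psi> (wd w * b)" for v w
  proof (rule clinear_mult_eqI[of "\<lambda>a b. tens_func \<phi> \<psi> (Poly_Mapping.single (v, w) 1 * tens_free a b)"])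
    fix v' w'
    show "tens_func \<phi> \<psi> (Poly_Mapping.single (v, w) 1 * tens_free (wd v') (wd w')) =
      \<phi> (wd v * wd v') * \<psi> (wd w * wd w')"
      by (simp add: tens_free_wd mult_single tens_func_def scaleC_one wd_mult)
  qed (use assms lin in \<open>auto intro!: clinearI
       simp: clinear_add distrib_left scaleC_mult_right clinear_scale scaleC_complex_def algebra_simps\<close>)
  have "(\<lambda>t. tens_func \<phi> \<psi> (tens_free a b * t)) = tens_func (ltr a \<phi>) (ltr b \<psi>)"
  proof (rule clinear_eqI)
    show "clinear (\<lambda>t. tens_func \<phi> \<psi> (tens_free a b * t))"
      by (rule clinear_comp[OF clinear_tens_func clinear_mult_right])
    fix k :: "word \<times> word"
    show "tens_func \<phi> \<psi> (tens_free a b * Poly_Mapping.single k 1) =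
        tens_func (ltr a \<phi>) (ltr b \<psi>) (Poly_Mapping.single k 1)"
      by (cases k) (simp add: word, simp add: tens_func_def scaleC_one ltr_def)
  qed (rule clinear_tens_func)
  then show "tens_func \<phi> \<psi> (tens_free a b * t) = tens_func (ltr a \<phi>) (ltr b \<psi>) t"
    by (rule fun_cong)
  have "(\<lambda>t. tens_func \<phi> \<psi> (t * tens_free a b)) = tens_func (a \<triangleright> \<phi>) (b \<triangleright> \<psi>)"
  proof (rule clinear_eqI)
    show "clinear (\<lambda>t. tens_func \<phi> \<psi> (t * tens_free a b))"
      by (rule clinear_comp[OF clinear_tens_func clinear_mult_left])
    fix k :: "word \<times> word"
    show "tens_func \<phi> \<psi> (Poly_Mapping.single k 1 * tens_free a b) =
        tens_func (a \<triangleright> \<phi>) (b \<triangleright> \<psi>) (Poly_Mapping.single k 1)"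
      by (cases k) (simp add: word', simp add: tens_func_def scaleC_one act_def)
  qed (rule clinear_tens_func)
  then show "tens_func \<phi> \<psi> (t * tens_free a b) = tens_func (a \<triangleright> \<phi>) (b \<triangleright> \<psi>) t"
    by (rule fun_cong)
qed

lemma clinear_comult: "clinear comult"
  by (simp add: comult_def lext_linear)

lemma comult_mult: "comult (x * y) = comult x * comult y"
proof (rule clinear_mult_eqI[of "\<lambda>x y. comult (x * y)"])
  fix v w
  show "comult (wd v * wd w) = comult (wd v) * comult (wd w)"
    by (simp add: wd_mult comult_def plus_word_def)
qed (auto intro: clinear_comp[OF clinear_comult clinear_mult_right]
    clinear_comp[OF clinear_comult clinear_mult_left]
    clinear_comp[OF clinear_mult_right clinear_comult]
    clinear_comp[OF clinear_mult_left clinear_comult])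

lemma comult_gn: "comult (gn g) = comult_gen g"
  by (simp add: comult_def gn_def)

lemma comult_one: "comult 1 = 1"
  by (simp add: comult_def one_eq_wd zero_word_def)

lemma tens_func_one: "tens_func \<phi> \<psi> 1 = \<phi> 1 * \<psi> 1"
proof -
  have "1 = (Poly_Mapping.single (0, 0) 1 :: free2)"
    by (simp add: zero_prod_def[symmetric])
  then have "tens_func \<phi> \<psi> 1 = tens_func \<phi> \<psi> (Poly_Mapping.single (0, 0) 1)"
    by (rule arg_cong)
  also have "\<dots> = 1 *\<^sub>C (case (0, 0) of (v, w) \<Rightarrow> \<phi> (wd v) * \<psi> (wd w))"
    unfolding tens_func_def by (rule lext_single)
  finally show ?thesis by (simp add: one_eq_wd scaleC_one)
qed

lemma conv_one: "(\<phi> \<star> \<psi>) 1 = \<phi> 1 * \<psi> 1"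
  by (simp add: conv_tens_func comult_one tens_func_one)

lemma clinear_conv: "clinear (\<phi> \<star> \<psi>)"
  using clinear_comp[OF clinear_tens_func clinear_comult] by (simp add: conv_tens_func[abs_def])

lemma conv_add_left: "(\<phi> + \<phi>') \<star> \<psi> = \<phi> \<star> \<psi> + \<phi>' \<star> \<psi>"
  and conv_add_right: "\<phi> \<star> (\<psi> + \<psi>') = \<phi> \<star> \<psi> + \<phi> \<star> \<psi>'"
  and conv_scale_left: "(c *\<^sub>C \<phi>) \<star> \<psi> = c *\<^sub>C (\<phi> \<star> \<psi>)"
  and conv_scale_right: "\<phi> \<star> (c *\<^sub>C \<psi>) = c *\<^sub>C (\<phi> \<star> \<psi>)"
  by (simp_all add: fun_eq_iff scaleC_fun_apply conv_def lext_def split_def scaleC_complex_def sum.distrib[symmetric]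
      sum_distrib_left algebra_simps)

lemma clinear_conv_left: "clinear (\<lambda>\<phi>. \<phi> \<star> \<psi>)"
  by (rule clinearI) (simp_all add: conv_add_left conv_scale_left)

lemma clinear_conv_right: "clinear (\<lambda>\<psi>. \<phi> \<star> \<psi>)"
  by (rule clinearI) (simp_all add: conv_add_right conv_scale_right)

lemmas conv_zero_left [simp] = clinear_zero[OF clinear_conv_left]
  and conv_zero_right [simp] = clinear_zero[OF clinear_conv_right]
  and conv_neg_left = clinear_neg[OF clinear_conv_left]
  and conv_neg_right = clinear_neg[OF clinear_conv_right]
  and conv_diff_left = clinear_diff[OF clinear_conv_left]
  and conv_diff_right = clinear_diff[OF clinear_conv_right]
  and conv_sum_left = clinear_sum[OF clinear_conv_left]
  and conv_sum_right = clinear_sum[OF clinear_conv_right]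

lemma act_mult: "(x * y) \<triangleright> a = x \<triangleright> y \<triangleright> a"
  by (simp add: act_def mult.assoc)

lemma act_one [simp]: "1 \<triangleright> a = a"
  by (simp add: act_def)

lemma ltr_one [simp]: "ltr 1 a = a"
  by (simp add: ltr_def)

lemma clinear_act_right: "clinear (\<lambda>a. x \<triangleright> a)"
  by (rule clinearI) (simp_all add: act_def fun_eq_iff scaleC_fun_apply)

lemma clinear_act_left: "clinear a \<Longrightarrow> clinear (\<lambda>x. x \<triangleright> a)"
  by (rule clinearI)
    (simp_all add: act_def fun_eq_iff scaleC_fun_apply distrib_left clinear_add clinear_scale scaleC_mult_right)

lemmas act_add = clinear_add[OF clinear_act_right]
  and act_scale = clinear_scale[OF clinear_act_right]
  and act_zero [simp] = clinear_zero[OF clinear_act_right]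
  and act_neg = clinear_neg[OF clinear_act_right]
  and act_diff = clinear_diff[OF clinear_act_right]
  and act_sum = clinear_sum[OF clinear_act_right]
  and add_act = clinear_add[OF clinear_act_left]
  and scale_act = clinear_scale[OF clinear_act_left]
  and zero_act = clinear_zero[OF clinear_act_left]
  and neg_act = clinear_neg[OF clinear_act_left]
  and diff_act = clinear_diff[OF clinear_act_left]

lemma clinear_ltr_right: "clinear (\<lambda>a. ltr x a)"
  by (rule clinearI) (simp_all add: ltr_def fun_eq_iff scaleC_fun_apply)

lemmas ltr_add = clinear_add[OF clinear_ltr_right]
  and ltr_scale = clinear_scale[OF clinear_ltr_right]

lemma conv_act_tens_func: "(x \<triangleright> (\<phi> \<star> \<psi>)) y = tens_func \<phi> \<psi> (comult y * comult x)"
  by (simp add: act_def conv_tens_func comult_mult)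

lemma conv_ltr_tens_func: "ltr x (\<phi> \<star> \<psi>) y = tens_func \<phi> \<psi> (comult x * comult y)"
  by (simp add: ltr_def conv_tens_func comult_mult)

lemma act_conv:
  assumes "clinear \<phi>" "clinear \<psi>"
  shows "E i \<triangleright> (\<phi> \<star> \<psi>) = (E i \<triangleright> \<phi>) \<star> (K i \<triangleright> \<psi>) + \<phi> \<star> (E i \<triangleright> \<psi>)"
    and "F i \<triangleright> (\<phi> \<star> \<psi>) = (F i \<triangleright> \<phi>) \<star> \<psi> + (Kinv i \<triangleright> \<phi>) \<star> (F i \<triangleright> \<psi>)"
    and "K i \<triangleright> (\<phi> \<star> \<psi>) = (K i \<triangleright> \<phi>) \<star> (K i \<triangleright> \<psi>)"
    and "Kinv i \<triangleright> (\<phi> \<star> \<psi>) = (Kinv i \<triangleright> \<phi>) \<star> (Kinv i \<triangleright> \<psi>)"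
  by (simp_all add: fun_eq_iff scaleC_fun_apply conv_act_tens_func comult_gn distrib_left tens_func_mult[OF assms]
      clinear_add[OF clinear_tens_func] conv_tens_func)

lemma ltr_conv:
  assumes "clinear \<phi>" "clinear \<psi>"
  shows "ltr (E i) (\<phi> \<star> \<psi>) = ltr (E i) \<phi> \<star> ltr (K i) \<psi> + \<phi> \<star> ltr (E i) \<psi>"
    and "ltr (F i) (\<phi> \<star> \<psi>) = ltr (F i) \<phi> \<star> \<psi> + ltr (Kinv i) \<phi> \<star> ltr (F i) \<psi>"
    and "ltr (K i) (\<phi> \<star> \<psi>) = ltr (K i) \<phi> \<star> ltr (K i) \<psi>"
    and "ltr (Kinv i) (\<phi> \<star> \<psi>) = ltr (Kinv i) \<phi> \<star> ltr (Kinv i) \<psi>"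
  by (simp_all add: fun_eq_iff scaleC_fun_apply conv_ltr_tens_func comult_gn distrib_right tens_func_mult[OF assms]
      clinear_add[OF clinear_tens_func] conv_tens_func)

text \<open>Coassociativity is used in dual form. The last letter of a word is absorbed as a right
  translation, and both bracketings obey the same twisted Leibniz rule.\<close>

lemma conv_assoc:
  assumes "clinear \<phi>" "clinear \<psi>" "clinear \<chi>"
  shows "\<phi> \<star> \<psi> \<star> \<chi> = \<phi> \<star> (\<psi> \<star> \<chi>)"
proof (rule clinear_eq_wdI[OF clinear_conv clinear_conv])
  fix gs
  show "(\<phi> \<star> \<psi> \<star> \<chi>) (wd (Word gs)) = (\<phi> \<star> (\<psi> \<star> \<chi>)) (wd (Word gs))"
    using assms
  proof (induction gs arbitrary: \<phi> \<psi> \<chi> rule: rev_induct)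
    case Nil
    then show ?case by (simp add: wd_Nil conv_one)
  next
    case (snoc g gs)
    have R: "f (wd (Word (gs @ [g]))) = (gn g \<triangleright> f) (wd (Word gs))" for f :: func
      by (simp add: act_def wd_snoc)
    show ?case
      unfolding R using snoc.prems
      by (cases g) (simp_all add: act_conv clinear_act clinear_conv conv_add_left conv_add_right snoc.IH)
  qed
qed

lemma clinear_counit: "clinear counit"
  by (simp add: counit_def lext_linear)

lemma counit_mult: "counit (x * y) = counit x * counit y"
proof (rule clinear_mult_eqI[of "\<lambda>x y. counit (x * y)"])
  fix v w
  show "counit (wd v * wd w) = counit (wd v) * counit (wd w)"
    by (simp add: wd_mult counit_def plus_word_def)
qed (auto intro!: clinearI simp: clinear_add[OF clinear_counit] clinear_scale[OF clinear_counit]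
    scaleC_mult_left scaleC_mult_right scaleC_complex_def algebra_simps)

lemma counit_gn: "counit (gn g) = counit_gen g"
  by (simp add: counit_def gn_def)

lemma counit_one: "counit 1 = 1"
  by (simp add: counit_def one_eq_wd zero_word_def)

lemma act_counit: "x \<triangleright> counit = counit x *\<^sub>C counit"
  by (simp add: act_def fun_eq_iff scaleC_fun_apply counit_mult scaleC_complex_def)

lemma conv_counit:
  assumes "clinear \<phi>"
  shows "\<phi> \<star> counit = \<phi>" "counit \<star> \<phi> = \<phi>"
proof -
  have "(\<phi> \<star> counit) (wd (Word gs)) = \<phi> (wd (Word gs)) \<and>
    (counit \<star> \<phi>) (wd (Word gs)) = \<phi> (wd (Word gs))" for gs
    using assms
  proof (induction gs arbitrary: \<phi> rule: rev_induct)
    case Nil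
    then show ?case by (simp add: wd_Nil conv_one counit_one)
  next
    case (snoc g gs)
    have R: "f (wd (Word (gs @ [g]))) = (gn g \<triangleright> f) (wd (Word gs))" for f :: func
      by (simp add: act_def wd_snoc)
    show ?case
      unfolding R using snoc.prems
      by (cases g) (simp_all add: act_conv clinear_act clinear_counit act_counit counit_gn
          scaleC_one snoc.IH)
  qed
  then show "\<phi> \<star> counit = \<phi>" "counit \<star> \<phi> = \<phi>"
    by (auto intro!: clinear_eq_wdI clinear_conv assms)
qed

text \<open>The convolution product is dual to an algebra homomorphism, so coproducts multiply.\<close>

lemma conv_split:
  assumes "clinear \<phi>" "clinear \<psi>"
    and "\<And>x y. \<phi> (x * y) = (\<Sum>i\<in>I. a i x * b i y)"
    and "\<And>x y. \<psi> (x * y) = (\<Sum>j\<in>J. c j x * d j y)"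
    and lin: "\<And>i. i \<in> I \<Longrightarrow> clinear (a i)" "\<And>j. j \<in> J \<Longrightarrow> clinear (c j)"
      "\<And>i. i \<in> I \<Longrightarrow> clinear (b i)" "\<And>j. j \<in> J \<Longrightarrow> clinear (d j)"
  shows "(\<phi> \<star> \<psi>) (x * y) = (\<Sum>i\<in>I. \<Sum>j\<in>J. (a i \<star> c j) x * (b i \<star> d j) y)"
proof -
  have "tens_func \<phi> \<psi> (s * t) = (\<Sum>i\<in>I. \<Sum>j\<in>J. tens_func (a i) (c j) s * tens_func (b i) (d j) t)" for s t
  proof -
    have eq: "(\<lambda>t. tens_func \<phi> \<psi> (Poly_Mapping.single k 1 * t)) =
       (\<lambda>t. \<Sum>i\<in>I. \<Sum>j\<in>J. tens_func (a i) (c j) (Poly_Mapping.single k 1) * tens_func (b i) (d j) t)" for k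
    proof (rule clinear_eqI)
      fix k' :: "word \<times> word"
      obtain v w v' w' where k: "k = (v, w)" "k' = (v', w')" by fastforce
      show "tens_func \<phi> \<psi> (Poly_Mapping.single k 1 * Poly_Mapping.single k' 1) =
        (\<Sum>i\<in>I. \<Sum>j\<in>J. tens_func (a i) (c j) (Poly_Mapping.single k 1) * tens_func (b i) (d j) (Poly_Mapping.single k' 1))"
        by (simp add: k mult_single tens_func_def scaleC_one wd_mult[symmetric] assms(3,4) sum_product
            mult.assoc mult.left_commute)
    next
      show "clinear (\<lambda>t. tens_func \<phi> \<psi> (Poly_Mapping.single k 1 * t))"
        by (rule clinear_comp[OF clinear_tens_func clinear_mult_right])
      show "clinear (\<lambda>t. \<Sum>i\<in>I. \<Sum>j\<in>J. tens_func (a i) (c j) (Poly_Mapping.single k 1) * tens_func (b i) (d j) t)"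
        by (rule clinearI) (simp_all add: clinear_add[OF clinear_tens_func] clinear_scale[OF clinear_tens_func]
          scaleC_complex_def sum.distrib sum_distrib_left distrib_left distrib_right mult.assoc mult.left_commute)
    qed
    have "(\<lambda>s. tens_func \<phi> \<psi> (s * t)) = (\<lambda>s. \<Sum>i\<in>I. \<Sum>j\<in>J. tens_func (a i) (c j) s * tens_func (b i) (d j) t)"
    proof (rule clinear_eqI)
      show "clinear (\<lambda>s. tens_func \<phi> \<psi> (s * t))"
        by (rule clinear_comp[OF clinear_tens_func clinear_mult_left])
      show "clinear (\<lambda>s. \<Sum>i\<in>I. \<Sum>j\<in>J. tens_func (a i) (c j) s * tens_func (b i) (d j) t)"
        by (rule clinearI) (simp_all add: clinear_add[OF clinear_tens_func] clinear_scale[OF clinear_tens_func]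
          scaleC_complex_def sum.distrib sum_distrib_left distrib_left distrib_right mult.assoc mult.left_commute)
    qed (rule fun_cong[OF eq])
    then show ?thesis by (rule fun_cong)
  qed
  then show ?thesis by (simp add: conv_tens_func comult_mult)
qed

section \<open>The antipode as an antihomomorphism of the free algebra\<close>

lemma clinear_antipode: "clinear antipode"
  by (simp add: antipode_def lext_linear)

lemma antipode_mult: "antipode (x * y) = antipode y * antipode x"
proof (rule clinear_mult_eqI[of "\<lambda>x y. antipode (x * y)"])
  fix v w
  show "antipode (wd v * wd w) = antipode (wd w) * antipode (wd v)"
    by (simp add: wd_mult antipode_def plus_word_def)
qed (auto intro: clinear_comp[OF clinear_antipode clinear_mult_right]
    clinear_comp[OF clinear_antipode clinear_mult_left]
    clinear_comp[OF clinear_mult_right clinear_antipode]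
    clinear_comp[OF clinear_mult_left clinear_antipode])

lemma antipode_gn: "antipode (gn g) = antipode_gen g"
  by (simp add: antipode_def gn_def)

lemma antipode_one: "antipode 1 = 1"
  by (simp add: antipode_def one_eq_wd zero_word_def)

section \<open>Functionals on the quantized enveloping algebra\<close>

lemma node_forall: "(\<forall>i. P i) \<longleftrightarrow> P N1 \<and> P N2"
  by (metis node.exhaust)

lemma uq_ideal_mem: "r \<in> uq_rels q \<Longrightarrow> x * r * y \<in> uq_ideal q"
  unfolding uq_ideal_def by (rule cvec.span_base) blast

lemma uq_dualD: "\<phi> \<in> uq_dual q \<Longrightarrow> clinear \<phi>"
  by (simp add: uq_dual_def)

lemma uq_dual_iff: "\<phi> \<in> uq_dual q \<longleftrightarrow> clinear \<phi> \<and> (\<forall>r\<in>uq_rels q. \<forall>x y. \<phi> (x * r * y) = 0)"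
proof
  assume "clinear \<phi> \<and> (\<forall>r\<in>uq_rels q. \<forall>x y. \<phi> (x * r * y) = 0)"
  then have lin: "clinear \<phi>" and kill: "\<And>x r y. r \<in> uq_rels q \<Longrightarrow> \<phi> (x * r * y) = 0" by auto
  have "\<phi> z = 0 z" if "z \<in> uq_ideal q" for z
    by (rule clinear_eq_on_span[OF lin clinear_0 _ that[unfolded uq_ideal_def]]) (auto simp: kill)
  then show "\<phi> \<in> uq_dual q"
    using lin by (simp add: uq_dual_def)
qed (auto simp: uq_dual_def uq_ideal_mem)

lemma uq_dual_act: "\<phi> \<in> uq_dual q \<Longrightarrow> x \<triangleright> \<phi> \<in> uq_dual q"
  by (simp add: uq_dual_iff clinear_act) (simp add: act_def mult.assoc)

lemma subspace_uq_dual: "cvec.subspace (uq_dual q)"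
  by (auto simp: cvec.subspace_def uq_dual_def clinear_plus clinear_scaleC clinear_0 scaleC_complex_def scaleC_fun_apply)

text \<open>In \<open>f (x * r * y)\<close> the word \<open>y\<close> is absorbed into the span of
  \<open>S\<close> by translation, while \<open>x\<close> is merely the point of evaluation. So it
  suffices that each relation kills the members of \<open>S\<close>.\<close>

lemma uq_dual_spanI:
  assumes "\<And>f. f \<in> S \<Longrightarrow> clinear f"
    and "\<And>f g. f \<in> S \<Longrightarrow> gn g \<triangleright> f \<in> cvec.span S"
    and "\<And>f r. f \<in> S \<Longrightarrow> r \<in> uq_rels q \<Longrightarrow> r \<triangleright> f = 0"
    and "f \<in> S"
  shows "f \<in> uq_dual q"
  unfolding uq_dual_iff
proof (intro conjI ballI allI)
  show "clinear f" using assms by blast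
  fix r x y assume r: "r \<in> uq_rels q"
  have step: "gn g \<triangleright> h \<in> cvec.span S" if "h \<in> cvec.span S" for g h
    by (rule clinear_span_subset[OF clinear_act_right cvec.subspace_span _ that]) (rule assms(2))
  have kill: "r \<triangleright> h = 0" if "h \<in> cvec.span S" for h
    using clinear_eq_on_span[OF clinear_act_right clinear_0 _ that, of r] assms(3) r by auto
  have mem: "wd (Word gs) \<triangleright> f \<in> cvec.span S" for gs
  proof (induction gs)
    case Nil
    then show ?case using assms(4) by (simp add: wd_Nil cvec.span_base)
  next
    case (Cons g gs)
    then show ?case by (simp add: wd_Cons act_mult step)
  qed
  have "f (x * r * wd (Word gs)) = 0" for gs
  proof -
    have "(r \<triangleright> wd (Word gs) \<triangleright> f) x = 0" using kill mem[of gs] by simp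
    then show ?thesis by (simp add: act_def mult.assoc)
  qed
  then have "(\<lambda>y. f (x * r * y)) = 0"
    by (intro clinear_eq_wdI clinear_comp[OF \<open>clinear f\<close> clinear_mult_right] clinear_0) auto
  then show "f (x * r * y) = 0" by (simp add: fun_eq_iff scaleC_fun_apply)
qed

lemma uq_dual_kill: "\<phi> \<in> uq_dual q \<Longrightarrow> r \<in> uq_rels q \<Longrightarrow> r \<triangleright> \<phi> = 0"
  using uq_dual_iff[of \<phi> q] mult_1_right by (auto simp: act_def fun_eq_iff scaleC_fun_apply) (metis mult_1_right)

section \<open>Powers of q, and the defining relations as operators on functionals\<close>

locale quantum_flag =
  fixes q :: real
  assumes q: "q \<notin> {-1, 0, 1}"
begin

definition Q :: complex where "Q = complex_of_real q"

lemma Q_nonzero: "Q \<noteq> 0"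
  using q by (simp add: Q_def)

lemma Q_square: "Q * Q \<noteq> 1"
proof
  assume "Q * Q = 1"
  then have "q * q = 1" by (simp add: Q_def flip: of_real_mult)
  then show False using q by (auto simp: square_eq_1_iff)
qed

lemma qpow_simps [simp]:
  "qpow q 0 = 1" "qpow q 1 = Q" "qpow q (-1) = inverse Q" "qpow q 2 = Q * Q" "qpow q (-2) = inverse (Q * Q)"
  by (simp_all add: qpow_def Q_def power_int_minus power2_eq_square flip: of_real_inverse)

lemma qpow_add: "qpow q (m + n) = qpow q m * qpow q n"
  using q by (simp add: qpow_def power_int_add)

lemma qpow_nonzero: "qpow q n \<noteq> 0"
  using q by (simp add: qpow_def)

text \<open>Absolute values and logarithms show that a real number other than 0, 1 and -1 is not a
  root of unity.\<close>

lemma qpow_eq_1_iff: "qpow q n = 1 \<longleftrightarrow> n = 0"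
proof
  assume "qpow q n = 1"
  then have "\<bar>q\<bar> powi n = 1" by (simp add: qpow_def power_int_abs[symmetric] del: of_real_power_int)
  moreover have "\<bar>q\<bar> > 0" "\<bar>q\<bar> \<noteq> 1" using q by auto
  moreover have "\<bar>q\<bar> powr real_of_int n = \<bar>q\<bar> powi n"
    by (rule powr_real_of_int') (use q in auto)
  ultimately have "real_of_int n * ln \<bar>q\<bar> = 0"
    using ln_powr[of "\<bar>q\<bar>" "real_of_int n"] by simp
  then show "n = 0" using \<open>\<bar>q\<bar> > 0\<close> \<open>\<bar>q\<bar> \<noteq> 1\<close> by simp
qed simp

lemma qpow_inj: "qpow q m = qpow q n \<Longrightarrow> m = n"
  using qpow_add[of "m - n" n] qpow_eq_1_iff[of "m - n"] qpow_nonzero[of n] by simp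

lemma rel_mem:
  shows "K i * Kinv i - 1 \<in> uq_rels q" "Kinv i * K i - 1 \<in> uq_rels q"
    and "K i * K j - K j * K i \<in> uq_rels q"
    and "K i * E j - qpow q (cartan i j) *\<^sub>C (E j * K i) \<in> uq_rels q"
    and "K i * F j - qpow q (- cartan i j) *\<^sub>C (F j * K i) \<in> uq_rels q"
    and "E i * F j - F j * E i - (if i = j then (1 / (qpow q 1 - qpow q (-1))) *\<^sub>C (K i - Kinv i) else 0) \<in> uq_rels q"
  unfolding uq_rels_def
  by (rule UnI1, rule UnI1, rule UN_I[OF UNIV_I], rule insertI1)
    (rule UnI1, rule UnI1, rule UN_I[OF UNIV_I], rule insertI2, rule insertI1,
     (rule UnI1, rule UnI2, rule UN_I[OF UNIV_I], rule UN_I[OF UNIV_I], blast)+)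

lemma rel_mem_serre:
  assumes "i \<noteq> j"
  shows "E i * E i * E j - (qpow q 1 + qpow q (-1)) *\<^sub>C (E i * E j * E i) + E j * E i * E i \<in> uq_rels q"
    and "F i * F i * F j - (qpow q 1 + qpow q (-1)) *\<^sub>C (F i * F j * F i) + F j * F i * F i \<in> uq_rels q"
  unfolding uq_rels_def
  by (rule UnI2, rule UN_I[of i, OF UNIV_I], rule UN_I[of j], simp add: assms[symmetric], blast)+

lemma act_rels:
  assumes \<phi>: "\<phi> \<in> uq_dual q"
  shows K_Kinv: "K i \<triangleright> Kinv i \<triangleright> \<phi> = \<phi>"
    and Kinv_K: "Kinv i \<triangleright> K i \<triangleright> \<phi> = \<phi>"
    and K_K: "K i \<triangleright> K j \<triangleright> \<phi> = K j \<triangleright> K i \<triangleright> \<phi>"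
    and K_E: "K i \<triangleright> E j \<triangleright> \<phi> = qpow q (cartan i j) *\<^sub>C (E j \<triangleright> K i \<triangleright> \<phi>)"
    and K_F: "K i \<triangleright> F j \<triangleright> \<phi> = qpow q (- cartan i j) *\<^sub>C (F j \<triangleright> K i \<triangleright> \<phi>)"
    and E_F: "i \<noteq> j \<Longrightarrow> E i \<triangleright> F j \<triangleright> \<phi> = F j \<triangleright> E i \<triangleright> \<phi>"
    and E_F_same: "E i \<triangleright> F i \<triangleright> \<phi> = F i \<triangleright> E i \<triangleright> \<phi> + (1 / (Q - inverse Q)) *\<^sub>C (K i \<triangleright> \<phi> - Kinv i \<triangleright> \<phi>)"
    and serre_E: "i \<noteq> j \<Longrightarrow> E i \<triangleright> E i \<triangleright> E j \<triangleright> \<phi> =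
      (Q + inverse Q) *\<^sub>C (E i \<triangleright> E j \<triangleright> E i \<triangleright> \<phi>) - E j \<triangleright> E i \<triangleright> E i \<triangleright> \<phi>"
    and serre_F: "i \<noteq> j \<Longrightarrow> F i \<triangleright> F i \<triangleright> F j \<triangleright> \<phi> =
      (Q + inverse Q) *\<^sub>C (F i \<triangleright> F j \<triangleright> F i \<triangleright> \<phi>) - F j \<triangleright> F i \<triangleright> F i \<triangleright> \<phi>"
proof -
  note lin = uq_dualD[OF \<phi>]
  note kill = uq_dual_kill[OF \<phi>]
  note expand = diff_act[OF lin] add_act[OF lin] scale_act[OF lin] act_mult act_one zero_act[OF lin]
  show "K i \<triangleright> Kinv i \<triangleright> \<phi> = \<phi>" using kill[OF rel_mem(1)] by (simp add: expand)
  show "Kinv i \<triangleright> K i \<triangleright> \<phi> = \<phi>" using kill[OF rel_mem(2)] by (simp add: expand)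
  show "K i \<triangleright> K j \<triangleright> \<phi> = K j \<triangleright> K i \<triangleright> \<phi>" using kill[OF rel_mem(3)] by (simp add: expand)
  show "K i \<triangleright> E j \<triangleright> \<phi> = qpow q (cartan i j) *\<^sub>C (E j \<triangleright> K i \<triangleright> \<phi>)"
    using kill[OF rel_mem(4)] by (simp add: expand)
  show "K i \<triangleright> F j \<triangleright> \<phi> = qpow q (- cartan i j) *\<^sub>C (F j \<triangleright> K i \<triangleright> \<phi>)"
    using kill[OF rel_mem(5)] by (simp add: expand)
  show "E i \<triangleright> F j \<triangleright> \<phi> = F j \<triangleright> E i \<triangleright> \<phi>" if "i \<noteq> j"
    using kill[OF rel_mem(6), of i j] that by (simp add: expand)
  show "E i \<triangleright> F i \<triangleright> \<phi> = F i \<triangleright> E i \<triangleright> \<phi> + (1 / (Q - inverse Q)) *\<^sub>C (K i \<triangleright> \<phi> - Kinv i \<triangleright> \<phi>)"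
    using kill[OF rel_mem(6), of i i] by (simp add: expand algebra_simps)
  show "E i \<triangleright> E i \<triangleright> E j \<triangleright> \<phi> =
      (Q + inverse Q) *\<^sub>C (E i \<triangleright> E j \<triangleright> E i \<triangleright> \<phi>) - E j \<triangleright> E i \<triangleright> E i \<triangleright> \<phi>" if "i \<noteq> j"
    using kill[OF rel_mem_serre(1)[OF that]] by (simp add: expand algebra_simps eq_neg_iff_add_eq_0)
  show "F i \<triangleright> F i \<triangleright> F j \<triangleright> \<phi> =
      (Q + inverse Q) *\<^sub>C (F i \<triangleright> F j \<triangleright> F i \<triangleright> \<phi>) - F j \<triangleright> F i \<triangleright> F i \<triangleright> \<phi>" if "i \<noteq> j"
    using kill[OF rel_mem_serre(2)[OF that]] by (simp add: expand algebra_simps eq_neg_iff_add_eq_0)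
qed

text \<open>The defining relations move only \<open>K i\<close> past the other generators. Inserting
  \<open>K i\<close> and \<open>Kinv i\<close> on the right transfers them to
  \<open>Kinv i\<close>.\<close>

lemma act_rels':
  assumes \<phi>: "\<phi> \<in> uq_dual q"
  shows Kinv_E: "Kinv i \<triangleright> E j \<triangleright> \<phi> = qpow q (- cartan i j) *\<^sub>C (E j \<triangleright> Kinv i \<triangleright> \<phi>)"
    and Kinv_F: "Kinv i \<triangleright> F j \<triangleright> \<phi> = qpow q (cartan i j) *\<^sub>C (F j \<triangleright> Kinv i \<triangleright> \<phi>)"
    and Kinv_K_commute: "Kinv i \<triangleright> K j \<triangleright> \<phi> = K j \<triangleright> Kinv i \<triangleright> \<phi>"
    and Kinv_Kinv: "Kinv i \<triangleright> Kinv j \<triangleright> \<phi> = Kinv j \<triangleright> Kinv i \<triangleright> \<phi>"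
proof -
  have inv: "qpow q (- n) * qpow q n = 1" for n using qpow_add[of "-n" n] by simp
  have "Kinv i \<triangleright> E j \<triangleright> \<phi> = Kinv i \<triangleright> E j \<triangleright> K i \<triangleright> Kinv i \<triangleright> \<phi>"
    using \<phi> by (simp add: K_Kinv)
  also have "\<dots> = (qpow q (- cartan i j) * qpow q (cartan i j)) *\<^sub>C (Kinv i \<triangleright> E j \<triangleright> K i \<triangleright> Kinv i \<triangleright> \<phi>)"
    by (simp only: inv scaleC_one)
  also have "\<dots> = qpow q (- cartan i j) *\<^sub>C (Kinv i \<triangleright> K i \<triangleright> E j \<triangleright> Kinv i \<triangleright> \<phi>)"
    using \<phi> by (simp add: K_E uq_dual_act act_scale scaleC_scaleC)
  also have "\<dots> = qpow q (- cartan i j) *\<^sub>C (E j \<triangleright> Kinv i \<triangleright> \<phi>)"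
    using \<phi> by (simp add: Kinv_K uq_dual_act)
  finally show "Kinv i \<triangleright> E j \<triangleright> \<phi> = qpow q (- cartan i j) *\<^sub>C (E j \<triangleright> Kinv i \<triangleright> \<phi>)" .
  have "Kinv i \<triangleright> F j \<triangleright> \<phi> = Kinv i \<triangleright> F j \<triangleright> K i \<triangleright> Kinv i \<triangleright> \<phi>"
    using \<phi> by (simp add: K_Kinv)
  also have "\<dots> = (qpow q (cartan i j) * qpow q (- cartan i j)) *\<^sub>C (Kinv i \<triangleright> F j \<triangleright> K i \<triangleright> Kinv i \<triangleright> \<phi>)"
    by (simp only: inv mult.commute[of _ "qpow q (- _)"] scaleC_one)
  also have "\<dots> = qpow q (cartan i j) *\<^sub>C (Kinv i \<triangleright> K i \<triangleright> F j \<triangleright> Kinv i \<triangleright> \<phi>)"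
    using \<phi> by (simp add: K_F uq_dual_act act_scale scaleC_scaleC)
  also have "\<dots> = qpow q (cartan i j) *\<^sub>C (F j \<triangleright> Kinv i \<triangleright> \<phi>)"
    using \<phi> by (simp add: Kinv_K uq_dual_act)
  finally show "Kinv i \<triangleright> F j \<triangleright> \<phi> = qpow q (cartan i j) *\<^sub>C (F j \<triangleright> Kinv i \<triangleright> \<phi>)" .
  have comm: "Kinv i \<triangleright> K j \<triangleright> \<psi> = K j \<triangleright> Kinv i \<triangleright> \<psi>" if \<psi>: "\<psi> \<in> uq_dual q" for \<psi> i j
  proof -
    have "Kinv i \<triangleright> K j \<triangleright> \<psi> = Kinv i \<triangleright> K j \<triangleright> K i \<triangleright> Kinv i \<triangleright> \<psi>"
      using \<psi> by (simp add: K_Kinv)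
    also have "\<dots> = Kinv i \<triangleright> K i \<triangleright> K j \<triangleright> Kinv i \<triangleright> \<psi>"
      by (subst K_K) (simp_all add: \<psi> uq_dual_act)
    also have "\<dots> = K j \<triangleright> Kinv i \<triangleright> \<psi>"
      using \<psi> by (simp add: Kinv_K uq_dual_act)
    finally show ?thesis .
  qed
  show "Kinv i \<triangleright> K j \<triangleright> \<phi> = K j \<triangleright> Kinv i \<triangleright> \<phi>" by (rule comm[OF \<phi>])
  have "Kinv i \<triangleright> Kinv j \<triangleright> \<phi> = Kinv j \<triangleright> K j \<triangleright> Kinv i \<triangleright> Kinv j \<triangleright> \<phi>"
    using \<phi> by (simp add: Kinv_K uq_dual_act)
  also have "\<dots> = Kinv j \<triangleright> Kinv i \<triangleright> \<phi>"
    using \<phi> by (simp add: comm[symmetric] K_Kinv Kinv_K uq_dual_act)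
  finally show "Kinv i \<triangleright> Kinv j \<triangleright> \<phi> = Kinv j \<triangleright> Kinv i \<triangleright> \<phi>" .
qed

lemma uq_rels_cases [consumes 1, case_names KKinv KinvK KK KE KF EF EF_same EEE FFF]:
  assumes "r \<in> uq_rels q"
    and "\<And>i. r = K i * Kinv i - 1 \<Longrightarrow> P"
    and "\<And>i. r = Kinv i * K i - 1 \<Longrightarrow> P"
    and "\<And>i j. r = K i * K j - K j * K i \<Longrightarrow> P"
    and "\<And>i j. r = K i * E j - qpow q (cartan i j) *\<^sub>C (E j * K i) \<Longrightarrow> P"
    and "\<And>i j. r = K i * F j - qpow q (- cartan i j) *\<^sub>C (F j * K i) \<Longrightarrow> P"
    and "\<And>i j. i \<noteq> j \<Longrightarrow> r = E i * F j - F j * E i \<Longrightarrow> P"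
    and "\<And>i. r = E i * F i - F i * E i - (1 / (Q - inverse Q)) *\<^sub>C (K i - Kinv i) \<Longrightarrow> P"
    and "\<And>i j. i \<noteq> j \<Longrightarrow>
      r = E i * E i * E j - (Q + inverse Q) *\<^sub>C (E i * E j * E i) + E j * E i * E i \<Longrightarrow> P"
    and "\<And>i j. i \<noteq> j \<Longrightarrow>
      r = F i * F i * F j - (Q + inverse Q) *\<^sub>C (F i * F j * F i) + F j * F i * F i \<Longrightarrow> P"
  shows P
  using assms(1) unfolding uq_rels_def qpow_simps
proof (elim UnE UN_E insertE emptyE)
  fix i j
  assume r: "r = E i * F j - F j * E i - (if i = j then (1 / (Q - inverse Q)) *\<^sub>C (K i - Kinv i) else 0)"
  show P
  proof (cases "i = j")
    case True
    then show ?thesis using r by (intro assms(8)) simp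
  next
    case False
    then show ?thesis using r by (intro assms(7)[OF False]) simp
  qed
next
  fix i j assume "j \<in> - {i}"
    "r = E i * E i * E j - (Q + inverse Q) *\<^sub>C (E i * E j * E i) + E j * E i * E i"
  then show P by (intro assms(9)) auto
next
  fix i j assume "j \<in> - {i}"
    "r = F i * F i * F j - (Q + inverse Q) *\<^sub>C (F i * F j * F i) + F j * F i * F i"
  then show P by (intro assms(10)) auto
qed (erule assms(2-6))+

text \<open>Dual form of the fact that the coproduct respects the defining relations: the twisted
  Leibniz rule reduces a relation on a product to the relations on the factors.\<close>

lemma conv_killed:
  assumes \<phi>: "\<phi> \<in> uq_dual q" and \<psi>: "\<psi> \<in> uq_dual q" and r: "r \<in> uq_rels q"
  shows "r \<triangleright> (\<phi> \<star> \<psi>) = 0"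
proof -
  note lin = uq_dualD[OF \<phi>] uq_dualD[OF \<psi>]
  note expand = diff_act[OF clinear_conv] add_act[OF clinear_conv] scale_act[OF clinear_conv] act_mult act_one
    zero_act[OF clinear_conv] act_conv clinear_act lin act_add act_diff act_scale
  note rls = act_scale act_add act_diff scaleC_scaleC act_rels act_rels' uq_dual_act \<phi> \<psi> conv_add_left conv_add_right conv_diff_left conv_diff_right
    conv_scale_left conv_scale_right
  note nz = Q_nonzero Q_square
  from r show ?thesis
  proof (cases rule: uq_rels_cases)
    case (KKinv i)
    then show ?thesis by (simp add: expand rls)
  next
    case (KinvK i)
    then show ?thesis by (simp add: expand rls)
  next
    case (KK i j)
    then show ?thesis by (simp add: expand) (simp add: K_K[OF \<phi>, of i j] K_K[OF \<psi>, of i j])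
  next
    case (KE i j)
    then show ?thesis
      apply (simp add: expand)
      apply (simp add: rls cvec.scale_right_distrib)
      done
  next
    case (KF i j)
    then show ?thesis
      apply (simp add: expand)
      apply (simp add: rls cvec.scale_right_distrib)
      done
  next
    case (EF i j)
    then show ?thesis
      apply (cases i; cases j)
      apply (simp_all add: expand)
      apply (simp_all add: rls cartan_def)
      done
  next
    case (EF_same i)
    define \<kappa> where "\<kappa> = 1 / (Q - inverse Q)"
    have "cartan i i = 2" by (simp add: cartan_def)
    with EF_same[folded \<kappa>_def] show ?thesis
      apply (simp add: expand)
      apply (simp add: E_F_same[folded \<kappa>_def] K_F Kinv_E uq_dual_act \<phi> \<psi> conv_add_left conv_add_right
        conv_diff_left conv_diff_right conv_scale_left conv_scale_right)
      apply (simp add: fun_eq_iff scaleC_fun_apply scaleC_complex_def algebra_simps)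
      done
  next
    case (EEE i j)
    then show ?thesis
      apply (cases i; cases j)
      apply (simp_all add: expand)
      apply (simp_all add: rls cartan_def)
      apply (simp_all add: fun_eq_iff scaleC_fun_apply scaleC_complex_def nz field_simps)
      done
  next
    case (FFF i j)
    then show ?thesis
      apply (cases i; cases j)
      apply (simp_all add: expand)
      apply (simp_all add: rls cartan_def)
      apply (simp_all add: fun_eq_iff scaleC_fun_apply scaleC_complex_def nz field_simps)
      done
  qed
qed

end

section \<open>The antipode on functionals\<close>

definition anti :: "func \<Rightarrow> func"
  where "anti \<phi> = \<phi> \<circ> antipode"

context quantum_flag
begin

lemma uq_dual_conv:
  assumes "\<phi> \<in> uq_dual q" "\<psi> \<in> uq_dual q"
  shows "\<phi> \<star> \<psi> \<in> uq_dual q"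
proof (rule uq_dual_spanI[where S = "{\<phi> \<star> \<psi> | \<phi> \<psi>. \<phi> \<in> uq_dual q \<and> \<psi> \<in> uq_dual q}"])
  fix f g assume "f \<in> {\<phi> \<star> \<psi> | \<phi> \<psi>. \<phi> \<in> uq_dual q \<and> \<psi> \<in> uq_dual q}"
  then obtain \<phi> \<psi> where f: "f = \<phi> \<star> \<psi>" "\<phi> \<in> uq_dual q" "\<psi> \<in> uq_dual q" by blast
  have base: "\<phi> \<star> \<psi> \<in> cvec.span {\<phi> \<star> \<psi> | \<phi> \<psi>. \<phi> \<in> uq_dual q \<and> \<psi> \<in> uq_dual q}"
    if "\<phi> \<in> uq_dual q" "\<psi> \<in> uq_dual q" for \<phi> \<psi>
    by (rule cvec.span_base) (use that in blast)
  show "gn g \<triangleright> f \<in> cvec.span {\<phi> \<star> \<psi> | \<phi> \<psi>. \<phi> \<in> uq_dual q \<and> \<psi> \<in> uq_dual q}"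
    by (cases g) (auto simp only: f act_conv[OF uq_dualD[OF f(2)] uq_dualD[OF f(3)]]
        intro!: cvec.span_add base uq_dual_act f(2,3))
next
  fix f r assume "f \<in> {\<phi> \<star> \<psi> | \<phi> \<psi>. \<phi> \<in> uq_dual q \<and> \<psi> \<in> uq_dual q}" "r \<in> uq_rels q"
  then show "r \<triangleright> f = 0" using conv_killed by blast
qed (use assms clinear_conv in blast)+

lemma counit_uq_dual: "counit \<in> uq_dual q"
proof (rule uq_dual_spanI[where S = "{counit}"])
  fix f g assume "f \<in> {counit}"
  then show "gn g \<triangleright> f \<in> cvec.span {counit}"
    by (simp only: singleton_iff act_counit) (rule cvec.span_scale[OF cvec.span_base], simp)
next
  fix f r assume f: "f \<in> {counit}" and r: "r \<in> uq_rels q"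
  have "counit r = 0"
    using r by (cases rule: uq_rels_cases)
      (simp_all add: clinear_diff[OF clinear_counit] clinear_add[OF clinear_counit]
        clinear_scale[OF clinear_counit] counit_mult counit_gn counit_one scaleC_complex_def)
  then show "r \<triangleright> f = 0" using f by (simp add: act_counit)
qed (simp_all add: clinear_counit)

lemma clinear_anti: "clinear \<phi> \<Longrightarrow> clinear (anti \<phi>)"
  unfolding anti_def comp_def by (rule clinear_comp[OF _ clinear_antipode])

lemma anti_one: "anti \<phi> 1 = \<phi> 1"
  by (simp add: anti_def antipode_one)

lemma clinear_anti_right: "clinear anti"
  by (rule clinearI) (simp_all add: anti_def fun_eq_iff scaleC_fun_apply)

lemma ltr_anti: "ltr x (anti \<phi>) = anti (antipode x \<triangleright> \<phi>)"
  by (simp add: ltr_def act_def anti_def antipode_mult fun_eq_iff)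

text \<open>Left translation by the first letter \<open>g\<close> turns into the action of its
  antipode inside \<open>anti\<close>, and the Leibniz rule for that action gives the reversed
  product. Membership in \<open>uq_dual q\<close> enters because \<open>K i\<close> has to cancel
  against \<open>Kinv i\<close>.\<close>

lemma anti_conv:
  assumes "\<phi> \<in> uq_dual q" "\<psi> \<in> uq_dual q"
  shows "anti (\<phi> \<star> \<psi>) = anti \<psi> \<star> anti \<phi>"
proof (rule clinear_eq_wdI[OF clinear_anti[OF clinear_conv] clinear_conv])
  fix gs
  show "anti (\<phi> \<star> \<psi>) (wd (Word gs)) = (anti \<psi> \<star> anti \<phi>) (wd (Word gs))"
    using assms
  proof (induction gs arbitrary: \<phi> \<psi>)
    case Nil
    then show ?case by (simp add: wd_Nil conv_one anti_one)
  next
    case (Cons g gs)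
    let ?w = "wd (Word gs)"
    note lin = uq_dualD[OF Cons.prems(1)] uq_dualD[OF Cons.prems(2)]
    have L: "f (wd (Word (g # gs))) = ltr (gn g) f ?w" for f :: func
      by (simp add: ltr_def wd_Cons)
    show ?case
      unfolding L using Cons.prems
      by (cases g)
        (simp_all add: ltr_anti antipode_gn ltr_conv clinear_anti lin act_mult neg_act[OF clinear_conv] neg_act
          act_conv act_add clinear_act K_Kinv Kinv_K Cons.IH uq_dual_act clinear_neg[OF clinear_anti_right]
          clinear_diff[OF clinear_anti_right] clinear_add[OF clinear_anti_right] conv_neg_left conv_neg_right)
  qed
qed

subsection \<open>The matrix coefficients\<close>

lemma sum_123:
  "(\<Sum>a\<in>{1..3::nat}. f a) = f 1 + f 2 + f 3"
  "(\<Sum>a\<in>{Suc 0..3}. f a) = f (Suc 0) + f 2 + f 3"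
proof -
  have "{1..3::nat} = {1, 2, 3}" by auto
  then show "(\<Sum>a\<in>{1..3::nat}. f a) = f 1 + f 2 + f 3" by (simp add: add.assoc)
  then show "(\<Sum>a\<in>{Suc 0..3}. f a) = f (Suc 0) + f 2 + f 3" by simp
qed

lemma in_123: "i \<in> {1..3::nat} \<longleftrightarrow> i = 1 \<or> i = 2 \<or> i = 3"
  by auto

abbreviation U :: "nat \<Rightarrow> nat \<Rightarrow> func" where "U \<equiv> u q"

text \<open>The entries \<open>S(u\<^sub>i\<^sub>j)\<close> of the inverse of the matrix of
  generators.\<close>

definition V :: "nat \<Rightarrow> nat \<Rightarrow> func" where "V i j = anti (U i j)"

lemma clinear_U: "clinear (U i j)"
  by (simp add: u_def lext_linear)

lemma clinear_V: "clinear (V i j)"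
  unfolding V_def by (rule clinear_anti[OF clinear_U])

lemma U_one: "U i j 1 = of_bool (i = j)"
  by (simp add: u_def one_eq_wd zero_word_def)

lemma V_one: "V i j 1 = of_bool (i = j)"
  by (simp add: V_def anti_one U_one)

lemma pair_word_append:
  assumes "i \<in> {1..3}"
  shows "pair_word q (gs @ hs) i j = (\<Sum>a\<in>{1..3}. pair_word q gs i a * pair_word q hs a j)"
  using assms
proof (induction gs arbitrary: i)
  case Nil
  then show ?case unfolding in_123 by (auto simp: sum_123)
next
  case (Cons g gs)
  have "pair_word q ((g # gs) @ hs) i j =
      (\<Sum>b\<in>{1..3}. \<Sum>a\<in>{1..3}. pair_gen q g i b * (pair_word q gs b a * pair_word q hs a j))"
    using Cons.IH by (simp add: sum_distrib_left)
  also have "\<dots> = (\<Sum>a\<in>{1..3}. \<Sum>b\<in>{1..3}. pair_gen q g i b * (pair_word q gs b a * pair_word q hs a j))"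
    by (rule sum.swap)
  finally show ?case by (simp add: sum_distrib_right mult.assoc)
qed

lemma U_mult:
  assumes "i \<in> {1..3}"
  shows "U i j (x * y) = (\<Sum>a\<in>{1..3}. U i a x * U a j y)"
proof (rule clinear_mult_eqI[of "\<lambda>x y. U i j (x * y)"])
  fix v w
  show "U i j (wd v * wd w) = (\<Sum>a\<in>{1..3}. U i a (wd v) * U a j (wd w))"
    using assms by (simp add: wd_mult u_def plus_word_def pair_word_append)
qed (auto intro!: clinearI simp: clinear_add[OF clinear_U] clinear_scale[OF clinear_U]
    scaleC_mult_left scaleC_mult_right scaleC_complex_def sum.distrib sum_distrib_left algebra_simps)

lemma V_mult:
  assumes "i \<in> {1..3}"
  shows "V i j (x * y) = (\<Sum>a\<in>{1..3}. V a j x * V i a y)"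
  using U_mult[OF assms] by (simp add: V_def anti_def antipode_mult mult.commute)

lemma U_gn: "j \<in> {1..3} \<Longrightarrow> U i j (gn g) = pair_gen q g i j"
  unfolding in_123 by (auto simp: u_def gn_def sum_123)

lemma U_neg: "U i j (- x) = - U i j x"
  by (rule clinear_neg[OF clinear_U])

lemma act_U: "i \<in> {1..3} \<Longrightarrow> x \<triangleright> U i j = (\<Sum>a\<in>{1..3}. U a j x *\<^sub>C U i a)"
  by (simp add: act_def fun_eq_iff U_mult sum_123 scaleC_fun_apply scaleC_complex_def mult.commute)

lemma ltr_U: "i \<in> {1..3} \<Longrightarrow> ltr x (U i j) = (\<Sum>a\<in>{1..3}. U i a x *\<^sub>C U a j)"
  by (simp add: ltr_def fun_eq_iff U_mult sum_123 scaleC_fun_apply scaleC_complex_def)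

lemma act_V: "i \<in> {1..3} \<Longrightarrow> x \<triangleright> V i j = (\<Sum>a\<in>{1..3}. V i a x *\<^sub>C V a j)"
  by (simp add: act_def fun_eq_iff V_mult sum_123 scaleC_fun_apply scaleC_complex_def mult.commute)

lemma ltr_V: "i \<in> {1..3} \<Longrightarrow> ltr x (V i j) = (\<Sum>a\<in>{1..3}. V a j x *\<^sub>C V i a)"
  by (simp add: ltr_def fun_eq_iff V_mult sum_123 scaleC_fun_apply scaleC_complex_def)

text \<open>The factors \<open>- Q\<close> and \<open>- inverse Q\<close> come from the
  \<open>Kinv\<close> and \<open>K\<close> contained in \<open>antipode_gen\<close>.\<close>

fun MS :: "gen \<Rightarrow> nat \<Rightarrow> nat \<Rightarrow> complex" where
  "MS (gE v) i j = of_bool (i = num v + 1 \<and> j = num v) * (- Q)"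
| "MS (gF v) i j = of_bool (i = num v \<and> j = num v + 1) * (- inverse Q)"
| "MS (gK v) i j = pair_gen q (gKinv v) i j"
| "MS (gKinv v) i j = pair_gen q (gK v) i j"

lemma V_gn:
  assumes "i \<in> {1..3}" "j \<in> {1..3}"
  shows "V i j (gn g) = MS g i j"
proof (cases g)
  case (gE v)
  then show ?thesis using assms unfolding in_123
    by (cases v) (auto simp: V_def anti_def antipode_gn U_neg U_mult U_gn sum_123)
next
  case (gF v)
  then show ?thesis using assms unfolding in_123
    by (cases v) (auto simp: V_def anti_def antipode_gn U_neg U_mult U_gn sum_123)
qed (use assms in \<open>auto simp: V_def anti_def antipode_gn U_gn\<close>)

lemma in_123' [simp]: "1 \<in> {1..3::nat}" "2 \<in> {1..3::nat}" "3 \<in> {1..3::nat}" "Suc 0 \<in> {1..3}"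
  by auto

lemmas U_simps = clinear_diff[OF clinear_U] clinear_add[OF clinear_U] clinear_scale[OF clinear_U]
  clinear_zero[OF clinear_U] U_mult U_gn U_one sum_123 cartan_def scaleC_complex_def

lemmas V_simps = clinear_diff[OF clinear_V] clinear_add[OF clinear_V] clinear_scale[OF clinear_V]
  clinear_zero[OF clinear_V] V_mult V_gn V_one sum_123 cartan_def scaleC_complex_def

text \<open>The matrices \<open>pair_gen\<close> form the three-dimensional vector representation;
  each defining relation is multiplied out in it.\<close>

lemma U_uq_dual:
  assumes "i \<in> {1..3}" "j \<in> {1..3}"
  shows "U i j \<in> uq_dual q"
proof (rule uq_dual_spanI[where S = "{U i j | i j. i \<in> {1..3} \<and> j \<in> {1..3}}"])
  fix f g assume "f \<in> {U i j | i j. i \<in> {1..3} \<and> j \<in> {1..3}}"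
  then obtain i j where f: "f = U i j" "i \<in> {1..3}" "j \<in> {1..3}" by blast
  show "gn g \<triangleright> f \<in> cvec.span {U i j | i j. i \<in> {1..3} \<and> j \<in> {1..3}}"
    unfolding f(1) act_U[OF f(2)]
    by (rule cvec.span_sum, rule cvec.span_scale, rule cvec.span_base) (use f in blast)
next
  fix f r assume "f \<in> {U i j | i j. i \<in> {1..3} \<and> j \<in> {1..3}}" and r: "r \<in> uq_rels q"
  then obtain i j where f: "f = U i j" "i \<in> {1..3}" "j \<in> {1..3}" by blast
  note nz = Q_nonzero Q_square
  have "U a j r = 0" if "a \<in> {1..3}" for a
    using r
  proof (cases rule: uq_rels_cases)
    case (KKinv i)
    then show ?thesis using that f nz unfolding in_123 by (cases i) (auto simp: U_simps)
  next
    case (KinvK i)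
    then show ?thesis using that f nz unfolding in_123 by (cases i) (auto simp: U_simps)
  next
    case (KK i k)
    then show ?thesis using that f nz unfolding in_123 by (cases i; cases k) (auto simp: U_simps)
  next
    case (KE i k)
    then show ?thesis using that f nz unfolding in_123 by (cases i; cases k) (auto simp: U_simps)
  next
    case (KF i k)
    then show ?thesis using that f nz unfolding in_123 by (cases i; cases k) (auto simp: U_simps)
  next
    case (EF i k)
    then show ?thesis using that f nz unfolding in_123 by (cases i; cases k) (auto simp: U_simps)
  next
    case (EEE i k)
    then show ?thesis using that f nz unfolding in_123 by (cases i; cases k) (auto simp: U_simps)
  next
    case (FFF i k)
    then show ?thesis using that f nz unfolding in_123 by (cases i; cases k) (auto simp: U_simps)
  next
    case (EF_same i)
    have "Q - inverse Q \<noteq> 0" using nz by (simp add: field_simps)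
    then show ?thesis using that f EF_same nz unfolding in_123
      by (cases i) (auto simp: U_simps divide_simps)
  qed
  then show "r \<triangleright> f = 0"
    unfolding f(1) act_U[OF f(2)] by simp
qed (use assms clinear_U in blast)+

lemma V_uq_dual:
  assumes "i \<in> {1..3}" "j \<in> {1..3}"
  shows "V i j \<in> uq_dual q"
proof (rule uq_dual_spanI[where S = "{V i j | i j. i \<in> {1..3} \<and> j \<in> {1..3}}"])
  fix f g assume "f \<in> {V i j | i j. i \<in> {1..3} \<and> j \<in> {1..3}}"
  then obtain i j where f: "f = V i j" "i \<in> {1..3}" "j \<in> {1..3}" by blast
  show "gn g \<triangleright> f \<in> cvec.span {V i j | i j. i \<in> {1..3} \<and> j \<in> {1..3}}"
    unfolding f(1) act_V[OF f(2)]
    by (rule cvec.span_sum, rule cvec.span_scale, rule cvec.span_base) (use f in blast)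
next
  fix f r assume "f \<in> {V i j | i j. i \<in> {1..3} \<and> j \<in> {1..3}}" and r: "r \<in> uq_rels q"
  then obtain i j where f: "f = V i j" "i \<in> {1..3}" "j \<in> {1..3}" by blast
  note nz = Q_nonzero Q_square
  have "V i a r = 0" if "a \<in> {1..3}" for a
    using r
  proof (cases rule: uq_rels_cases)
    case (KKinv i)
    then show ?thesis using that f nz unfolding in_123 by (cases i) (auto simp: V_simps)
  next
    case (KinvK i)
    then show ?thesis using that f nz unfolding in_123 by (cases i) (auto simp: V_simps)
  next
    case (KK i k)
    then show ?thesis using that f nz unfolding in_123 by (cases i; cases k) (auto simp: V_simps)
  next
    case (KE i k)
    then show ?thesis using that f nz unfolding in_123 by (cases i; cases k) (auto simp: V_simps)
  next
    case (KF i k)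
    then show ?thesis using that f nz unfolding in_123 by (cases i; cases k) (auto simp: V_simps)
  next
    case (EF i k)
    then show ?thesis using that f nz unfolding in_123 by (cases i; cases k) (auto simp: V_simps)
  next
    case (EEE i k)
    then show ?thesis using that f nz unfolding in_123 by (cases i; cases k) (auto simp: V_simps)
  next
    case (FFF i k)
    then show ?thesis using that f nz unfolding in_123 by (cases i; cases k) (auto simp: V_simps)
  next
    case (EF_same i)
    have "Q - inverse Q \<noteq> 0" using nz by (simp add: field_simps)
    then show ?thesis using that f EF_same nz unfolding in_123
      by (cases i) (auto simp: V_simps divide_simps)
  qed
  then show "r \<triangleright> f = 0"
    unfolding f(1) act_V[OF f(2)] by simp
qed (use assms clinear_V in blast)+


text \<open>The factor by which the square of the antipode rescales \<open>U i j\<close>.\<close>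

definition dq :: "nat \<Rightarrow> nat \<Rightarrow> complex" where "dq i j = qpow q (2 * (int i - int j))"

lemma qpow_4: "qpow q 4 = Q * Q * (Q * Q)" "qpow q (-4) = inverse (Q * Q * (Q * Q))"
  using qpow_add[of 2 2] qpow_add[of "-2" "-2"] by simp_all

lemma anti_V_gn:
  assumes "i \<in> {1..3}" "j \<in> {1..3}"
  shows "anti (V i j) (gn g) = dq i j * U i j (gn g)"
proof (cases g)
  case (gE v)
  then show ?thesis using assms Q_nonzero unfolding in_123
    by (cases v) (auto simp: anti_def antipode_gn clinear_neg[OF clinear_V] V_simps U_gn dq_def qpow_4)
next
  case (gF v)
  then show ?thesis using assms Q_nonzero unfolding in_123
    by (cases v) (auto simp: anti_def antipode_gn clinear_neg[OF clinear_V] V_simps U_gn dq_def qpow_4)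
next
  case (gK v)
  then show ?thesis using assms unfolding in_123
    by (cases v) (auto simp: anti_def antipode_gn V_simps U_gn dq_def)
next
  case (gKinv v)
  then show ?thesis using assms unfolding in_123
    by (cases v) (auto simp: anti_def antipode_gn V_simps U_gn dq_def)
qed

lemma dq_mult: "dq i a * dq a j = dq i j" "dq a j * dq i a = dq i j"
  by (simp_all add: dq_def qpow_add[symmetric])

lemma dq_same [simp]: "dq i i = 1"
  by (simp add: dq_def)

text \<open>Both sides turn words into matrix products, the right one because
  \<open>dq i a * dq a j = dq i j\<close>. So the values on generators decide.\<close>

lemma anti_V:
  assumes "i \<in> {1..3}" "j \<in> {1..3}"
  shows "anti (V i j) = dq i j *\<^sub>C U i j"
proof (rule clinear_eq_wdI[OF clinear_anti[OF clinear_V] clinear_scaleC[OF clinear_U]])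
  fix gs
  show "anti (V i j) (wd (Word gs)) = (dq i j *\<^sub>C U i j) (wd (Word gs))"
    using assms
  proof (induction gs arbitrary: i)
    case Nil
    then show ?case by (simp add: wd_Nil anti_one V_one U_one scaleC_fun_apply scaleC_complex_def)
  next
    case (Cons g gs)
    have "anti (V i j) (wd (Word (g # gs))) = (\<Sum>a\<in>{1..3}. anti (V i a) (gn g) * anti (V a j) (wd (Word gs)))"
      using V_mult[OF Cons.prems(1)] by (simp add: wd_Cons anti_def antipode_mult mult.commute)
    also have "\<dots> = (\<Sum>a\<in>{1..3}. dq i j * (U i a (gn g) * U a j (wd (Word gs))))"
      using Cons by (intro sum.cong refl)
        (simp add: anti_V_gn scaleC_fun_apply scaleC_complex_def dq_mult mult_ac)
    also have "\<dots> = (dq i j *\<^sub>C U i j) (wd (Word (g # gs)))"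
      using U_mult[OF Cons.prems(1)] by (simp add: wd_Cons scaleC_fun_apply scaleC_complex_def sum_distrib_left)
    finally show ?case .
  qed
qed

section \<open>The matrix V is inverse to U\<close>

lemma counit_charact:
  assumes "clinear T" "\<And>g. ltr (gn g) T = counit_gen g *\<^sub>C T"
  shows "T = T 1 *\<^sub>C counit"
proof (rule clinear_eq_wdI[OF assms(1) clinear_scaleC[OF clinear_counit]])
  fix gs
  show "T (wd (Word gs)) = (T 1 *\<^sub>C counit) (wd (Word gs))"
  proof (induction gs)
    case Nil
    then show ?case by (simp add: wd_Nil counit_one scaleC_fun_apply scaleC_complex_def)
  next
    case (Cons g gs)
    have "T (wd (Word (g # gs))) = ltr (gn g) T (wd (Word gs))" by (simp add: ltr_def wd_Cons)
    also have "\<dots> = counit_gen g * T (wd (Word gs))"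
      using assms(2)[of g] by (simp add: scaleC_fun_apply scaleC_complex_def)
    finally show ?case
      using Cons by (simp add: wd_Cons counit_mult counit_gn scaleC_fun_apply scaleC_complex_def)
  qed
qed

lemma counit_charact':
  assumes "clinear T" "\<And>g. gn g \<triangleright> T = counit_gen g *\<^sub>C T"
  shows "T = T 1 *\<^sub>C counit"
proof (rule clinear_eq_wdI[OF assms(1) clinear_scaleC[OF clinear_counit]])
  fix gs
  show "T (wd (Word gs)) = (T 1 *\<^sub>C counit) (wd (Word gs))"
  proof (induction gs rule: rev_induct)
    case Nil
    then show ?case by (simp add: wd_Nil counit_one scaleC_fun_apply scaleC_complex_def)
  next
    case (snoc g gs)
    have "T (wd (Word (gs @ [g]))) = (gn g \<triangleright> T) (wd (Word gs))" by (simp add: act_def wd_snoc)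
    also have "\<dots> = counit_gen g * T (wd (Word gs))"
      using assms(2)[of g] by (simp add: scaleC_fun_apply scaleC_complex_def)
    finally show ?case
      using snoc by (simp add: wd_snoc counit_mult counit_gn scaleC_fun_apply scaleC_complex_def)
  qed
qed

lemma clinear_fun_sum: "(\<And>i. i \<in> I \<Longrightarrow> clinear (f i)) \<Longrightarrow> clinear (\<Sum>i\<in>I. f i)"
  by (induction I rule: infinite_finite_induct) (auto simp: clinear_0 clinear_plus)

text \<open>Left translation acts on the summed index of both factors, hence leaves the matrix
  product invariant. For the product in the order \<open>U\<close>, \<open>V\<close> the summed
  index is reached by right translation instead.\<close>

lemma V_U:
  assumes "i \<in> {1..3}" "j \<in> {1..3}"
  shows "(\<Sum>a\<in>{1..3}. V i a \<star> U a j) = of_bool (i = j) *\<^sub>C counit"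
proof -
  let ?T = "\<Sum>a\<in>{1..3}. V i a \<star> U a j"
  have "ltr (gn g) ?T = counit_gen g *\<^sub>C ?T" for g
  proof (cases g)
    case (gE v)
    then show ?thesis using Q_nonzero assms
      by (cases v) (simp_all add: sum_123 ltr_add ltr_conv clinear_U clinear_V ltr_U ltr_V
          U_gn V_gn scaleC_one conv_scale_left conv_scale_right conv_neg_left conv_neg_right scaleC_scaleC)
  next
    case (gF v)
    then show ?thesis using Q_nonzero assms
      by (cases v) (simp_all add: sum_123 ltr_add ltr_conv clinear_U clinear_V ltr_U ltr_V
          U_gn V_gn scaleC_one conv_scale_left conv_scale_right conv_neg_left conv_neg_right scaleC_scaleC)
  next
    case (gK v)
    then show ?thesis using Q_nonzero assms
      by (cases v) (simp_all add: sum_123 ltr_add ltr_conv clinear_U clinear_V ltr_U ltr_V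
          U_gn V_gn scaleC_one conv_scale_left conv_scale_right conv_neg_left conv_neg_right scaleC_scaleC)
  next
    case (gKinv v)
    then show ?thesis using Q_nonzero assms
      by (cases v) (simp_all add: sum_123 ltr_add ltr_conv clinear_U clinear_V ltr_U ltr_V
          U_gn V_gn scaleC_one conv_scale_left conv_scale_right conv_neg_left conv_neg_right scaleC_scaleC)
  qed
  then have "?T = ?T 1 *\<^sub>C counit"
    by (intro counit_charact clinear_fun_sum clinear_conv)
  moreover have "?T 1 = of_bool (i = j)"
    using assms unfolding in_123 by (auto simp: sum_123 conv_one U_one V_one)
  ultimately show ?thesis by simp
qed

lemma U_V:
  assumes "i \<in> {1..3}" "j \<in> {1..3}"
  shows "(\<Sum>a\<in>{1..3}. U i a \<star> V a j) = of_bool (i = j) *\<^sub>C counit"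
proof -
  let ?T = "\<Sum>a\<in>{1..3}. U i a \<star> V a j"
  have "gn g \<triangleright> ?T = counit_gen g *\<^sub>C ?T" for g
  proof (cases g)
    case (gE v)
    then show ?thesis using Q_nonzero assms
      by (cases v) (simp_all add: sum_123 act_add act_conv clinear_U clinear_V act_U act_V
          U_gn V_gn scaleC_one conv_scale_left conv_scale_right conv_neg_left conv_neg_right scaleC_scaleC)
  next
    case (gF v)
    then show ?thesis using Q_nonzero assms
      by (cases v) (simp_all add: sum_123 act_add act_conv clinear_U clinear_V act_U act_V
          U_gn V_gn scaleC_one conv_scale_left conv_scale_right conv_neg_left conv_neg_right scaleC_scaleC)
  next
    case (gK v)
    then show ?thesis using Q_nonzero assms
      by (cases v) (simp_all add: sum_123 act_add act_conv clinear_U clinear_V act_U act_V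
          U_gn V_gn scaleC_one conv_scale_left conv_scale_right conv_neg_left conv_neg_right scaleC_scaleC)
  next
    case (gKinv v)
    then show ?thesis using Q_nonzero assms
      by (cases v) (simp_all add: sum_123 act_add act_conv clinear_U clinear_V act_U act_V
          U_gn V_gn scaleC_one conv_scale_left conv_scale_right conv_neg_left conv_neg_right scaleC_scaleC)
  qed
  then have "?T = ?T 1 *\<^sub>C counit"
    by (intro counit_charact' clinear_fun_sum clinear_conv)
  moreover have "?T 1 = of_bool (i = j)"
    using assms unfolding in_123 by (auto simp: sum_123 conv_one U_one V_one)
  ultimately show ?thesis by simp
qed

lemma counit_antipode: "anti counit = counit"
proof (rule clinear_eq_wdI[OF clinear_anti[OF clinear_counit] clinear_counit])
  fix gs
  show "anti counit (wd (Word gs)) = counit (wd (Word gs))"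
  proof (induction gs)
    case Nil
    then show ?case by (simp add: wd_Nil anti_one)
  next
    case (Cons g gs)
    have "counit (antipode_gen g) = counit_gen g"
      by (cases g) (simp_all add: clinear_neg[OF clinear_counit] counit_mult counit_gn)
    then show ?case using Cons by (simp add: wd_Cons anti_def antipode_mult counit_mult antipode_gn counit_gn)
  qed
qed

text \<open>The antipode applied to \<open>U_V\<close>. The product is reversed, so the sum now runs
  over the row index of \<open>U\<close> and the column index of \<open>V\<close>, at the price of
  the square of the antipode.\<close>

lemma dq_U_V:
  assumes "i \<in> {1..3}" "j \<in> {1..3}"
  shows "(\<Sum>a\<in>{1..3}. dq a j *\<^sub>C (U a j \<star> V i a)) = of_bool (i = j) *\<^sub>C counit"
proof -
  have "anti (\<Sum>a\<in>{1..3}. U i a \<star> V a j) = (\<Sum>a\<in>{1..3}. anti (V a j) \<star> anti (U i a))"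
    using assms by (simp add: clinear_sum[OF clinear_anti_right] anti_conv U_uq_dual V_uq_dual)
  also have "\<dots> = (\<Sum>a\<in>{1..3}. dq a j *\<^sub>C (U a j \<star> V i a))"
    using assms by (simp add: anti_V V_def[symmetric] conv_scale_left)
  finally show ?thesis
    unfolding U_V[OF assms] clinear_scale[OF clinear_anti_right] counit_antipode by (rule sym)
qed

subsection \<open>The quantum group\<close>

text \<open>The antipode exchanges the families \<open>U\<close> and \<open>V\<close> up to scalars
  by \<open>anti_V\<close>, so the span of these products is closed under it.\<close>

inductive_set mons :: "func set" where
  mons_counit: "counit \<in> mons"
| mons_U: "a \<in> mons \<Longrightarrow> i \<in> {1..3} \<Longrightarrow> j \<in> {1..3} \<Longrightarrow> U i j \<star> a \<in> mons"
| mons_V: "a \<in> mons \<Longrightarrow> i \<in> {1..3} \<Longrightarrow> j \<in> {1..3} \<Longrightarrow> V i j \<star> a \<in> mons"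

lemma mons_uq_dual: "a \<in> mons \<Longrightarrow> a \<in> uq_dual q"
  by (induction rule: mons.induct) (blast intro: counit_uq_dual uq_dual_conv U_uq_dual V_uq_dual)+

lemma span_mons_uq_dual: "a \<in> cvec.span mons \<Longrightarrow> a \<in> uq_dual q"
  using cvec.span_minimal[OF _ subspace_uq_dual, of mons q] mons_uq_dual by blast

lemma conv_span:
  assumes "a \<in> cvec.span S" "b \<in> cvec.span T" "\<And>s t. s \<in> S \<Longrightarrow> t \<in> T \<Longrightarrow> s \<star> t \<in> cvec.span R"
  shows "a \<star> b \<in> cvec.span R"
proof (rule clinear_span_subset[OF clinear_conv_left cvec.subspace_span _ assms(1)])
  show "s \<star> b \<in> cvec.span R" if "s \<in> S" for s
    by (rule clinear_span_subset[OF clinear_conv_right cvec.subspace_span _ assms(2)])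
      (use assms(3) that in blast)
qed

lemma mons_conv: "a \<in> mons \<Longrightarrow> b \<in> mons \<Longrightarrow> a \<star> b \<in> mons"
proof (induction rule: mons.induct)
  case mons_counit
  then show ?case using uq_dualD[OF mons_uq_dual] by (simp add: conv_counit)
next
  case (mons_U a i j)
  then show ?case using uq_dualD[OF mons_uq_dual]
    by (simp add: conv_assoc[OF clinear_U] mons.mons_U)
next
  case (mons_V a i j)
  then show ?case using uq_dualD[OF mons_uq_dual]
    by (simp add: conv_assoc[OF clinear_V] mons.mons_V)
qed

lemma span_mons_conv: "a \<in> cvec.span mons \<Longrightarrow> b \<in> cvec.span mons \<Longrightarrow> a \<star> b \<in> cvec.span mons"
  by (rule conv_span) (auto intro: cvec.span_base mons_conv)

lemma mons_U0: "i \<in> {1..3} \<Longrightarrow> j \<in> {1..3} \<Longrightarrow> U i j \<in> mons"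
  using mons.mons_U[OF mons_counit, of i j] by (simp add: conv_counit clinear_U)

lemma mons_V0: "i \<in> {1..3} \<Longrightarrow> j \<in> {1..3} \<Longrightarrow> V i j \<in> mons"
  using mons.mons_V[OF mons_counit, of i j] by (simp add: conv_counit clinear_V)

lemma comult_inI:
  assumes "finite I" "\<And>i. i \<in> I \<Longrightarrow> a i \<in> S \<and> b i \<in> S"
    "\<And>x y. \<phi> (x * y) = (\<Sum>i\<in>I. a i x * b i y)"
  shows "comult_in S \<phi>"
proof -
  obtain h where h: "bij_betw h {0..<card I} I" using ex_bij_betw_nat_finite[OF assms(1)] by blast
  have "(\<Sum>i<card I. a (h i) x * b (h i) y) = (\<Sum>i\<in>I. a i x * b i y)" for x y
    using sum.reindex_bij_betw[OF h, of "\<lambda>i. a i x * b i y"] by (simp add: lessThan_atLeast0)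
  moreover have "\<forall>i<card I. a (h i) \<in> S \<and> b (h i) \<in> S"
    using bij_betwE[OF h] assms(2) by simp
  ultimately show ?thesis unfolding comult_in_def
    using assms(3) by (intro exI[of _ "card I"] exI[of _ "\<lambda>i. a (h i)"] exI[of _ "\<lambda>i. b (h i)"]) simp
qed

lemma comult_in_conv:
  assumes "comult_in S \<phi>" "comult_in S \<psi>" "\<And>a. a \<in> S \<Longrightarrow> clinear a" "clinear \<phi>" "clinear \<psi>"
    "\<And>a b. a \<in> S \<Longrightarrow> b \<in> S \<Longrightarrow> a \<star> b \<in> S"
  shows "comult_in S (\<phi> \<star> \<psi>)"
proof -
  obtain n a b where 1: "\<And>i. i < (n::nat) \<Longrightarrow> a i \<in> S \<and> b i \<in> S" "\<And>x y. \<phi> (x * y) = (\<Sum>i<n. a i x * b i y)"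
    using assms(1) unfolding comult_in_def by blast
  obtain m c d where 2: "\<And>i. i < (m::nat) \<Longrightarrow> c i \<in> S \<and> d i \<in> S" "\<And>x y. \<psi> (x * y) = (\<Sum>i<m. c i x * d i y)"
    using assms(2) unfolding comult_in_def by blast
  show ?thesis
  proof (rule comult_inI[where I = "{..<n} \<times> {..<m}" and a = "\<lambda>(i, j). a i \<star> c j" and b = "\<lambda>(i, j). b i \<star> d j"])
    fix x y
    have "(\<phi> \<star> \<psi>) (x * y) = (\<Sum>i<n. \<Sum>j<m. (a i \<star> c j) x * (b i \<star> d j) y)"
      by (rule conv_split) (use 1 2 assms in auto)
    then show "(\<phi> \<star> \<psi>) (x * y) = (\<Sum>i\<in>{..<n} \<times> {..<m}. (case i of (i, j) \<Rightarrow> a i \<star> c j) x * (case i of (i, j) \<Rightarrow> b i \<star> d j) y)"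
      by (simp add: sum.cartesian_product split_def)
  qed (use 1 2 assms in auto)
qed

lemma comult_in_add:
  assumes "comult_in S \<phi>" "comult_in S \<psi>"
  shows "comult_in S (\<phi> + \<psi>)"
proof -
  obtain n a b where 1: "\<And>i. i < (n::nat) \<Longrightarrow> a i \<in> S \<and> b i \<in> S" "\<And>x y. \<phi> (x * y) = (\<Sum>i<n. a i x * b i y)"
    using assms(1) unfolding comult_in_def by blast
  obtain m c d where 2: "\<And>i. i < (m::nat) \<Longrightarrow> c i \<in> S \<and> d i \<in> S" "\<And>x y. \<psi> (x * y) = (\<Sum>i<m. c i x * d i y)"
    using assms(2) unfolding comult_in_def by blast
  show ?thesis
    by (rule comult_inI[where I = "{..<n} <+> {..<m}" and a = "case_sum a c" and b = "case_sum b d"])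
      (use 1 2 in \<open>auto simp: sum.Plus\<close>)
qed

lemma comult_in_scale:
  assumes "comult_in S \<phi>" "cvec.subspace S"
  shows "comult_in S (c *\<^sub>C \<phi>)"
proof -
  obtain n a b where 1: "\<And>i. i < (n::nat) \<Longrightarrow> a i \<in> S \<and> b i \<in> S" "\<And>x y. \<phi> (x * y) = (\<Sum>i<n. a i x * b i y)"
    using assms(1) unfolding comult_in_def by blast
  show ?thesis
    by (rule comult_inI[where I = "{..<n}" and a = "\<lambda>i. c *\<^sub>C a i" and b = b])
      (use 1 assms(2) in \<open>auto simp: scaleC_fun_apply scaleC_complex_def sum_distrib_left mult.assoc
        intro: cvec.subspace_scale\<close>)
qed

lemma comult_in_zero: "comult_in S 0"
  by (rule comult_inI[where I = "{}"]) auto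

lemma comult_in_mono: "comult_in S \<phi> \<Longrightarrow> S \<subseteq> T \<Longrightarrow> comult_in T \<phi>"
  unfolding comult_in_def by (meson subsetD)

lemma span_mons_comult:
  assumes "\<phi> \<in> cvec.span mons"
  shows "comult_in (cvec.span mons) \<phi>"
proof -
  have lin: "clinear a" if "a \<in> cvec.span mons" for a
    using uq_dualD[OF span_mons_uq_dual[OF that]] .
  have "comult_in (cvec.span mons) a" if "a \<in> mons" for a
    using that
  proof (induction rule: mons.induct)
    case mons_counit
    show ?case
      by (rule comult_inI[where I = "{()}" and a = "\<lambda>_. counit" and b = "\<lambda>_. counit"])
        (auto simp: counit_mult intro: cvec.span_base mons.mons_counit)
  next
    case (mons_U a i j)
    have "comult_in (cvec.span mons) (U i j)"
      by (rule comult_inI[where I = "{1..3}" and a = "U i" and b = "\<lambda>a. U a j"])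
        (use mons_U U_mult in \<open>auto simp del: atLeastAtMost_iff One_nat_def intro: cvec.span_base mons_U0\<close>)
    then show ?case using mons_U
      by (intro comult_in_conv lin span_mons_conv) (blast intro: cvec.span_base mons_U0)+
  next
    case (mons_V a i j)
    have "comult_in (cvec.span mons) (V i j)"
      by (rule comult_inI[where I = "{1..3}" and a = "\<lambda>a. V a j" and b = "V i"])
        (use mons_V V_mult in \<open>auto simp del: atLeastAtMost_iff One_nat_def intro: cvec.span_base mons_V0\<close>)
    then show ?case using mons_V
      by (intro comult_in_conv lin span_mons_conv) (blast intro: cvec.span_base mons_V0)+
  qed
  with assms show ?thesis
    by (induction rule: cvec.span_induct_alt)
      (auto intro!: comult_in_add comult_in_scale comult_in_zero cvec.subspace_span)
qed

lemma span_mons_anti: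
  assumes "\<phi> \<in> cvec.span mons"
  shows "anti \<phi> \<in> cvec.span mons"
proof (rule clinear_span_subset[OF clinear_anti_right cvec.subspace_span _ assms])
  show "anti a \<in> cvec.span mons" if "a \<in> mons" for a
    using that
  proof (induction rule: mons.induct)
    case mons_counit
    then show ?case by (simp add: counit_antipode cvec.span_base mons.mons_counit)
  next
    case (mons_U a i j)
    then show ?case
      by (simp add: anti_conv U_uq_dual mons_uq_dual V_def[symmetric] span_mons_conv cvec.span_base mons_V0)
  next
    case (mons_V a i j)
    then show ?case
      by (simp add: anti_conv V_uq_dual mons_uq_dual anti_V conv_scale_right span_mons_conv
          cvec.span_base mons_U0 cvec.span_scale)
  qed
qed

lemma hopf_subalgebra_span_mons: "hopf_subalgebra q (cvec.span mons)"
  unfolding hopf_subalgebra_def hopf_dual_def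
  using span_mons_comult comult_in_mono[OF span_mons_comult] span_mons_uq_dual span_mons_conv span_mons_anti
  by (auto simp: anti_def cvec.span_base mons_counit)

text \<open>A Hopf subalgebra with all \<open>U i j\<close> also contains their antipodes
  \<open>V i j\<close> and so every monomial; conversely the span of the monomials is a Hopf
  subalgebra.\<close>

theorem OSU3_eq: "OSU3 q = cvec.span mons"
proof
  show "OSU3 q \<subseteq> cvec.span mons"
    unfolding OSU3_def by (rule hull_minimal[where S = "hopf_subalgebra q"])
      (blast intro: cvec.span_base mons_U0 hopf_subalgebra_span_mons)+
  show "cvec.span mons \<subseteq> OSU3 q"
    unfolding OSU3_def hull_def
  proof (rule Inter_greatest)
    fix S assume "S \<in> {t. hopf_subalgebra q t \<and> {U i j |i j. i \<in> {1..3} \<and> j \<in> {1..3}} \<subseteq> t}"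
    then have S: "hopf_subalgebra q S" and U: "\<And>i j. i \<in> {1..3} \<Longrightarrow> j \<in> {1..3} \<Longrightarrow> U i j \<in> S" by blast+
    have V: "V i j \<in> S" if "i \<in> {1..3}" "j \<in> {1..3}" for i j
      using S U[OF that] by (simp add: hopf_subalgebra_def V_def anti_def)
    have "a \<in> S" if "a \<in> mons" for a
      using that by (induction rule: mons.induct) (use S[unfolded hopf_subalgebra_def] U V in blast)+
    then show "cvec.span mons \<subseteq> S"
      using S by (intro cvec.span_minimal) (auto simp: hopf_subalgebra_def)
  qed
qed

end

section \<open>The tangent space\<close>

lemma UNIV_tix: "UNIV = {Ix_E R1, Ix_E R2, Ix_E R12, Ix_F R1, Ix_F R2, Ix_F R12}"
proof -
  have "k \<in> {Ix_E R1, Ix_E R2, Ix_E R12, Ix_F R1, Ix_F R2, Ix_F R12}" for k :: tix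
    by (cases k; cases "case k of Ix_E g \<Rightarrow> g | Ix_F g \<Rightarrow> g") auto
  then show ?thesis by blast
qed

instance tix :: finite
  by standard (simp add: UNIV_tix)

lemma sum_tix: "(\<Sum>k\<in>UNIV. f k) =
    f (Ix_E R1) + f (Ix_E R2) + f (Ix_E R12) + f (Ix_F R1) + f (Ix_F R2) + f (Ix_F R12)"
  for f :: "tix \<Rightarrow> 'a::comm_monoid_add"
  by (simp add: UNIV_tix add.assoc)

lemma tix_cases [case_names E1 E2 E12 F1 F2 F12]:
  obtains "k = Ix_E R1" | "k = Ix_E R2" | "k = Ix_E R12" | "k = Ix_F R1" | "k = Ix_F R2" | "k = Ix_F R12"
  using UNIV_tix by blast

lemma star_superset:
  assumes "finite S" "Poly_Mapping.keys x \<subseteq> S"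
  shows "star x = (\<Sum>w\<in>S. cnj (Poly_Mapping.lookup x w) *\<^sub>C prod_list (map star_gen (rev (letters w))))"
  unfolding star_def
  by (rule sum.mono_neutral_left) (use assms in \<open>auto simp: in_keys_iff\<close>)

lemma star_gn: "star (gn g) = star_gen g"
  by (simp add: star_def gn_def wd_def scaleC_one)

context quantum_flag
begin

abbreviation T :: "tix \<Rightarrow> free" where "T \<equiv> tangent q"

lemma star_E12: "star (E N2 * E N1 - c *\<^sub>C (E N1 * E N2)) =
    K N1 * F N1 * (K N2 * F N2) - cnj c *\<^sub>C (K N2 * F N2 * (K N1 * F N1))"
proof -
  let ?v = "Word [gE N2, gE N1]" and ?w = "Word [gE N1, gE N2]"
  have eq: "E N2 * E N1 - c *\<^sub>C (E N1 * E N2) = wd ?v - c *\<^sub>C wd ?w"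
    by (simp add: gn_def wd_mult plus_word_def)
  have keys: "Poly_Mapping.keys (wd ?v - c *\<^sub>C wd ?w) \<subseteq> {?v, ?w}"
    by (auto simp: in_keys_iff lookup_minus lookup_scaleC wd_def lookup_single when_def scaleC_complex_def
        split: if_splits)
  show ?thesis
    unfolding eq
    by (subst star_superset[OF _ keys]) (simp_all add: lookup_minus lookup_scaleC wd_def lookup_single scaleC_one
        scaleC_complex_def mult.assoc)
qed

lemma act_T:
  assumes "clinear \<phi>"
  shows "T (Ix_E R1) \<triangleright> \<phi> = E N1 \<triangleright> \<phi>" "T (Ix_E R2) \<triangleright> \<phi> = E N2 \<triangleright> \<phi>"
    "T (Ix_E R12) \<triangleright> \<phi> = E N2 \<triangleright> E N1 \<triangleright> \<phi> - inverse Q *\<^sub>C (E N1 \<triangleright> E N2 \<triangleright> \<phi>)"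
    "T (Ix_F R1) \<triangleright> \<phi> = K N1 \<triangleright> F N1 \<triangleright> \<phi>" "T (Ix_F R2) \<triangleright> \<phi> = K N2 \<triangleright> F N2 \<triangleright> \<phi>"
    "T (Ix_F R12) \<triangleright> \<phi> = K N1 \<triangleright> F N1 \<triangleright> K N2 \<triangleright> F N2 \<triangleright> \<phi> -
       inverse Q *\<^sub>C (K N2 \<triangleright> F N2 \<triangleright> K N1 \<triangleright> F N1 \<triangleright> \<phi>)"
proof -
  \<comment> \<open>As \<open>q\<close> is real, the antilinear star fixes the coefficient in the
    composite root vector.\<close>
  have c: "cnj (inverse Q) = inverse Q" by (simp add: Q_def)
  note ex = diff_act[OF assms] scale_act[OF assms] act_mult
  show "T (Ix_E R1) \<triangleright> \<phi> = E N1 \<triangleright> \<phi>" "T (Ix_E R2) \<triangleright> \<phi> = E N2 \<triangleright> \<phi>"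
    "T (Ix_E R12) \<triangleright> \<phi> = E N2 \<triangleright> E N1 \<triangleright> \<phi> - inverse Q *\<^sub>C (E N1 \<triangleright> E N2 \<triangleright> \<phi>)"
    "T (Ix_F R1) \<triangleright> \<phi> = K N1 \<triangleright> F N1 \<triangleright> \<phi>" "T (Ix_F R2) \<triangleright> \<phi> = K N2 \<triangleright> F N2 \<triangleright> \<phi>"
    by (simp_all add: ex star_gn)
  show "T (Ix_F R12) \<triangleright> \<phi> = K N1 \<triangleright> F N1 \<triangleright> K N2 \<triangleright> F N2 \<triangleright> \<phi> -
       inverse Q *\<^sub>C (K N2 \<triangleright> F N2 \<triangleright> K N1 \<triangleright> F N1 \<triangleright> \<phi>)"
    using c by (simp add: star_E12 ex del: complex_cnj_inverse)
qed

fun rootK :: "root \<Rightarrow> free" where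
  "rootK R1 = K N1"
| "rootK R2 = K N2"
| "rootK R12 = K N1 * K N2"

text \<open>
  The coproduct of \<open>T j\<close> is \<open>1 \<otimes> T j + \<Sum>k. T k \<otimes> Tmat k j\<close>, so \<open>Tmat\<close> is the
  matrix of the right action of functions on the dual basis of the tangent space.
\<close>

fun Tmat :: "tix \<Rightarrow> tix \<Rightarrow> free" where
  "Tmat (Ix_E g) (Ix_E h) = (if g = h then rootK g else
     if g = R1 \<and> h = R12 then (1 - inverse (Q * Q)) *\<^sub>C (E N2 * K N1) else 0)"
| "Tmat (Ix_F g) (Ix_F h) = (if g = h then rootK g else
     if g = R1 \<and> h = R12 then (Q - inverse Q) *\<^sub>C (K N2 * F N2 * K N1) else 0)"
| "Tmat (Ix_E g) (Ix_F h) = 0"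
| "Tmat (Ix_F g) (Ix_E h) = 0"

lemma act_T_conv:
  assumes \<phi>: "\<phi> \<in> uq_dual q" and \<psi>: "\<psi> \<in> uq_dual q"
  shows "T j \<triangleright> (\<phi> \<star> \<psi>) = (\<Sum>k\<in>UNIV. (T k \<triangleright> \<phi>) \<star> (Tmat k j \<triangleright> \<psi>)) + \<phi> \<star> (T j \<triangleright> \<psi>)"
proof -
  note lin = uq_dualD[OF \<phi>] uq_dualD[OF \<psi>] clinear_conv
  note ex = lin act_T act_conv clinear_act act_add act_diff act_scale conv_add_left conv_add_right
    conv_diff_left conv_diff_right conv_scale_left conv_scale_right zero_act scale_act act_mult
    scaleC_scaleC scaleC_one
  note rel = K_Kinv Kinv_K K_E K_F Kinv_E Kinv_F uq_dual_act \<phi> \<psi> cartan_def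
  have "T j \<triangleright> (\<phi> \<star> \<psi>) = (\<Sum>k\<in>UNIV. (T k \<triangleright> \<phi>) \<star> (Tmat k j \<triangleright> \<psi>)) + \<phi> \<star> (T j \<triangleright> \<psi>)"
    unfolding sum_tix
    by (cases j rule: tix_cases; simp del: tangent.simps add: ex; simp add: ex rel K_K[of _ N2 N1];
        simp add: fun_eq_iff scaleC_fun_apply scaleC_complex_def Q_nonzero field_simps)
  then show ?thesis .
qed


abbreviation A :: "func set" where "A \<equiv> OSU3 q"

lemma A_hopf: "hopf_subalgebra q A"
  by (simp add: OSU3_eq hopf_subalgebra_span_mons)

lemma A_uq_dual: "a \<in> A \<Longrightarrow> a \<in> uq_dual q"
  using A_hopf by (auto simp: hopf_subalgebra_def hopf_dual_def)

lemma A_clinear: "a \<in> A \<Longrightarrow> clinear a"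
  by (rule uq_dualD[OF A_uq_dual])

lemma A_subspace: "cvec.subspace A"
  and A_counit: "counit \<in> A"
  and A_conv: "a \<in> A \<Longrightarrow> b \<in> A \<Longrightarrow> a \<star> b \<in> A"
  and A_comult: "a \<in> A \<Longrightarrow> comult_in A a"
  using A_hopf by (auto simp: hopf_subalgebra_def)

lemmas A_zero = cvec.subspace_0[OF A_subspace]
  and A_add = cvec.subspace_add[OF A_subspace]
  and A_scale = cvec.subspace_scale[OF A_subspace]
  and A_sum = cvec.subspace_sum[OF A_subspace]

lemma A_U: "i \<in> {1..3} \<Longrightarrow> j \<in> {1..3} \<Longrightarrow> U i j \<in> A"
  by (simp add: OSU3_eq cvec.span_base mons_U0)

lemma A_V: "i \<in> {1..3} \<Longrightarrow> j \<in> {1..3} \<Longrightarrow> V i j \<in> A"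
  by (simp add: OSU3_eq cvec.span_base mons_V0)

lemma A_act_ltr:
  assumes "a \<in> A"
  shows A_act: "x \<triangleright> a \<in> A" and A_ltr: "ltr x a \<in> A"
proof -
  obtain n b c where n: "\<And>i. i < (n::nat) \<Longrightarrow> b i \<in> A \<and> c i \<in> A" "\<And>x y. a (x * y) = (\<Sum>i<n. b i x * c i y)"
    using A_comult[OF assms] unfolding comult_in_def by blast
  have "x \<triangleright> a = (\<Sum>i<n. c i x *\<^sub>C b i)" "ltr x a = (\<Sum>i<n. b i x *\<^sub>C c i)"
    by (simp_all add: act_def ltr_def fun_eq_iff n(2) sum_fun_apply scaleC_fun_apply scaleC_complex_def mult.commute)
  then show "x \<triangleright> a \<in> A" "ltr x a \<in> A"
    using n(1) by (auto intro!: A_sum A_scale)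
qed

lemma A_conv_assoc: "a \<in> A \<Longrightarrow> b \<in> A \<Longrightarrow> c \<in> A \<Longrightarrow> a \<star> b \<star> c = a \<star> (b \<star> c)"
  by (simp add: conv_assoc A_clinear)

subsection \<open>Weights\<close>

text \<open>The weights of the vector representation: \<open>K v\<close> acts on column
  \<open>j\<close> of \<open>U\<close> by this power of \<open>q\<close>.\<close>

definition colwt :: "nat \<Rightarrow> node \<Rightarrow> int"
  where "colwt j v = of_bool (num v + 1 = j) - of_bool (num v = j)"

text \<open>The tangent vector \<open>T k\<close> corresponds to the matrix unit at \<open>(top_ix k, bot_ix k)\<close>.\<close>

fun top_ix :: "tix \<Rightarrow> nat" where
  "top_ix (Ix_E R1) = 2" | "top_ix (Ix_E R2) = 3" | "top_ix (Ix_E R12) = 3"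
| "top_ix (Ix_F R1) = 1" | "top_ix (Ix_F R2) = 2" | "top_ix (Ix_F R12) = 1"

fun bot_ix :: "tix \<Rightarrow> nat" where
  "bot_ix (Ix_E R1) = 1" | "bot_ix (Ix_E R2) = 2" | "bot_ix (Ix_E R12) = 1"
| "bot_ix (Ix_F R1) = 2" | "bot_ix (Ix_F R2) = 3" | "bot_ix (Ix_F R12) = 3"

lemma ix_123: "top_ix k \<in> {1..3}" "bot_ix k \<in> {1..3}"
  by (cases k rule: tix_cases; simp)+

definition wt :: "tix \<Rightarrow> node \<Rightarrow> int" where "wt k = colwt (top_ix k) - colwt (bot_ix k)"

definition Aw :: "(node \<Rightarrow> int) \<Rightarrow> func set"
  where "Aw \<alpha> = {a \<in> A. \<forall>i. K i \<triangleright> a = qpow q (\<alpha> i) *\<^sub>C a}"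

lemma Aw_A: "a \<in> Aw \<alpha> \<Longrightarrow> a \<in> A"
  by (simp add: Aw_def)

lemma Aw_subspace: "cvec.subspace (Aw \<alpha>)"
  unfolding Aw_def cvec.subspace_def
  by (auto simp: A_zero A_add A_scale act_add act_scale scaleC_add_right scaleC_scaleC mult.commute)

lemmas Aw_zero = cvec.subspace_0[OF Aw_subspace]
  and Aw_add = cvec.subspace_add[OF Aw_subspace]
  and Aw_scale = cvec.subspace_scale[OF Aw_subspace]
  and Aw_sum = cvec.subspace_sum[OF Aw_subspace]

lemma OF3_eq: "OF3 q = Aw 0"
proof -
  have "Kinv i \<triangleright> b = b" if "b \<in> A" "K i \<triangleright> b = b" for i b
    using Kinv_K[OF A_uq_dual[OF that(1)], of i] that(2) by simp
  then show ?thesis unfolding OF3_def Aw_def by (auto simp: scaleC_one)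
qed

lemma Aw_conv: "a \<in> Aw \<alpha> \<Longrightarrow> b \<in> Aw \<mu> \<Longrightarrow> a \<star> b \<in> Aw (\<alpha> + \<mu>)"
  by (simp add: Aw_def A_conv act_conv A_clinear conv_scale_left conv_scale_right scaleC_scaleC qpow_add mult.commute)

lemma Aw_conv': "a \<in> Aw \<alpha> \<Longrightarrow> b \<in> Aw \<mu> \<Longrightarrow> \<nu> = \<alpha> + \<mu> \<Longrightarrow> a \<star> b \<in> Aw \<nu>"
  using Aw_conv by blast

lemma Aw_counit: "counit \<in> Aw 0"
  by (simp add: Aw_def A_counit act_counit counit_gn)

lemma Aw_U:
  assumes "i \<in> {1..3}" "j \<in> {1..3}"
  shows "U i j \<in> Aw (colwt j)"
proof -
  have "K v \<triangleright> U i j = qpow q ((colwt j) v) *\<^sub>C U i j" for v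
    using assms unfolding in_123
    by (cases v) (auto simp: act_U U_gn sum_123 colwt_def scaleC_one)
  then show ?thesis using A_U[OF assms] unfolding Aw_def by blast
qed

lemma Aw_V:
  assumes "i \<in> {1..3}" "j \<in> {1..3}"
  shows "V i j \<in> Aw (- colwt i)"
proof -
  have "K v \<triangleright> V i j = qpow q ((- colwt i) v) *\<^sub>C V i j" for v
    using assms unfolding in_123
    by (cases v) (auto simp: act_V V_gn sum_123 colwt_def scaleC_one)
  then show ?thesis using A_V[OF assms] unfolding Aw_def by blast
qed

lemma Aw_disjoint: "a \<in> Aw \<alpha> \<Longrightarrow> a \<in> Aw \<mu> \<Longrightarrow> a \<noteq> 0 \<Longrightarrow> \<alpha> = \<mu>"
proof (rule ext)
  fix i assume a: "a \<in> Aw \<alpha>" "a \<in> Aw \<mu>" "a \<noteq> 0"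
  have "qpow q (\<alpha> i) *\<^sub>C a = K i \<triangleright> a" "K i \<triangleright> a = qpow q (\<mu> i) *\<^sub>C a"
    using a(1) a(2)[unfolded Aw_def] by (simp add: Aw_def, blast)
  then have "qpow q (\<alpha> i) *\<^sub>C a = qpow q (\<mu> i) *\<^sub>C a" by (rule trans)
  then show "\<alpha> i = \<mu> i" using a(3) by (simp add: qpow_inj)
qed

lemma K_T:
  assumes "\<phi> \<in> uq_dual q"
  shows "K i \<triangleright> T k \<triangleright> \<phi> = qpow q (wt k i) *\<^sub>C (T k \<triangleright> K i \<triangleright> \<phi>)"
proof -
  note lin = uq_dualD[OF assms]
  show ?thesis
    by (cases k rule: tix_cases; cases i;
        simp add: act_T lin clinear_act wt_def colwt_def del: tangent.simps;
        simp add: act_diff act_scale K_E K_F K_K[of _ N2 N1] uq_dual_act assms cartan_def scaleC_scaleC;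
        simp add: fun_eq_iff scaleC_fun_apply scaleC_complex_def Q_nonzero field_simps)
qed

lemma Aw_act_T:
  assumes "a \<in> Aw \<alpha>"
  shows "T k \<triangleright> a \<in> Aw (\<alpha> + wt k)"
  using assms unfolding Aw_def
  by (auto simp: A_act K_T A_uq_dual act_scale scaleC_scaleC qpow_add mult.commute)

text \<open>The coproduct of \<open>T j\<close> is homogeneous, so \<open>Tmat k j\<close> has
  weight \<open>wt j - wt k\<close>.\<close>

lemma Aw_act_Tmat:
  assumes a: "a \<in> Aw \<alpha>"
  shows "Tmat k j \<triangleright> a \<in> Aw (\<alpha> + wt j - wt k)"
proof -
  note lin = A_clinear[OF Aw_A[OF a]]
  have K: "K i \<triangleright> b \<in> Aw \<mu>" if "b \<in> Aw \<mu>" for i b \<mu>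
  proof -
    have "K i \<triangleright> b = qpow q (\<mu> i) *\<^sub>C b" using that by (simp add: Aw_def)
    then show ?thesis using Aw_scale[OF that] by simp
  qed
  have E: "E N2 \<triangleright> b \<in> Aw (\<mu> + wt (Ix_E R2))" if "b \<in> Aw \<mu>" for b \<mu>
    using Aw_act_T[OF that, of "Ix_E R2"] by simp
  have F: "K N2 \<triangleright> F N2 \<triangleright> b \<in> Aw (\<mu> + wt (Ix_F R2))" if "b \<in> Aw \<mu>" for b \<mu>
    using Aw_act_T[OF that, of "Ix_F R2"] by (simp add: act_T A_clinear Aw_A[OF that] del: tangent.simps)
  have w: "wt (Ix_E R2) = wt (Ix_E R12) - wt (Ix_E R1)" "wt (Ix_F R2) = wt (Ix_F R12) - wt (Ix_F R1)"
    by (simp_all add: wt_def)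
  show ?thesis
    using K[OF a] K[OF K[OF a]] Aw_scale[OF E[OF K[OF a, of N1]]] Aw_scale[OF F[OF K[OF a, of N1]]]
    by (cases k rule: tix_cases; cases j rule: tix_cases)
      (simp_all add: lin zero_act Aw_zero act_mult scale_act w add_diff_eq)
qed

section \<open>The bimodule of one-forms\<close>

lemma conv_T:
  assumes "\<phi> \<in> uq_dual q" "\<psi> \<in> uq_dual q"
  shows "(\<phi> \<star> \<psi>) (T j) = (\<Sum>k\<in>UNIV. \<phi> (T k) * \<psi> (Tmat k j)) + \<phi> 1 * \<psi> (T j)"
proof -
  have ev: "(x \<triangleright> f) 1 = f x" for f :: func and x by (simp add: act_def)
  have "(\<phi> \<star> \<psi>) (T j) = (T j \<triangleright> (\<phi> \<star> \<psi>)) 1" by (simp only: ev)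
  also have "\<dots> = (\<Sum>k\<in>UNIV. \<phi> (T k) * \<psi> (Tmat k j)) + \<phi> 1 * \<psi> (T j)"
    by (simp add: act_T_conv[OF assms] sum_fun_apply conv_one ev)
  finally show ?thesis .
qed

lemma UV_T:
  assumes "i \<in> {1..3}" "j \<in> {1..3}" "l \<in> {1..3}"
  shows "(U i j \<star> V j l) (T k) = (\<Sum>n\<in>UNIV. U i j (T n) * V j l (Tmat n k)) + U i j 1 * V j l (T k)"
  by (rule conv_T) (use assms U_uq_dual V_uq_dual in blast)+

lemma U_T:
  assumes "i \<in> {1..3}" "j \<in> {1..3}"
  shows "U i j (T k) = of_bool (i = top_ix k \<and> j = bot_ix k) *
    (case k of Ix_E _ \<Rightarrow> 1 | Ix_F R12 \<Rightarrow> inverse (Q * Q) | Ix_F _ \<Rightarrow> inverse Q)"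
proof -
  have ev: "U i j (T k) = (T k \<triangleright> U i j) 1" by (simp add: act_def)
  show ?thesis
    using assms Q_nonzero unfolding ev in_123
    by (cases k rule: tix_cases;
        auto simp: act_T clinear_U clinear_act act_U U_gn sum_123 act_add act_scale act_diff U_one
          scaleC_fun_apply scaleC_complex_def field_simps simp del: tangent.simps)
qed

end

lemma sum_swap3: "(\<Sum>b\<in>J. \<Sum>c\<in>M. \<Sum>d\<in>N. g b c d) = (\<Sum>c\<in>M. \<Sum>d\<in>N. \<Sum>b\<in>J. g b c d)"
  by (rule trans[OF sum.swap]) (intro sum.cong refl sum.swap)

lemma sum_swap4: "(\<Sum>a\<in>I. \<Sum>b\<in>J. \<Sum>c\<in>M. \<Sum>d\<in>N. g a b c d) =
    (\<Sum>c\<in>M. \<Sum>d\<in>N. \<Sum>a\<in>I. \<Sum>b\<in>J. g a b c d)"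
  by (rule trans[OF sum.cong[OF refl sum_swap3] sum_swap3])

section \<open>Matrix coefficients of weight zero and their antipodes\<close>

context quantum_flag
begin

text \<open>Matrix coefficients of the vector representation tensored with its dual, at the weight
  zero vector with coordinates \<open>z\<close>. They lie in \<open>B\<close> and are closed under
  taking second Sweedler legs.\<close>

definition yz :: "(nat \<Rightarrow> complex) \<Rightarrow> nat \<Rightarrow> nat \<Rightarrow> func"
  where "yz z m n = (\<Sum>j\<in>{1..3}. z j *\<^sub>C (U m j \<star> V j n))"

text \<open>This is the antipode of \<open>U (top_ix k) m \<star> V n (bot_ix k)\<close>, the first
  Sweedler leg of \<open>y_elt z k\<close> that belongs to the second leg
  \<open>yz z m n\<close>.\<close>

definition tz :: "tix \<Rightarrow> nat \<Rightarrow> nat \<Rightarrow> func"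
  where "tz k m n = dq n (bot_ix k) *\<^sub>C (U n (bot_ix k) \<star> V (top_ix k) m)"

abbreviation y_elt :: "(nat \<Rightarrow> complex) \<Rightarrow> tix \<Rightarrow> func"
  where "y_elt z k \<equiv> yz z (top_ix k) (bot_ix k)"

lemma yz_Aw: "m \<in> {1..3} \<Longrightarrow> n \<in> {1..3} \<Longrightarrow> yz z m n \<in> Aw 0"
  unfolding yz_def by (intro Aw_sum Aw_scale Aw_conv'[OF Aw_U Aw_V]) auto

lemma tz_Aw: "m \<in> {1..3} \<Longrightarrow> n \<in> {1..3} \<Longrightarrow> tz k m n \<in> Aw (- wt k)"
  unfolding tz_def by (intro Aw_scale Aw_conv'[OF Aw_U Aw_V] ix_123) (auto simp: wt_def)

lemma act_UV:
  assumes "m \<in> {1..3}" "n \<in> {1..3}" "j \<in> {1..3}"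
  shows "X \<triangleright> (U m j \<star> V j n) =
    (\<Sum>m'\<in>{1..3}. \<Sum>n'\<in>{1..3}. (U m' j \<star> V j n') X *\<^sub>C (U m m' \<star> V n' n))"
proof
  fix x
  have "(U m j \<star> V j n) (x * X) = (\<Sum>m'\<in>{1..3}. \<Sum>n'\<in>{1..3}. (U m m' \<star> V n' n) x * (U m' j \<star> V j n') X)"
    by (rule conv_split) (use U_mult V_mult assms clinear_U clinear_V in auto)
  then show "(X \<triangleright> (U m j \<star> V j n)) x =
    (\<Sum>m'\<in>{1..3}. \<Sum>n'\<in>{1..3}. (U m' j \<star> V j n') X *\<^sub>C (U m m' \<star> V n' n)) x"
    by (simp only: act_def sum_fun_apply scaleC_fun_apply scaleC_complex_def mult.commute)
qed

lemma act_yz: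
  assumes "m \<in> {1..3}" "n \<in> {1..3}"
  shows "X \<triangleright> yz z m n = (\<Sum>m'\<in>{1..3}. \<Sum>n'\<in>{1..3}. yz z m' n' X *\<^sub>C (U m m' \<star> V n' n))"
proof -
  have "X \<triangleright> yz z m n = (\<Sum>j\<in>{1..3}. z j *\<^sub>C (\<Sum>m'\<in>{1..3}. \<Sum>n'\<in>{1..3}. (U m' j \<star> V j n') X *\<^sub>C (U m m' \<star> V n' n)))"
    unfolding yz_def act_sum act_scale by (intro sum.cong refl) (simp only: act_UV[OF assms])
  also have "\<dots> = (\<Sum>m'\<in>{1..3}. \<Sum>j\<in>{1..3}. \<Sum>n'\<in>{1..3}. z j *\<^sub>C (U m' j \<star> V j n') X *\<^sub>C (U m m' \<star> V n' n))"
    unfolding cvec.scale_sum_right by (rule sum.swap)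
  also have "\<dots> = (\<Sum>m'\<in>{1..3}. \<Sum>n'\<in>{1..3}. \<Sum>j\<in>{1..3}. z j *\<^sub>C (U m' j \<star> V j n') X *\<^sub>C (U m m' \<star> V n' n))"
    by (intro sum.cong refl sum.swap)
  also have "\<dots> = (\<Sum>m'\<in>{1..3}. \<Sum>n'\<in>{1..3}. yz z m' n' X *\<^sub>C (U m m' \<star> V n' n))"
    unfolding yz_def sum_fun_apply scaleC_fun_apply cvec.scale_sum_left
    by (simp only: scaleC_complex_def scaleC_scaleC mult.assoc)
  finally show ?thesis .
qed

text \<open>The inner factors \<open>V\<close> and \<open>U\<close> contract by \<open>V_U\<close>,
  after which the outer ones meet and contract by \<open>dq_U_V\<close>.\<close>

lemma tz_UV:
  assumes "m' \<in> {1..3}" "n' \<in> {1..3}"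
  shows "(\<Sum>m\<in>{1..3}. \<Sum>n\<in>{1..3}. tz k m n \<star> (U m m' \<star> V n' n)) =
    of_bool (m' = top_ix k \<and> n' = bot_ix k) *\<^sub>C counit"
proof -
  have "tz k m n \<star> (U m m' \<star> V n' n) =
      dq n (bot_ix k) *\<^sub>C (U n (bot_ix k) \<star> ((V (top_ix k) m \<star> U m m') \<star> V n' n))" for m n
    by (simp add: tz_def conv_scale_left conv_assoc clinear_U clinear_V clinear_conv)
  then have "(\<Sum>m\<in>{1..3}. \<Sum>n\<in>{1..3}. tz k m n \<star> (U m m' \<star> V n' n)) =
     (\<Sum>n\<in>{1..3}. \<Sum>m\<in>{1..3}. dq n (bot_ix k) *\<^sub>C (U n (bot_ix k) \<star> ((V (top_ix k) m \<star> U m m') \<star> V n' n)))"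
    by (subst sum.swap) simp
  also have "\<dots> = (\<Sum>n\<in>{1..3}. dq n (bot_ix k) *\<^sub>C (U n (bot_ix k) \<star> ((\<Sum>m\<in>{1..3}. V (top_ix k) m \<star> U m m') \<star> V n' n)))"
    by (simp only: conv_sum_left conv_sum_right cvec.scale_sum_right)
  also have "\<dots> = of_bool (top_ix k = m') *\<^sub>C (\<Sum>n\<in>{1..3}. dq n (bot_ix k) *\<^sub>C (U n (bot_ix k) \<star> V n' n))"
    unfolding V_U[OF ix_123(1) assms(1)] cvec.scale_sum_right
    by (simp only: conv_scale_left conv_scale_right conv_counit clinear_V cvec.scale_left_commute)
  also have "\<dots> = of_bool (m' = top_ix k \<and> n' = bot_ix k) *\<^sub>C counit"
    unfolding dq_U_V[OF assms(2) ix_123(2)] by (auto simp: scaleC_one)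
  finally show ?thesis .
qed

text \<open>
  In Sweedler notation this is \<open>a S(y\<^sub>(\<^sub>1\<^sub>)) (X \<triangleright> y\<^sub>(\<^sub>2\<^sub>)) = y(X) a\<close> for \<open>y = y_elt z k\<close>.
\<close>

lemma tz_yz:
  assumes a: "a \<in> A"
  shows "(\<Sum>m\<in>{1..3}. \<Sum>n\<in>{1..3}. a \<star> tz k m n \<star> (X \<triangleright> yz z m n)) = y_elt z k X *\<^sub>C a"
proof -
  have "(\<Sum>m\<in>{1..3}. \<Sum>n\<in>{1..3}. tz k m n \<star> (X \<triangleright> yz z m n)) =
    (\<Sum>m\<in>{1..3}. \<Sum>n\<in>{1..3}. \<Sum>m'\<in>{1..3}. \<Sum>n'\<in>{1..3}. yz z m' n' X *\<^sub>C (tz k m n \<star> (U m m' \<star> V n' n)))"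
    by (intro sum.cong refl) (simp only: act_yz conv_sum_right conv_scale_right)
  also have "\<dots> = (\<Sum>m'\<in>{1..3}. \<Sum>n'\<in>{1..3}. \<Sum>m\<in>{1..3}. \<Sum>n\<in>{1..3}. yz z m' n' X *\<^sub>C (tz k m n \<star> (U m m' \<star> V n' n)))"
    by (rule sum_swap4)
  also have "\<dots> = (\<Sum>m'\<in>{1..3}. \<Sum>n'\<in>{1..3}. yz z m' n' X *\<^sub>C of_bool (m' = top_ix k \<and> n' = bot_ix k) *\<^sub>C counit)"
    by (intro sum.cong refl) (simp only: cvec.scale_sum_right[symmetric] tz_UV)
  also have "\<dots> = y_elt z k X *\<^sub>C counit"
    by (cases k rule: tix_cases) (simp_all add: sum_123 scaleC_one)
  finally have eq: "(\<Sum>m\<in>{1..3}. \<Sum>n\<in>{1..3}. tz k m n \<star> (X \<triangleright> yz z m n)) = y_elt z k X *\<^sub>C counit" .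
  have "(\<Sum>m\<in>{1..3}. \<Sum>n\<in>{1..3}. a \<star> tz k m n \<star> (X \<triangleright> yz z m n)) =
      a \<star> (\<Sum>m\<in>{1..3}. \<Sum>n\<in>{1..3}. tz k m n \<star> (X \<triangleright> yz z m n))"
    unfolding conv_sum_right
    by (intro sum.cong refl A_conv_assoc a Aw_A[OF tz_Aw] A_act Aw_A[OF yz_Aw])
  then show ?thesis
    by (simp only: eq conv_scale_right conv_counit A_clinear[OF a])
qed

subsection \<open>Functions dual to the tangent vectors\<close>

text \<open>The value of \<open>U (top_ix k) (bot_ix k) \<star> V (bot_ix k) (bot_ix k)\<close> at
  \<open>T k\<close>, used to normalize the dual function.\<close>

fun cm :: "tix \<Rightarrow> complex" where
  "cm (Ix_E _) = Q"
| "cm (Ix_F R12) = inverse (Q * Q * Q)"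
| "cm (Ix_F _) = inverse (Q * Q)"

definition zd :: "tix \<Rightarrow> nat \<Rightarrow> complex" where "zd k j = (if j = bot_ix k then inverse (cm k) else 0)"

lemma zd_yz: "yz (zd k) m n = inverse (cm k) *\<^sub>C (U m (bot_ix k) \<star> V (bot_ix k) n)"
  by (cases k rule: tix_cases) (simp_all add: yz_def sum_123 zd_def)

text \<open>Among the tangent vectors \<open>U (top_ix k) (bot_ix k)\<close> detects only
  \<open>T k\<close>, and the diagonal entry \<open>V (bot_ix k) (bot_ix k)\<close> does not see the
  off-diagonal part of \<open>Tmat\<close>.\<close>

lemma zd_T: "y_elt (zd k) k (T j) = of_bool (j = k)"
proof -
  show ?thesis
    unfolding zd_yz scaleC_fun_apply UV_T[OF ix_123 ix_123(2)] sum_tix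
    using Q_nonzero
    by (cases k rule: tix_cases; cases j rule: tix_cases)
      (simp_all add: U_T U_one V_simps scaleC_complex_def field_simps del: tangent.simps)
qed

lemma yz_one: "m \<noteq> n \<Longrightarrow> m \<in> {1..3} \<Longrightarrow> n \<in> {1..3} \<Longrightarrow> yz z m n 1 = 0"
  by (simp only: yz_def sum_fun_apply scaleC_fun_apply conv_one U_one V_one) (auto simp: scaleC_complex_def intro!: sum.neutral)

lemma top_neq_bot: "top_ix k \<noteq> bot_ix k"
  by (cases k rule: tix_cases) simp_all

lemma y_elt_one: "y_elt z k 1 = 0"
  by (rule yz_one[OF top_neq_bot ix_123])

text \<open>
  The coefficients are chosen such that \<open>y_elt (zr k) k\<close> vanishes on the tangent space but not
  on products of two tangent vectors; except for \<open>Ix_F R12\<close> a single summand does it.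
\<close>

definition zr :: "tix \<Rightarrow> nat \<Rightarrow> complex"
  where "zr k j = (if j \<noteq> top_ix k \<and> j \<noteq> bot_ix k then 1
    else if k = Ix_F R12 \<and> j = top_ix k then 1 - Q * Q else 0)"

lemma V_T:
  assumes "i \<in> {1..3}" "j \<in> {1..3}"
  shows "V i j (T k) = of_bool (i = top_ix k \<and> j = bot_ix k) *
    (case k of Ix_E _ \<Rightarrow> - Q | Ix_F R12 \<Rightarrow> - inverse (Q * Q * Q * Q * Q) | Ix_F _ \<Rightarrow> - inverse (Q * Q))"
proof -
  have ev: "V i j (T k) = (T k \<triangleright> V i j) 1" by (simp add: act_def)
  show ?thesis
    using assms Q_nonzero unfolding ev in_123
    by (cases k rule: tix_cases;
        auto simp: act_T clinear_V clinear_act act_V V_gn sum_123 act_add act_scale act_diff act_neg V_one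
          scaleC_fun_apply scaleC_complex_def field_simps simp del: tangent.simps)
qed

text \<open>For \<open>Ix_F R12\<close> the middle summand does not vanish at \<open>T k\<close>,
  because of the off-diagonal entry of \<open>Tmat\<close> from \<open>Ix_F R1\<close> to
  \<open>Ix_F R12\<close>. The top summand with coefficient \<open>1 - Q * Q\<close> cancels
  it.\<close>

lemma zr_T: "y_elt (zr k) k (T j) = 0"
proof -
  have "(\<Sum>i\<in>{1..3}. zr k i * (U (top_ix k) i \<star> V i (bot_ix k)) (T j)) = 0"
    using Q_nonzero
    by (cases k rule: tix_cases; cases j rule: tix_cases)
     (simp_all add: zr_def UV_T sum_tix sum_123 U_T V_T U_one V_simps scaleC_complex_def del: tangent.simps,
      simp_all add: field_simps)
  then show ?thesis
    by (simp only: yz_def sum_fun_apply scaleC_fun_apply scaleC_complex_def)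
qed


subsection \<open>Quadratic relations between tangent vectors\<close>

text \<open>The two roots with sum \<open>m\<close>, ordered so that for \<open>Ix_E R12\<close> and
  \<open>Ix_F R12\<close> the relation in \<open>T_relation\<close> is the definition of the root
  vector.\<close>

fun pr1 :: "tix \<Rightarrow> tix" where
  "pr1 (Ix_E R1) = Ix_E R12" | "pr1 (Ix_E R2) = Ix_E R12" | "pr1 (Ix_E R12) = Ix_E R2"
| "pr1 (Ix_F R1) = Ix_F R12" | "pr1 (Ix_F R2) = Ix_F R12" | "pr1 (Ix_F R12) = Ix_F R1"

fun pr2 :: "tix \<Rightarrow> tix" where
  "pr2 (Ix_E R1) = Ix_F R2" | "pr2 (Ix_E R2) = Ix_F R1" | "pr2 (Ix_E R12) = Ix_E R1"
| "pr2 (Ix_F R1) = Ix_E R2" | "pr2 (Ix_F R2) = Ix_E R1" | "pr2 (Ix_F R12) = Ix_F R2"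

lemma wt_sum_iff: "wt m = wt k + wt l \<longleftrightarrow> (k = pr1 m \<and> l = pr2 m) \<or> (k = pr2 m \<and> l = pr1 m)"
  unfolding fun_eq_iff node_forall
  by (cases m rule: tix_cases; cases k rule: tix_cases; cases l rule: tix_cases)
    (simp_all add: wt_def colwt_def)

lemma pr_neq: "pr1 m \<noteq> pr2 m"
  by (cases m rule: tix_cases) simp_all

text \<open>The constants \<open>xr\<close> and \<open>kr\<close> are those of the definition of the
  root vector for the two composite indices. For the others they result from moving an E past an F
  and setting \<open>K i\<close> to 1.\<close>

fun xr :: "tix \<Rightarrow> complex" where
  "xr (Ix_E _) = - inverse Q" | "xr (Ix_F R12) = - inverse Q" | "xr (Ix_F _) = - Q"

fun kr :: "tix \<Rightarrow> complex" where
  "kr (Ix_E R1) = - inverse (Q * Q)" | "kr (Ix_E R2) = inverse (Q * Q * Q)" | "kr (Ix_E R12) = 1"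
| "kr (Ix_F R1) = inverse Q" | "kr (Ix_F R2) = - 1" | "kr (Ix_F R12) = 1"

lemma xr_nonzero: "xr m \<noteq> 0"
  using Q_nonzero by (cases m rule: tix_cases) simp_all

text \<open>For a simple root one factor is a composite root vector and the other a simple one of
  opposite sign. Their commutation leaves terms with \<open>K i\<close> and \<open>Kinv i\<close>,
  which become powers of \<open>q\<close> because both fix \<open>b\<close>.\<close>

lemma T_relation:
  assumes "b \<in> Aw 0"
  shows "T (pr1 m) \<triangleright> T (pr2 m) \<triangleright> b + xr m *\<^sub>C (T (pr2 m) \<triangleright> T (pr1 m) \<triangleright> b) = kr m *\<^sub>C (T m \<triangleright> b)"
proof -
  have b: "b \<in> uq_dual q" by (rule A_uq_dual[OF Aw_A[OF assms]])
  have Kb: "K i \<triangleright> b = b" for i using assms by (simp add: Aw_def scaleC_one)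
  have Kb': "Kinv i \<triangleright> b = b" for i using Kinv_K[OF b, of i] by (simp add: Kb)
  define \<kappa> where "\<kappa> = 1 / (Q - inverse Q)"
  \<comment> \<open>This is \<open>\<kappa> * (Q - inverse Q) = 1\<close>, cleared of the
    inverse.\<close>
  have \<kappa>: "\<kappa> * Q * Q = Q + \<kappa>"
    using Q_nonzero Q_square by (simp add: \<kappa>_def field_simps)
  note rl = act_add act_diff act_scale act_neg scaleC_scaleC K_E K_F Kinv_E Kinv_F E_F E_F_same[folded \<kappa>_def]
    uq_dual_act b Kb Kb' cartan_def scaleC_one
  have fin: "\<kappa> * (Q * (Q * c)) = Q * c + \<kappa> * c" for c
    using arg_cong[OF \<kappa>, of "\<lambda>z. z * c"] by (simp only: mult.assoc distrib_right)
  have diff: "clinear (f - g)" if "clinear f" "clinear g" for f g :: func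
    using clinear_plus[OF that(1) clinear_scaleC[OF that(2), of "-1"]] by simp
  show ?thesis
    using Q_nonzero
    by (cases m rule: tix_cases;
        simp add: act_T uq_dualD[OF b] clinear_act diff clinear_scaleC del: tangent.simps;
        simp add: rl del: tangent.simps; simp add: fun_eq_iff scaleC_fun_apply scaleC_complex_def;
        (simp add: field_simps)?; (simp add: fin algebra_simps)?)
qed

lemma act_act_one: "(x \<triangleright> y \<triangleright> b) 1 = b (x * y)"
  by (simp add: act_def)

lemma T_relation_one:
  assumes "b \<in> Aw 0"
  shows "b (T (pr1 m) * T (pr2 m)) + xr m * b (T (pr2 m) * T (pr1 m)) = kr m * b (T m)"
  using fun_cong[OF T_relation[OF assms, of m], of 1]
  by (simp add: act_act_one scaleC_fun_apply scaleC_complex_def del: tangent.simps) (simp add: act_def)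

text \<open>Left translation sees the row index of \<open>U\<close> and the column index of
  \<open>V\<close>, which are not summed. Thus \<open>y_elt z k\<close> has left weight
  \<open>wt k\<close> besides its right weight zero.\<close>

lemma ltr_yz:
  assumes "m \<in> {1..3}" "n \<in> {1..3}"
  shows "ltr (K i) (yz z m n) = qpow q (colwt m i - colwt n i) *\<^sub>C yz z m n"
proof -
  have U: "ltr (K i) (U m j) = qpow q (colwt m i) *\<^sub>C U m j" for j
    using assms(1) unfolding in_123 by (cases i) (auto simp: ltr_U U_gn sum_123 colwt_def scaleC_one)
  have V: "ltr (K i) (V j n) = qpow q (- colwt n i) *\<^sub>C V j n" if "j \<in> {1..3}" for j
    using assms(2) that unfolding in_123 by (cases i) (auto simp: ltr_V V_gn sum_123 colwt_def scaleC_one)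
  have "ltr (K i) (yz z m n) = (\<Sum>j\<in>{1..3}. z j *\<^sub>C (ltr (K i) (U m j) \<star> ltr (K i) (V j n)))"
    unfolding yz_def by (simp only: clinear_sum[OF clinear_ltr_right] ltr_scale ltr_conv clinear_U clinear_V)
  also have "\<dots> = (\<Sum>j\<in>{1..3}. qpow q (colwt m i - colwt n i) *\<^sub>C z j *\<^sub>C (U m j \<star> V j n))"
    using qpow_add[of "colwt m i" "- colwt n i"]
    by (intro sum.cong refl) (simp add: U V conv_scale_left conv_scale_right scaleC_scaleC mult_ac)
  also have "\<dots> = qpow q (colwt m i - colwt n i) *\<^sub>C yz z m n"
    by (simp only: yz_def cvec.scale_sum_right)
  finally show ?thesis .
qed

text \<open>A \<open>K i\<close> put to the left of \<open>T k * T l\<close> is read off as the left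
  weight \<open>wt m\<close>. Moved through to the right, where it acts trivially, it yields
  \<open>wt k + wt l\<close>.\<close>

lemma y_elt_TT_eq_0:
  assumes "wt m \<noteq> wt k + wt l"
  shows "y_elt z m (T k * T l) = 0"
proof -
  let ?y = "y_elt z m"
  have y: "?y \<in> Aw 0" by (rule yz_Aw[OF ix_123])
  note Z = A_uq_dual[OF Aw_A[OF y]]
  obtain i where i: "wt m i \<noteq> wt k i + wt l i" using assms by (auto simp: fun_eq_iff)
  have "qpow q (wt m i) * ?y (T k * T l) = ltr (K i) ?y (T k * T l)"
    by (simp add: ltr_yz[OF ix_123] wt_def scaleC_fun_apply scaleC_complex_def)
  also have "\<dots> = (K i \<triangleright> T k \<triangleright> T l \<triangleright> ?y) 1"
    by (simp add: ltr_def act_def mult.assoc)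
  also have "K i \<triangleright> T k \<triangleright> T l \<triangleright> ?y = (qpow q (wt k i) * qpow q (wt l i)) *\<^sub>C (T k \<triangleright> T l \<triangleright> K i \<triangleright> ?y)"
    by (simp add: K_T Z uq_dual_act act_scale scaleC_scaleC del: tangent.simps)
  also have "K i \<triangleright> ?y = ?y" using y by (simp add: Aw_def scaleC_one)
  finally have "(qpow q (wt m i) - qpow q (wt k i + wt l i)) * ?y (T k * T l) = 0"
    by (simp add: act_act_one scaleC_fun_apply scaleC_complex_def qpow_add algebra_simps)
  then show ?thesis using i qpow_inj by auto
qed

lemma UV_TT:
  assumes "m \<in> {1..3}" "n \<in> {1..3}" "j \<in> {1..3}"
  shows "(U m j \<star> V j n) (T k * T l) =
    (\<Sum>m'\<in>{1..3}. \<Sum>n'\<in>{1..3}. (U m' j \<star> V j n') (T l) * (U m m' \<star> V n' n) (T k))"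
proof -
  have "(U m j \<star> V j n) (T k * T l) = (T l \<triangleright> (U m j \<star> V j n)) (T k)" by (simp add: act_def)
  then show ?thesis
    by (simp only: act_UV[OF assms] sum_fun_apply scaleC_fun_apply scaleC_complex_def)
qed

lemma UV_T':
  assumes "a \<in> {1..3}" "b \<in> {1..3}" "c \<in> {1..3}" "d \<in> {1..3}"
  shows "(U a b \<star> V c d) (T k) = (\<Sum>n\<in>UNIV. U a b (T n) * V c d (Tmat n k)) + U a b 1 * V c d (T k)"
  by (rule conv_T) (use assms U_uq_dual V_uq_dual in blast)+

text \<open>One order of the factors is enough, because \<open>T_relation_one\<close> and
  \<open>zr_T\<close> determine the value at the other.\<close>

lemma zr_TT: "y_elt (zr m) m (T (pr1 m) * T (pr2 m)) \<noteq> 0"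
proof -
  have "(\<Sum>i\<in>{1..3}. zr m i * (U (top_ix m) i \<star> V i (bot_ix m)) (T (pr1 m) * T (pr2 m))) \<noteq> 0"
    using Q_nonzero
    by (cases m rule: tix_cases)
     (simp_all add: zr_def UV_TT UV_T' sum_tix sum_123 U_T V_T U_one V_simps scaleC_complex_def
       del: tangent.simps)
  then show ?thesis
    by (simp only: yz_def sum_fun_apply scaleC_fun_apply scaleC_complex_def not_False_eq_True)
qed

subsection \<open>The right action on one-forms\<close>

lemma dual_rep: "dual_rep q k \<in> A" "dual_rep q k 1 = 0" "dual_rep q k (T j) = of_bool (j = k)"
proof -
  have "\<exists>y. y \<in> A \<and> y 1 = 0 \<and> (\<forall>j. y (T j) = of_bool (j = k))"
    using Aw_A[OF yz_Aw[OF ix_123]] y_elt_one zd_T by blast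
  then have "dual_rep q k \<in> A \<and> dual_rep q k 1 = 0 \<and> (\<forall>j. dual_rep q k (T j) = of_bool (j = k))"
    unfolding dual_rep_def by (rule someI_ex)
  then show "dual_rep q k \<in> A" "dual_rep q k 1 = 0" "dual_rep q k (T j) = of_bool (j = k)" by blast+
qed

text \<open>By \<open>conv_T\<close> a representative enters only through its values at 1 and on the
  tangent space, so the choice made in \<open>dual_rep\<close> has no influence.\<close>

lemma rmul_eq:
  assumes "c \<in> A"
  shows "rmul q \<omega> c j = (\<Sum>k\<in>UNIV. \<omega> k \<star> (Tmat k j \<triangleright> c))"
proof -
  have "(dual_rep q k \<star> (\<lambda>y. c (z * y))) (T j) = c (z * Tmat k j)" for k z
  proof -
    have "ltr z c \<in> uq_dual q" by (rule A_uq_dual[OF A_ltr[OF assms]])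
    from conv_T[OF A_uq_dual[OF dual_rep(1)] this, of k j]
    have "(dual_rep q k \<star> ltr z c) (T j) = (\<Sum>n\<in>UNIV. of_bool (n = k) * ltr z c (Tmat n j))"
      by (simp add: dual_rep del: tangent.simps)
    also have "\<dots> = ltr z c (Tmat k j)" by (cases k rule: tix_cases) (simp_all add: sum_tix)
    finally show ?thesis by (simp add: ltr_def)
  qed
  then show ?thesis by (simp add: rmul_def act_def)
qed

text \<open>Coassociativity for \<open>T l\<close> forces the coproduct of the matrix
  \<open>Tmat\<close> to be a matrix product; this makes the right action associative.\<close>

lemma act_Tmat_conv:
  assumes \<phi>: "\<phi> \<in> uq_dual q" and \<psi>: "\<psi> \<in> uq_dual q"
  shows "Tmat k l \<triangleright> (\<phi> \<star> \<psi>) = (\<Sum>j\<in>UNIV. (Tmat k j \<triangleright> \<phi>) \<star> (Tmat j l \<triangleright> \<psi>))"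
proof -
  note lin = uq_dualD[OF \<phi>] uq_dualD[OF \<psi>] clinear_conv
  show ?thesis
    unfolding sum_tix
    by (cases k rule: tix_cases; cases l rule: tix_cases;
        simp add: lin zero_act scale_act act_mult act_conv clinear_act act_add conv_scale_left conv_scale_right
          scaleC_add_right K_Kinv uq_dual_act \<phi> \<psi> K_K[of _ N2 N1])
qed

lemma rmul_assoc:
  assumes "\<And>k. \<omega> k \<in> A" "a \<in> A" "c \<in> A"
  shows "rmul q (rmul q \<omega> a) c = rmul q \<omega> (a \<star> c)"
proof
  fix l
  have "rmul q (rmul q \<omega> a) c l = (\<Sum>j\<in>UNIV. \<Sum>k\<in>UNIV. \<omega> k \<star> ((Tmat k j \<triangleright> a) \<star> (Tmat j l \<triangleright> c)))"
    using assms by (simp add: rmul_eq conv_sum_left A_conv_assoc A_act)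
  also have "\<dots> = (\<Sum>k\<in>UNIV. \<Sum>j\<in>UNIV. \<omega> k \<star> ((Tmat k j \<triangleright> a) \<star> (Tmat j l \<triangleright> c)))"
    by (rule sum.swap)
  also have "\<dots> = rmul q \<omega> (a \<star> c) l"
    using assms by (simp add: rmul_eq A_conv conv_sum_right act_Tmat_conv A_uq_dual)
  finally show "rmul q (rmul q \<omega> a) c l = rmul q \<omega> (a \<star> c) l" .
qed

lemma counit_Tmat: "counit (Tmat k j) = of_bool (k = j)"
  by (cases k rule: tix_cases; cases j rule: tix_cases)
    (simp_all add: counit_mult counit_gn clinear_zero[OF clinear_counit] clinear_scale[OF clinear_counit] scaleC_complex_def)

lemma rmul_counit:
  assumes "\<And>k. \<omega> k \<in> A"
  shows "rmul q \<omega> counit = \<omega>"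
proof
  fix j
  have "rmul q \<omega> counit j = (\<Sum>k\<in>UNIV. of_bool (k = j) *\<^sub>C \<omega> k)"
    using assms by (simp add: rmul_eq A_counit act_counit counit_Tmat conv_scale_right conv_counit A_clinear)
  also have "\<dots> = \<omega> j" by (cases j rule: tix_cases) (simp_all add: sum_tix scaleC_one)
  finally show "rmul q \<omega> counit j = \<omega> j" .
qed

lemma rmul_add_left: "rmul q (\<omega> + \<eta>) c = rmul q \<omega> c + rmul q \<eta> c"
  and rmul_scale_left: "rmul q (s *\<^sub>C \<omega>) c = s *\<^sub>C rmul q \<omega> c"
  by (simp_all add: rmul_def fun_eq_iff conv_add_left conv_scale_left sum.distrib scaleC_fun_apply
      sum_fun_apply cvec.scale_sum_right)

lemma rmul_add_right: "a \<in> A \<Longrightarrow> c \<in> A \<Longrightarrow> rmul q \<omega> (a + c) = rmul q \<omega> a + rmul q \<omega> c"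
  by (rule ext) (simp add: rmul_eq A_add act_add conv_add_right sum.distrib)

lemma rmul_scale_right: "a \<in> A \<Longrightarrow> rmul q \<omega> (s *\<^sub>C a) = s *\<^sub>C rmul q \<omega> a"
  by (rule ext) (simp add: rmul_eq A_scale act_scale conv_scale_right scaleC_fun_apply cvec.scale_sum_right)

lemma lmul_add_right: "lmul a (\<omega> + \<eta>) = lmul a \<omega> + lmul a \<eta>"
  and lmul_scale_right: "lmul a (s *\<^sub>C \<omega>) = s *\<^sub>C lmul a \<omega>"
  by (simp_all add: lmul_def fun_eq_iff conv_add_left conv_add_right conv_scale_left conv_scale_right scaleC_fun_apply)

lemma lmul_rmul:
  assumes "\<And>k. \<omega> k \<in> A" "a \<in> A" "c \<in> A"
  shows "lmul a (rmul q \<omega> c) = rmul q (lmul a \<omega>) c"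
  using assms by (auto simp: fun_eq_iff lmul_def rmul_eq conv_sum_right A_conv_assoc A_act)

lemma lmul_lmul:
  assumes "\<And>k. \<omega> k \<in> A" "a \<in> A" "c \<in> A"
  shows "lmul a (lmul c \<omega>) = lmul (a \<star> c) \<omega>"
  using assms by (auto simp: fun_eq_iff lmul_def A_conv_assoc)

lemma lmul_counit: "(\<And>k. \<omega> k \<in> A) \<Longrightarrow> lmul counit \<omega> = \<omega>"
  by (auto simp: fun_eq_iff lmul_def conv_counit A_clinear)

lemma dd_A: "a \<in> A \<Longrightarrow> dd q a k \<in> A"
  by (simp add: dd_def A_act)

text \<open>Componentwise this is the coproduct formula \<open>act_T_conv\<close> for the tangent
  vectors.\<close>

lemma dd_conv:
  assumes "a \<in> A" "b \<in> A"
  shows "dd q (a \<star> b) = rmul q (dd q a) b + lmul a (dd q b)"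
  using assms by (auto simp: fun_eq_iff dd_def rmul_eq lmul_def act_T_conv A_uq_dual simp del: tangent.simps)

end

section \<open>Tensor products as quotients\<close>

text \<open>The free vector space on \<open>M \<times> N\<close>, seen inside the one on all pairs
  of the type. The relations and the chosen representatives of the quotient stay in it.\<close>

definition singles :: "'m set \<Rightarrow> 'n set \<Rightarrow> ('m \<times> 'n \<Rightarrow>\<^sub>0 complex) set"
  where "singles M N = cvec.span {Poly_Mapping.single (x, y) 1 | x y. x \<in> M \<and> y \<in> N}"

definition bilin_on :: "'m::complex_vector set \<Rightarrow> 'n::complex_vector set \<Rightarrow> ('m \<Rightarrow> 'n \<Rightarrow> 'c::complex_vector) \<Rightarrow> bool"
  where "bilin_on M N G \<longleftrightarrow>
    (\<forall>x\<in>M. \<forall>x'\<in>M. \<forall>y\<in>N. G (x + x') y = G x y + G x' y) \<and>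
    (\<forall>x\<in>M. \<forall>y\<in>N. \<forall>y'\<in>N. G x (y + y') = G x y + G x y') \<and>
    (\<forall>c. \<forall>x\<in>M. \<forall>y\<in>N. G (c *\<^sub>C x) y = c *\<^sub>C G x y) \<and>
    (\<forall>c. \<forall>x\<in>M. \<forall>y\<in>N. G x (c *\<^sub>C y) = c *\<^sub>C G x y)"

lemma subspace_singles: "cvec.subspace (singles M N)"
  by (simp add: singles_def cvec.subspace_span)

lemma single_singles: "x \<in> M \<Longrightarrow> y \<in> N \<Longrightarrow> Poly_Mapping.single (x, y) c \<in> singles M N"
proof -
  assume "x \<in> M" "y \<in> N"
  then have "Poly_Mapping.single (x, y) 1 \<in> singles M N"
    unfolding singles_def by (intro cvec.span_base) blast
  from cvec.subspace_scale[OF subspace_singles this, of c] show ?thesis by (simp add: scaleC_single)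
qed

lemma keys_singles:
  assumes "t \<in> singles M N"
  shows "Poly_Mapping.keys t \<subseteq> M \<times> N"
  using assms unfolding singles_def
proof (induction rule: cvec.span_induct_alt)
  case (step c x t)
  then have "Poly_Mapping.keys (c *\<^sub>C x) \<subseteq> M \<times> N" by (auto simp: scaleC_single split: if_splits)
  then show ?case using step(2) Poly_Mapping.keys_add[of "c *\<^sub>C x" t] by blast
qed simp

lemma singles_induct [consumes 1, case_names zero step]:
  assumes "t \<in> singles M N" "P 0"
    "\<And>c x y t. x \<in> M \<Longrightarrow> y \<in> N \<Longrightarrow> t \<in> singles M N \<Longrightarrow> P t \<Longrightarrow> P (c *\<^sub>C Poly_Mapping.single (x, y) 1 + t)"
  shows "P t"
proof -
  have "t \<in> singles M N \<and> P t"
    using assms(1) unfolding singles_def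
  proof (induction rule: cvec.span_induct_alt)
    case base
    then show ?case using assms(2) by (simp add: cvec.span_zero)
  next
    case (step c x t)
    then obtain a b where ab: "x = Poly_Mapping.single (a, b) 1" "a \<in> M" "b \<in> N" by blast
    have "c *\<^sub>C x + t \<in> singles M N"
      unfolding singles_def by (rule cvec.span_add[OF cvec.span_scale[OF cvec.span_base[OF step(1)]]]) (use step in blast)
    then show ?case using assms(3)[OF ab(2,3), of t c] step ab by (simp add: singles_def)
  qed
  then show ?thesis by blast
qed

lemma bilinear_rels_singles:
  assumes M: "cvec.subspace M" and N: "cvec.subspace N"
  shows "bilinear_rels M N \<subseteq> singles M N"
  unfolding bilinear_rels_def
  by (auto intro!: cvec.subspace_diff[OF subspace_singles] single_singles
      cvec.subspace_add[OF M] cvec.subspace_add[OF N] cvec.subspace_scale[OF M] cvec.subspace_scale[OF N])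

lemma lext_bilinear_rels:
  assumes "bilin_on M N G" "r \<in> bilinear_rels M N"
  shows "lext (\<lambda>(x, y). G x y) r = 0"
proof -
  have add: "\<And>x x' y. x \<in> M \<Longrightarrow> x' \<in> M \<Longrightarrow> y \<in> N \<Longrightarrow> G (x + x') y = G x y + G x' y"
    "\<And>x y y'. x \<in> M \<Longrightarrow> y \<in> N \<Longrightarrow> y' \<in> N \<Longrightarrow> G x (y + y') = G x y + G x y'"
    "\<And>c x y. x \<in> M \<Longrightarrow> y \<in> N \<Longrightarrow> G (c *\<^sub>C x) y = c *\<^sub>C G x y"
    "\<And>c x y. x \<in> M \<Longrightarrow> y \<in> N \<Longrightarrow> G x (c *\<^sub>C y) = c *\<^sub>C G x y"
    using assms(1) by (auto simp: bilin_on_def)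
  from assms(2) show ?thesis
    unfolding bilinear_rels_def by (auto simp: lext_diff scaleC_one add)
qed

lemma qmap_diff: "cvec.subspace W \<Longrightarrow> qmap W x - x \<in> W"
  using qmap[of W] by (metis clinear_diff right_minus_eq)

text \<open>A class differs from a representative by an element of the span of the relations, so
  maps killing the relations may be evaluated on either.\<close>

lemma lext_qmap:
  assumes "\<And>r. r \<in> R \<Longrightarrow> lext g r = 0"
  shows "lext g (qmap (cvec.span R) t) = lext g t"
proof -
  have "lext g (qmap (cvec.span R) t - t) = 0 (qmap (cvec.span R) t - t)"
    by (rule clinear_eq_on_span[OF lext_linear clinear_0 _ qmap_diff[OF cvec.subspace_span]]) (simp add: assms)
  then show ?thesis by (simp add: lext_diff)
qed

lemma lext_tens:
  assumes "\<And>r. r \<in> R \<Longrightarrow> lext g r = 0"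
  shows "lext g (tens R x y) = g (x, y)"
  by (simp add: tens_def lext_qmap[OF assms] scaleC_one)

lemma tens_bilin:
  assumes "bilinear_rels M N \<subseteq> R"
  shows "bilin_on M N (tens R)"
proof -
  let ?q = "qmap (cvec.span R)"
  note lin = qmap(1)[OF cvec.subspace_span, of R]
  have kill: "?q r = 0" if "r \<in> bilinear_rels M N" for r
    using that assms qmap(3)[OF cvec.subspace_span, of R r] by (blast intro: cvec.span_base)
  have sc: "?q (Poly_Mapping.single k c) = c *\<^sub>C ?q (Poly_Mapping.single k 1)" for k c
    by (simp add: clinear_scale[OF lin, symmetric] scaleC_single)
  show ?thesis
    unfolding bilin_on_def tens_def
  proof (intro conjI ballI allI)
    fix x x' y assume "x \<in> M" "x' \<in> M" "y \<in> N"
    then have "Poly_Mapping.single (x + x', y) 1 - Poly_Mapping.single (x, y) 1 - Poly_Mapping.single (x', y) 1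
      \<in> bilinear_rels M N" unfolding bilinear_rels_def by blast
    from kill[OF this, unfolded clinear_diff[OF lin]] show "?q (Poly_Mapping.single (x + x', y) 1) =
      ?q (Poly_Mapping.single (x, y) 1) + ?q (Poly_Mapping.single (x', y) 1)"
      by (simp add: algebra_simps)
  next
    fix x y y' assume "x \<in> M" "y \<in> N" "y' \<in> N"
    then have "Poly_Mapping.single (x, y + y') 1 - Poly_Mapping.single (x, y) 1 - Poly_Mapping.single (x, y') 1
      \<in> bilinear_rels M N" unfolding bilinear_rels_def by blast
    from kill[OF this, unfolded clinear_diff[OF lin]] show "?q (Poly_Mapping.single (x, y + y') 1) =
      ?q (Poly_Mapping.single (x, y) 1) + ?q (Poly_Mapping.single (x, y') 1)"
      by (simp add: algebra_simps)
  next
    fix c x y assume "x \<in> M" "y \<in> N"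
    then have "Poly_Mapping.single (c *\<^sub>C x, y) 1 - Poly_Mapping.single (x, y) c \<in> bilinear_rels M N"
      unfolding bilinear_rels_def by blast
    from kill[OF this, unfolded clinear_diff[OF lin]] show "?q (Poly_Mapping.single (c *\<^sub>C x, y) 1) = c *\<^sub>C ?q (Poly_Mapping.single (x, y) 1)"
      by (simp add: sc[of _ c])
  next
    fix c x y assume "x \<in> M" "y \<in> N"
    then have "Poly_Mapping.single (x, c *\<^sub>C y) 1 - Poly_Mapping.single (x, y) c \<in> bilinear_rels M N"
      unfolding bilinear_rels_def by blast
    from kill[OF this, unfolded clinear_diff[OF lin]] show "?q (Poly_Mapping.single (x, c *\<^sub>C y) 1) = c *\<^sub>C ?q (Poly_Mapping.single (x, y) 1)"
      by (simp add: sc[of _ c])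
  qed
qed

lemma tens_space_singles:
  assumes "R \<subseteq> singles M N" "t \<in> tens_space R M N"
  shows "t \<in> singles M N" "qmap (cvec.span R) t = t"
proof -
  note lin = qmap(1)[OF cvec.subspace_span, of R]
  have R: "cvec.span R \<subseteq> singles M N"
    using assms(1) by (rule cvec.span_minimal[OF _ subspace_singles])
  have "tens R x y \<in> singles M N" if "x \<in> M" "y \<in> N" for x y
    using cvec.subspace_add[OF subspace_singles subsetD[OF R qmap_diff[OF cvec.subspace_span]]
        single_singles[OF that, of 1], of "Poly_Mapping.single (x, y) 1"]
    by (simp add: tens_def)
  then have "{tens R x y | x y. x \<in> M \<and> y \<in> N} \<subseteq> singles M N" by blast
  then show "t \<in> singles M N"
    using assms(2) cvec.span_minimal[OF _ subspace_singles] unfolding tens_space_def by blast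
  have id: "clinear (\<lambda>x :: ('a \<times> 'b) \<Rightarrow>\<^sub>0 complex. x)" by (rule clinearI) simp_all
  show "qmap (cvec.span R) t = t"
    by (rule clinear_eq_on_span[OF lin id _ assms(2)[unfolded tens_space_def]])
      (auto simp: tens_def qmap(2)[OF cvec.subspace_span])
qed

lemma tens_space_inj:
  assumes "R \<subseteq> singles M N" "t \<in> tens_space R M N" "t \<in> cvec.span R"
  shows "t = 0"
  using tens_space_singles(2)[OF assms(1,2)] qmap(3)[OF cvec.subspace_span, of R t] assms(3) by simp

lemma tens_in_tens_space: "x \<in> M \<Longrightarrow> y \<in> N \<Longrightarrow> tens R x y \<in> tens_space R M N"
  unfolding tens_space_def by (rule cvec.span_base) blast

lemma subspace_tens_space: "cvec.subspace (tens_space R M N)"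
  by (simp add: tens_space_def cvec.subspace_span)

lemma qmap_lext_tens: "qmap (cvec.span R) t = lext (\<lambda>(x, y). tens R x y) t"
  using lext_eta[OF qmap(1)[OF cvec.subspace_span, of R], of t] by (simp add: tens_def split_def)

context quantum_flag
begin

section \<open>One-forms and their tensor square\<close>

text \<open>Shifted weights are needed for the tensor square: for one-forms \<omega> and \<eta> the
  product \<open>rmul q \<omega> (\<eta> l)\<close> has shift \<open>wt l\<close>.\<close>

definition Omw :: "(node \<Rightarrow> int) \<Rightarrow> form set"
  where "Omw \<mu> = {\<omega>. \<forall>k. \<omega> k \<in> Aw (\<mu> + wt k)}"

abbreviation Om :: "form set" where "Om \<equiv> Omw 0"

definition bas :: "func \<Rightarrow> tix \<Rightarrow> form"
  where "bas a k = (\<lambda>j. if j = k then a else 0)"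

lemma OmwD: "\<omega> \<in> Omw \<mu> \<Longrightarrow> \<omega> k \<in> Aw (\<mu> + wt k)"
  by (simp add: Omw_def)

lemma OmD: "\<omega> \<in> Om \<Longrightarrow> \<omega> k \<in> Aw (wt k)"
  by (simp add: Omw_def)

lemma Omw_A: "\<omega> \<in> Omw \<mu> \<Longrightarrow> \<omega> k \<in> A"
  by (rule Aw_A[OF OmwD])

lemma Omw_subspace: "cvec.subspace (Omw \<mu>)"
  unfolding Omw_def cvec.subspace_def by (auto simp: Aw_zero Aw_add Aw_scale scaleC_fun_apply)

lemma bas_Om: "a \<in> Aw (wt k) \<Longrightarrow> bas a k \<in> Om"
  by (simp add: bas_def Omw_def Aw_zero)

lemma lmul_Omw: "a \<in> Aw \<alpha> \<Longrightarrow> \<omega> \<in> Omw \<mu> \<Longrightarrow> lmul a \<omega> \<in> Omw (\<alpha> + \<mu>)"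
  unfolding Omw_def lmul_def by (auto intro!: Aw_conv' simp: add.assoc)

lemma rmul_Omw: "\<omega> \<in> Omw \<mu> \<Longrightarrow> a \<in> Aw \<alpha> \<Longrightarrow> rmul q \<omega> a \<in> Omw (\<mu> + \<alpha>)"
  unfolding Omw_def
  by (auto simp: rmul_eq Aw_A intro!: Aw_sum Aw_conv' Aw_act_Tmat)

lemma rmul_Omw': "\<omega> \<in> Omw \<mu> \<Longrightarrow> a \<in> Aw \<alpha> \<Longrightarrow> \<nu> = \<mu> + \<alpha> \<Longrightarrow> rmul q \<omega> a \<in> Omw \<nu>"
  using rmul_Omw by blast

lemma dd_Omw: "a \<in> Aw \<alpha> \<Longrightarrow> dd q a \<in> Omw \<alpha>"
  unfolding Omw_def dd_def using Aw_act_T by blast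

lemma lmul_Om: "a \<in> Aw 0 \<Longrightarrow> \<omega> \<in> Om \<Longrightarrow> lmul a \<omega> \<in> Om"
  using lmul_Omw[of a 0 \<omega> 0] by simp

lemma rmul_Om: "a \<in> Aw 0 \<Longrightarrow> \<omega> \<in> Om \<Longrightarrow> rmul q \<omega> a \<in> Om"
  using rmul_Omw[of \<omega> 0 a 0] by simp

lemma form_sum_bas: "\<omega> = (\<Sum>k\<in>UNIV. bas (\<omega> k) k)"
  by (rule ext) (simp add: sum_fun_apply bas_def)

text \<open>This is \<open>tz_yz\<close> at \<open>X = T j\<close> for the function dual to
  \<open>T k\<close>: the form with single component \<open>a\<close> equals
  \<open>a S(y(1)) dy(2)\<close>.\<close>

lemma bas_expand:
  assumes a: "a \<in> Aw (wt k)"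
  shows "bas a k = (\<Sum>m\<in>{1..3}. \<Sum>n\<in>{1..3}. lmul (a \<star> tz k m n) (dd q (yz (zd k) m n)))"
proof
  fix j
  have "(\<Sum>m\<in>{1..3}. \<Sum>n\<in>{1..3}. lmul (a \<star> tz k m n) (dd q (yz (zd k) m n))) j = y_elt (zd k) k (T j) *\<^sub>C a"
    unfolding tz_yz[OF Aw_A[OF a], symmetric] by (simp only: sum_fun_apply lmul_def dd_def)
  then show "bas a k j = (\<Sum>m\<in>{1..3}. \<Sum>n\<in>{1..3}. lmul (a \<star> tz k m n) (dd q (yz (zd k) m n))) j"
    by (simp only: zd_T) (simp add: bas_def scaleC_one)
qed

lemma tz_coeff_Aw: "a \<in> Aw (wt k) \<Longrightarrow> m \<in> {1..3} \<Longrightarrow> n \<in> {1..3} \<Longrightarrow> a \<star> tz k m n \<in> Aw 0"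
  by (rule Aw_conv'[OF _ tz_Aw]) auto

theorem Om1_eq: "Om1 q = Om"
proof
  show "Om1 q \<subseteq> Om"
    unfolding Om1_def OF3_eq
    by (rule cvec.span_minimal[OF _ Omw_subspace]) (auto intro!: lmul_Om rmul_Om dd_Omw)
  show "Om \<subseteq> Om1 q"
  proof
    fix \<omega> assume \<omega>: "\<omega> \<in> Om"
    \<comment> \<open>The right coefficient allowed in the definition of \<open>Om1\<close> is taken
      to be the unit.\<close>
    have base: "lmul b (dd q c) \<in> Om1 q" if "b \<in> Aw 0" "c \<in> Aw 0" for b c
    proof -
      have "lmul b (rmul q (dd q c) counit) \<in> Om1 q"
        unfolding Om1_def OF3_eq by (rule cvec.span_base) (use that Aw_counit in blast)
      then show ?thesis using that by (simp add: rmul_counit dd_A Aw_A)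
    qed
    have "bas (\<omega> k) k \<in> Om1 q" for k
      unfolding bas_expand[OF OmD[OF \<omega>]] Om1_def
      by (intro cvec.span_sum base[unfolded Om1_def] tz_coeff_Aw OmD[OF \<omega>] yz_Aw)
    then show "\<omega> \<in> Om1 q"
      by (subst form_sum_bas) (simp add: Om1_def cvec.span_sum)
  qed
qed

text \<open>Partner of \<open>tz k m n\<close> in a partition of unity, with the opposite weight
  \<open>wt k\<close>.\<close>

definition cz :: "tix \<Rightarrow> nat \<Rightarrow> nat \<Rightarrow> func"
  where "cz k m n = U m (top_ix k) \<star> V (bot_ix k) n"

lemma cz_Aw: "m \<in> {1..3} \<Longrightarrow> n \<in> {1..3} \<Longrightarrow> cz k m n \<in> Aw (wt k)"
  unfolding cz_def by (rule Aw_conv'[OF Aw_U Aw_V]) (use ix_123[of k] in \<open>auto simp: wt_def\<close>)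

lemma tz_cz: "(\<Sum>m\<in>{1..3}. \<Sum>n\<in>{1..3}. tz k m n \<star> cz k m n) = counit"
  unfolding cz_def tz_UV[OF ix_123] by (simp add: scaleC_one)

lemma relsB_singles: "relsB q \<subseteq> singles Om Om"
proof -
  have "balanced_rels (Aw 0) (rmul q) lmul Om Om \<subseteq> singles Om Om"
    unfolding balanced_rels_def
    by (auto intro!: cvec.subspace_diff[OF subspace_singles] single_singles lmul_Om rmul_Om)
  then show ?thesis
    using bilinear_rels_singles[OF Omw_subspace Omw_subspace] unfolding relsB_def Om1_eq OF3_eq by blast
qed

text \<open>Tensors over \<open>B\<close> are multiplied out in the forms over the quantum group. In
  \<open>mu t l k\<close> the index \<open>l\<close> belongs to the second tensor factor and
  \<open>k\<close> to the first.\<close>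

definition mu :: "form2 \<Rightarrow> tix \<Rightarrow> form"
  where "mu = lext (\<lambda>(\<omega>, \<eta>). \<lambda>l. rmul q \<omega> (\<eta> l))"

lemma clinear_mu: "clinear mu"
  by (simp add: mu_def lext_linear)

lemma mu_bilin: "bilin_on Om Om (\<lambda>\<omega> \<eta> l. rmul q \<omega> (\<eta> l))"
  by (auto simp: bilin_on_def fun_eq_iff rmul_add_left rmul_add_right rmul_scale_left rmul_scale_right
      scaleC_fun_apply Omw_A)

lemma mu_relsB:
  assumes "r \<in> relsB q"
  shows "lext (\<lambda>(\<omega>, \<eta>). \<lambda>l. rmul q \<omega> (\<eta> l)) r = 0"
  using assms unfolding relsB_def Om1_eq OF3_eq
proof
  assume "r \<in> balanced_rels (Aw 0) (rmul q) lmul Om Om"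
  then obtain \<omega> b \<eta> where "\<omega> \<in> Om" "b \<in> Aw 0" "\<eta> \<in> Om"
    "r = Poly_Mapping.single (rmul q \<omega> b, \<eta>) 1 - Poly_Mapping.single (\<omega>, lmul b \<eta>) 1"
    unfolding balanced_rels_def by blast
  then show ?thesis
    by (simp add: lext_diff scaleC_one lmul_def rmul_assoc Omw_A Aw_A)
qed (rule lext_bilinear_rels[OF mu_bilin])

abbreviation TT :: "form2 set" where "TT \<equiv> Om1_Om1 q"

lemma TT_def: "TT = tens_space (relsB q) Om Om"
  by (simp add: Om1_Om1_def Om1_eq)

lemma TT_subspace: "cvec.subspace TT"
  by (simp add: TT_def subspace_tens_space)

lemma tensB_TT: "\<omega> \<in> Om \<Longrightarrow> \<eta> \<in> Om \<Longrightarrow> tensB q \<omega> \<eta> \<in> TT"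
  by (simp add: TT_def tensB_def tens_in_tens_space)

lemma TT_singles: "t \<in> TT \<Longrightarrow> t \<in> singles Om Om"
  unfolding TT_def by (rule tens_space_singles[OF relsB_singles])

lemma mu_tensB: "mu (tensB q \<omega> \<eta>) = (\<lambda>l. rmul q \<omega> (\<eta> l))"
  unfolding mu_def tensB_def by (subst lext_tens[OF mu_relsB]) auto

lemma tensB_bilin: "bilin_on Om Om (tensB q)"
  unfolding tensB_def by (rule tens_bilin) (simp add: relsB_def Om1_eq)

lemma tensB_add_left: "\<omega> \<in> Om \<Longrightarrow> \<omega>' \<in> Om \<Longrightarrow> \<eta> \<in> Om \<Longrightarrow> tensB q (\<omega> + \<omega>') \<eta> = tensB q \<omega> \<eta> + tensB q \<omega>' \<eta>"
  and tensB_add_right: "\<omega> \<in> Om \<Longrightarrow> \<eta> \<in> Om \<Longrightarrow> \<eta>' \<in> Om \<Longrightarrow> tensB q \<omega> (\<eta> + \<eta>') = tensB q \<omega> \<eta> + tensB q \<omega> \<eta>'"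
  and tensB_scale_left: "\<omega> \<in> Om \<Longrightarrow> \<eta> \<in> Om \<Longrightarrow> tensB q (c *\<^sub>C \<omega>) \<eta> = c *\<^sub>C tensB q \<omega> \<eta>"
  and tensB_scale_right: "\<omega> \<in> Om \<Longrightarrow> \<eta> \<in> Om \<Longrightarrow> tensB q \<omega> (c *\<^sub>C \<eta>) = c *\<^sub>C tensB q \<omega> \<eta>"
  using tensB_bilin by (auto simp: bilin_on_def)

lemma tensB_balanced:
  assumes "\<omega> \<in> Om" "b \<in> Aw 0" "\<eta> \<in> Om"
  shows "tensB q (rmul q \<omega> b) \<eta> = tensB q \<omega> (lmul b \<eta>)"
proof -
  let ?r = "Poly_Mapping.single (rmul q \<omega> b, \<eta>) 1 - Poly_Mapping.single (\<omega>, lmul b \<eta>) 1 :: form2"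
  have "?r \<in> relsB q"
    using assms unfolding relsB_def balanced_rels_def Om1_eq OF3_eq by blast
  then have "qmap (cvec.span (relsB q)) ?r = 0"
    using qmap(3)[OF cvec.subspace_span] cvec.span_base by blast
  then show ?thesis
    by (simp add: tensB_def tens_def clinear_diff[OF qmap(1)[OF cvec.subspace_span]])
qed

definition WW :: "(tix \<Rightarrow> form) set"
  where "WW = {\<Theta>. \<forall>l. \<Theta> l \<in> Omw (wt l)}"

lemma WW_subspace: "cvec.subspace WW"
  unfolding WW_def cvec.subspace_def
  by (auto simp: scaleC_fun_apply cvec.subspace_0[OF Omw_subspace] cvec.subspace_add[OF Omw_subspace]
      cvec.subspace_scale[OF Omw_subspace])

lemma mu_single: "mu (Poly_Mapping.single (\<omega>, \<eta>) 1) = (\<lambda>l. rmul q \<omega> (\<eta> l))"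
  by (simp add: mu_def scaleC_one)

lemma rmul_WW: "\<omega> \<in> Om \<Longrightarrow> \<eta> \<in> Om \<Longrightarrow> (\<lambda>l. rmul q \<omega> (\<eta> l)) \<in> WW"
  unfolding WW_def using rmul_Omw[of \<omega> 0] OmD by auto

lemma mu_WW:
  assumes "t \<in> singles Om Om"
  shows "mu t \<in> WW"
  using assms
proof (induction rule: singles_induct)
  case zero
  show ?case unfolding clinear_zero[OF clinear_mu] by (rule cvec.subspace_0[OF WW_subspace])
next
  case (step c x y t)
  then show ?case
    by (simp only: clinear_add[OF clinear_mu] clinear_scale[OF clinear_mu] mu_single)
      (intro cvec.subspace_add[OF WW_subspace] cvec.subspace_scale[OF WW_subspace] rmul_WW)
qed

text \<open>The decomposition \<open>tz_cz\<close> of the unit yields the inverse of \<open>mu\<close>.\<close>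

definition nu :: "(tix \<Rightarrow> form) \<Rightarrow> form2"
  where "nu \<Theta> = (\<Sum>l\<in>UNIV. \<Sum>m\<in>{1..3}. \<Sum>n\<in>{1..3}. tensB q (rmul q (\<Theta> l) (tz l m n)) (bas (cz l m n) l))"

lemma rmul_tz_Om: "\<Theta> \<in> WW \<Longrightarrow> m \<in> {1..3} \<Longrightarrow> n \<in> {1..3} \<Longrightarrow> rmul q (\<Theta> l) (tz l m n) \<in> Om"
  by (rule rmul_Omw'[OF _ tz_Aw]) (auto simp: WW_def)

lemma bas_cz_Om: "m \<in> {1..3} \<Longrightarrow> n \<in> {1..3} \<Longrightarrow> bas (cz l m n) l \<in> Om"
  by (intro bas_Om cz_Aw)

lemmas nu_summand = rmul_tz_Om bas_cz_Om

lemma nu_TT: "\<Theta> \<in> WW \<Longrightarrow> nu \<Theta> \<in> TT"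
  unfolding nu_def by (intro cvec.subspace_sum[OF TT_subspace] tensB_TT nu_summand)

lemma nu_add:
  assumes "\<Theta> \<in> WW" "\<Theta>' \<in> WW"
  shows "nu (\<Theta> + \<Theta>') = nu \<Theta> + nu \<Theta>'"
proof -
  have eq: "(\<Theta> + \<Theta>') l = \<Theta> l + \<Theta>' l" for l by simp
  show ?thesis
    unfolding nu_def sum.distrib[symmetric] eq rmul_add_left
    by (intro sum.cong refl tensB_add_left nu_summand assms)
qed

lemma nu_scale:
  assumes "\<Theta> \<in> WW"
  shows "nu (c *\<^sub>C \<Theta>) = c *\<^sub>C nu \<Theta>"
proof -
  have eq: "(c *\<^sub>C \<Theta>) l = c *\<^sub>C \<Theta> l" for l by (rule scaleC_fun_apply)
  show ?thesis
    unfolding nu_def cvec.scale_sum_right eq rmul_scale_left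
    by (intro sum.cong refl tensB_scale_left nu_summand assms)
qed

lemma bas_sum: "bas (\<Sum>i\<in>I. f i) k = (\<Sum>i\<in>I. bas (f i) k)"
  by (rule ext) (simp add: sum_fun_apply bas_def)

lemma tensB_sum_right:
  assumes "\<omega> \<in> Om" "\<And>i. i \<in> I \<Longrightarrow> f i \<in> Om"
  shows "tensB q \<omega> (\<Sum>i\<in>I. f i) = (\<Sum>i\<in>I. tensB q \<omega> (f i))"
  using assms(2)
proof (induction I rule: infinite_finite_induct)
  case (insert i I)
  then show ?case using assms(1)
    by (simp add: tensB_add_right cvec.subspace_sum[OF Omw_subspace] del: plus_fun_apply zero_fun_apply)
qed (use tensB_scale_right[OF assms(1) cvec.subspace_0[OF Omw_subspace], of 0] in \<open>simp_all del: zero_fun_apply\<close>)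

lemma bas_cz_expand:
  assumes a: "a \<in> Aw (wt l)"
  shows "bas a l = (\<Sum>m\<in>{1..3}. \<Sum>n\<in>{1..3}. lmul (a \<star> tz l m n) (bas (cz l m n) l))"
proof -
  have "a = a \<star> (\<Sum>m\<in>{1..3}. \<Sum>n\<in>{1..3}. tz l m n \<star> cz l m n)"
    by (simp only: tz_cz conv_counit A_clinear[OF Aw_A[OF a]])
  also have "\<dots> = (\<Sum>m\<in>{1..3}. \<Sum>n\<in>{1..3}. a \<star> tz l m n \<star> cz l m n)"
    unfolding conv_sum_right
    by (intro sum.cong refl A_conv_assoc[symmetric] Aw_A[OF a] Aw_A[OF tz_Aw] Aw_A[OF cz_Aw])
  finally have "bas a l = bas (\<Sum>m\<in>{1..3}. \<Sum>n\<in>{1..3}. a \<star> tz l m n \<star> cz l m n) l" by (rule arg_cong)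
  then show ?thesis
    unfolding bas_sum by (simp add: lmul_def bas_def if_distrib cong: if_cong)
qed

text \<open>The coefficients \<open>\<eta> l \<star> tz l m n\<close> have weight zero, so they pass
  through the tensor product over \<open>B\<close> and reassemble \<eta> by
  \<open>bas_cz_expand\<close>.\<close>

lemma nu_mu_tensB:
  assumes \<omega>: "\<omega> \<in> Om" and \<eta>: "\<eta> \<in> Om"
  shows "nu (\<lambda>l. rmul q \<omega> (\<eta> l)) = tensB q \<omega> \<eta>"
proof -
  have cz: "bas (cz l m n) l \<in> Om" if "m \<in> {1..3}" "n \<in> {1..3}" for l m n
    using that by (intro bas_Om cz_Aw)
  have B: "\<eta> l \<star> tz l m n \<in> Aw 0" if "m \<in> {1..3}" "n \<in> {1..3}" for l m n
    using that by (intro tz_coeff_Aw OmD \<eta>)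
  note eta = bas_cz_expand[OF OmD[OF \<eta>]]
  have "nu (\<lambda>l. rmul q \<omega> (\<eta> l)) =
      (\<Sum>l\<in>UNIV. \<Sum>m\<in>{1..3}. \<Sum>n\<in>{1..3}. tensB q \<omega> (lmul (\<eta> l \<star> tz l m n) (bas (cz l m n) l)))"
    unfolding nu_def
  proof (intro sum.cong refl)
    fix l m n assume mn: "m \<in> {1..3::nat}" "n \<in> {1..3::nat}"
    have "rmul q (rmul q \<omega> (\<eta> l)) (tz l m n) = rmul q \<omega> (\<eta> l \<star> tz l m n)"
      by (rule rmul_assoc) (use \<omega> \<eta> mn in \<open>auto intro: Omw_A Aw_A[OF tz_Aw]\<close>)
    then show "tensB q (rmul q (rmul q \<omega> (\<eta> l)) (tz l m n)) (bas (cz l m n) l) =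
        tensB q \<omega> (lmul (\<eta> l \<star> tz l m n) (bas (cz l m n) l))"
      by (simp only: tensB_balanced[OF \<omega> B[OF mn] cz[OF mn]])
  qed
  also have "\<dots> = (\<Sum>l\<in>UNIV. tensB q \<omega> (bas (\<eta> l) l))"
    unfolding eta
    by (intro sum.cong refl) (subst tensB_sum_right[OF \<omega>], intro cvec.subspace_sum[OF Omw_subspace] lmul_Om B cz,
        assumption+, intro sum.cong refl tensB_sum_right[OF \<omega>, symmetric] lmul_Om B cz)
  also have "\<dots> = tensB q \<omega> (\<Sum>l\<in>UNIV. bas (\<eta> l) l)"
    by (rule tensB_sum_right[OF \<omega>, symmetric]) (intro bas_Om OmD \<eta>)
  also have "\<dots> = tensB q \<omega> \<eta>" by (simp only: form_sum_bas[symmetric])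
  finally show ?thesis .
qed

text \<open>On representatives \<open>nu\<close> after \<open>mu\<close> is the quotient map itself;
  injectivity of \<open>mu\<close> on the tensor square follows.\<close>

lemma nu_mu_singles:
  assumes "t \<in> singles Om Om"
  shows "qmap (cvec.span (relsB q)) t = nu (mu t)"
  using assms
proof (induction rule: singles_induct)
  case zero
  show ?case
    using nu_scale[OF cvec.subspace_0[OF WW_subspace], of 0]
    unfolding clinear_zero[OF clinear_mu] clinear_zero[OF qmap(1)[OF cvec.subspace_span]]
    by (simp only: cvec.scale_zero_left)
next
  case (step c x y t)
  have "nu (mu (c *\<^sub>C Poly_Mapping.single (x, y) 1 + t)) = c *\<^sub>C tensB q x y + nu (mu t)"
    using step by (simp only: clinear_add[OF clinear_mu] clinear_scale[OF clinear_mu] mu_single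
        nu_add nu_scale rmul_WW mu_WW cvec.subspace_scale[OF WW_subspace] nu_mu_tensB)
  then show ?case
    using step by (simp add: clinear_add[OF qmap(1)[OF cvec.subspace_span]]
        clinear_scale[OF qmap(1)[OF cvec.subspace_span]] tensB_def tens_def)
qed

lemma nu_mu: "t \<in> TT \<Longrightarrow> nu (mu t) = t"
  using nu_mu_singles[OF TT_singles] tens_space_singles(2)[OF relsB_singles] unfolding TT_def by metis

lemma mu_inj: "s \<in> TT \<Longrightarrow> t \<in> TT \<Longrightarrow> mu s = mu t \<Longrightarrow> s = t"
  using nu_mu by metis

lemma rmul_sum_right:
  assumes "\<And>i. i \<in> I \<Longrightarrow> f i \<in> A"
  shows "rmul q \<omega> (\<Sum>i\<in>I. f i) = (\<Sum>i\<in>I. rmul q \<omega> (f i))"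
  using assms
proof (induction I rule: infinite_finite_induct)
  case (insert i I)
  then show ?case by (simp add: rmul_add_right A_sum del: plus_fun_apply)
qed (use rmul_scale_right[OF A_zero, of \<omega> 0] in \<open>simp_all del: zero_fun_apply\<close>)

lemma mu_nu:
  assumes "\<Theta> \<in> WW"
  shows "mu (nu \<Theta>) = \<Theta>"
proof
  fix l'
  have A: "\<Theta> l k \<in> A" for l k using assms Omw_A unfolding WW_def by blast
  have z: "rmul q \<omega> 0 = 0" for \<omega> using rmul_scale_right[OF A_zero, of \<omega> 0] by (simp del: zero_fun_apply)
  have "mu (nu \<Theta>) l' = (\<Sum>l\<in>UNIV. \<Sum>m\<in>{1..3}. \<Sum>n\<in>{1..3}. rmul q (rmul q (\<Theta> l) (tz l m n)) (bas (cz l m n) l l'))"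
    unfolding nu_def clinear_sum[OF clinear_mu] by (simp only: mu_tensB sum_fun_apply)
  also have "\<dots> = (\<Sum>l\<in>UNIV. if l = l' then
      \<Sum>m\<in>{1..3}. \<Sum>n\<in>{1..3}. rmul q (rmul q (\<Theta> l) (tz l m n)) (cz l m n) else 0)"
    by (intro sum.cong refl) (simp add: bas_def z)
  also have "\<dots> = (\<Sum>m\<in>{1..3}. \<Sum>n\<in>{1..3}. rmul q (rmul q (\<Theta> l') (tz l' m n)) (cz l' m n))"
    by simp
  also have "\<dots> = (\<Sum>m\<in>{1..3}. \<Sum>n\<in>{1..3}. rmul q (\<Theta> l') (tz l' m n \<star> cz l' m n))"
    by (intro sum.cong refl rmul_assoc A Aw_A[OF tz_Aw] Aw_A[OF cz_Aw])
  also have "\<dots> = (\<Sum>m\<in>{1..3}. rmul q (\<Theta> l') (\<Sum>n\<in>{1..3}. tz l' m n \<star> cz l' m n))"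
    by (intro sum.cong refl rmul_sum_right[symmetric] A_conv Aw_A[OF tz_Aw] Aw_A[OF cz_Aw])
  also have "\<dots> = rmul q (\<Theta> l') (\<Sum>m\<in>{1..3}. \<Sum>n\<in>{1..3}. tz l' m n \<star> cz l' m n)"
    by (intro rmul_sum_right[symmetric] A_sum A_conv Aw_A[OF tz_Aw] Aw_A[OF cz_Aw])
  also have "\<dots> = \<Theta> l'" by (simp only: tz_cz rmul_counit A)
  finally show "mu (nu \<Theta>) l' = \<Theta> l'" .
qed

end

section \<open>Coactions\<close>

lemma finite_basis:
  assumes "finite S"
  obtains Bs where "Bs \<subseteq> S" "finite Bs" "cvec.independent Bs"
    "\<And>a. a \<in> S \<Longrightarrow> a = (\<Sum>s\<in>Bs. cvec.representation Bs a s *\<^sub>C s)"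
proof -
  obtain Bs where Bs: "Bs \<subseteq> S" "cvec.independent Bs" "S \<subseteq> cvec.span Bs"
    using cvec.maximal_independent_subset[of S] by blast
  have fin: "finite Bs" using Bs(1) assms finite_subset by blast
  show thesis
    by (rule that[OF Bs(1) fin Bs(2)])
      (use cvec.sum_representation_eq[OF Bs(2) _ fin subset_refl, symmetric] Bs(3) in blast)
qed

lemma independent_pointwise:
  fixes Bs :: "('x \<Rightarrow> complex) set"
  assumes "finite Bs" "cvec.independent Bs" "\<And>x. (\<Sum>s\<in>Bs. s x * c s) = 0" "s \<in> Bs"
  shows "c s = 0"
proof -
  have "(\<Sum>s\<in>Bs. c s *\<^sub>C s) = 0"
    using assms(3) by (simp add: fun_eq_iff sum_fun_apply scaleC_fun_apply scaleC_complex_def mult.commute)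
  then show ?thesis using cvec.independentD[OF assms(2,1) subset_refl _ assms(4)] by blast
qed

lemma bilin_on_scale_sum:
  assumes "bilin_on M N G" "cvec.subspace M" "cvec.subspace N" "n \<in> N" "\<And>i. i \<in> I \<Longrightarrow> f i \<in> M"
  shows "G (\<Sum>i\<in>I. c i *\<^sub>C f i) n = (\<Sum>i\<in>I. c i *\<^sub>C G (f i) n)"
  using assms(5)
proof (induction I rule: infinite_finite_induct)
  case (insert i I)
  have "(\<Sum>i\<in>I. c i *\<^sub>C f i) \<in> M" "c i *\<^sub>C f i \<in> M" "f i \<in> M"
    using insert by (auto intro!: cvec.subspace_sum[OF assms(2)] cvec.subspace_scale[OF assms(2)])
  then show ?case using insert assms(1,4) by (simp add: bilin_on_def)
next
  case empty
  have "G (0 *\<^sub>C 0) n = 0 *\<^sub>C G 0 n"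
    using assms(1,4) cvec.subspace_0[OF assms(2)] by (simp only: bilin_on_def)
  then show ?case by simp
next
  case (infinite I)
  have "G (0 *\<^sub>C 0) n = 0 *\<^sub>C G 0 n"
    using assms(1,4) cvec.subspace_0[OF assms(2)] by (simp only: bilin_on_def)
  then show ?case using infinite by simp
qed

lemma bilin_on_flip: "bilin_on M N G \<Longrightarrow> bilin_on N M (\<lambda>y x. G x y)"
  by (simp add: bilin_on_def)

lemma bilin_on_sum_scale:
  assumes "bilin_on M N G" "cvec.subspace M" "cvec.subspace N" "m \<in> M" "\<And>i. i \<in> I \<Longrightarrow> f i \<in> N"
  shows "G m (\<Sum>i\<in>I. c i *\<^sub>C f i) = (\<Sum>i\<in>I. c i *\<^sub>C G m (f i))"
  using bilin_on_scale_sum[OF bilin_on_flip[OF assms(1)] assms(3,2,4,5)] .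

text \<open>The tensor product of a space of functions with \<open>N\<close> embeds into functions of two variables.\<close>

lemma tens_eval_inj:
  fixes M :: "('x \<Rightarrow> complex) set" and N :: "'n::complex_vector set" and ev :: "'n \<Rightarrow> 'y \<Rightarrow> complex"
  assumes M: "cvec.subspace M" and N: "cvec.subspace N"
    and ev: "clinear ev" "\<And>n. n \<in> N \<Longrightarrow> ev n = 0 \<Longrightarrow> n = 0"
    and t: "t \<in> singles M N" "\<And>x y. lext (\<lambda>(a, n). a x * ev n y) t = 0"
  shows "t \<in> cvec.span (bilinear_rels M N)"
proof -
  let ?R = "bilinear_rels M N"
  let ?K = "Poly_Mapping.keys t"
  note keys = keys_singles[OF t(1)]
  have fin: "finite (fst ` ?K)" by simp
  obtain Bs where Bs: "Bs \<subseteq> fst ` ?K" "finite Bs" "cvec.independent Bs"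
    and rep: "\<And>a. a \<in> fst ` ?K \<Longrightarrow> a = (\<Sum>s\<in>Bs. cvec.representation Bs a s *\<^sub>C s)"
    using finite_basis[OF fin] by blast
  define r where "r k s = cvec.representation Bs (fst k) s" for k :: "('x \<Rightarrow> complex) \<times> 'n" and s
  \<comment> \<open>Expanding all first legs in the basis \<open>Bs\<close> regroups
    \<open>t\<close> as the sum of \<open>s \<otimes> n s\<close>.\<close>
  define n where "n s = (\<Sum>k\<in>?K. (Poly_Mapping.lookup t k * r k s) *\<^sub>C snd k)" for s
  have "fst ` ?K \<subseteq> M" using keys by auto
  then have BsM: "s \<in> M" if "s \<in> Bs" for s using that Bs(1) by blast
  have nN: "n s \<in> N" for s
    unfolding n_def using keys by (intro cvec.subspace_sum[OF N] cvec.subspace_scale[OF N]) auto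
  have expand: "lext (\<lambda>(x, y). G x y) t = (\<Sum>s\<in>Bs. G s (n s))" if G: "bilin_on M N G" for G :: "_ \<Rightarrow> _ \<Rightarrow> 'z::complex_vector"
  proof -
    have "lext (\<lambda>(x, y). G x y) t = (\<Sum>k\<in>?K. Poly_Mapping.lookup t k *\<^sub>C (\<Sum>s\<in>Bs. r k s *\<^sub>C G s (snd k)))"
      unfolding lext_def split_def
    proof (intro sum.cong refl arg_cong[where f = "scaleC _"])
      fix k assume k: "k \<in> ?K"
      have "G (\<Sum>s\<in>Bs. r k s *\<^sub>C s) (snd k) = (\<Sum>s\<in>Bs. r k s *\<^sub>C G s (snd k))"
        by (rule bilin_on_scale_sum[OF G M N]) (use k keys BsM in auto)
      moreover have "(\<Sum>s\<in>Bs. r k s *\<^sub>C s) = fst k"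
        unfolding r_def using rep[of "fst k"] k by (metis image_eqI)
      ultimately show "G (fst k) (snd k) = (\<Sum>s\<in>Bs. r k s *\<^sub>C G s (snd k))" by simp
    qed
    also have "\<dots> = (\<Sum>k\<in>?K. \<Sum>s\<in>Bs. (Poly_Mapping.lookup t k * r k s) *\<^sub>C G s (snd k))"
      by (simp only: cvec.scale_sum_right scaleC_scaleC)
    also have "\<dots> = (\<Sum>s\<in>Bs. \<Sum>k\<in>?K. (Poly_Mapping.lookup t k * r k s) *\<^sub>C G s (snd k))"
      by (rule sum.swap)
    also have "\<dots> = (\<Sum>s\<in>Bs. G s (n s))"
      unfolding n_def
      by (intro sum.cong refl bilin_on_sum_scale[OF G M N, symmetric] BsM) (use keys in auto)
    finally show ?thesis .
  qed
  \<comment> \<open>For fixed \<open>y\<close> the vanishing evaluations form a linear relation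
    among the independent functions in \<open>Bs\<close>.\<close>
  have "n s = 0" if "s \<in> Bs" for s
  proof (rule ev(2)[OF nN], rule ext)
    fix y
    have "bilin_on M N (\<lambda>a n. a x * ev n y)" for x
      unfolding bilin_on_def
      by (auto simp: clinear_add[OF ev(1)] clinear_scale[OF ev(1)] scaleC_fun_apply scaleC_complex_def algebra_simps)
    then have "(\<Sum>s\<in>Bs. s x * ev (n s) y) = 0" for x
      using expand[of "\<lambda>a n. a x * ev n y"] t(2) by simp
    then show "ev (n s) y = 0 y"
      using independent_pointwise[OF Bs(2,3) _ that, of "\<lambda>s. ev (n s) y"] by simp
  qed
  moreover have tb: "bilin_on M N (tens ?R)" by (rule tens_bilin[OF subset_refl])
  moreover have "tens ?R s 0 = 0" if "s \<in> M" for s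
    using bilin_on_sum_scale[OF tb M N that, of "{}"] by simp
  ultimately have "qmap (cvec.span ?R) t = 0"
    unfolding qmap_lext_tens expand[OF tb] using BsM by simp
  then show ?thesis using qmap(3)[OF cvec.subspace_span] by blast
qed

context quantum_flag
begin

text \<open>A finite Sweedler decomposition of the coaction, kept as explicit data so that it can be
  evaluated without passing to the quotient.\<close>

definition splits :: "form \<Rightarrow> (tix \<times> func) set \<Rightarrow> (tix \<times> func \<Rightarrow> func) \<Rightarrow> (tix \<times> func \<Rightarrow> form) \<Rightarrow> bool"
  where "splits \<omega> I a \<eta> \<longleftrightarrow> finite I \<and> (\<forall>i\<in>I. a i \<in> A \<and> \<eta> i \<in> Om) \<and>
    (\<forall>k x y. \<omega> k (x * y) = (\<Sum>i\<in>I. a i x * \<eta> i k y))"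

text \<open>The first legs are made linearly independent: only then does the weight equation of
  \<phi> in its right variable hold for each second leg separately.\<close>

lemma Aw_split:
  assumes "\<phi> \<in> Aw \<alpha>"
  obtains Bs b where "finite Bs" "Bs \<subseteq> A" "\<And>s. s \<in> Bs \<Longrightarrow> b s \<in> Aw \<alpha>"
    "\<And>x y. \<phi> (x * y) = (\<Sum>s\<in>Bs. s x * b s y)"
proof -
  obtain n c d where n: "\<And>i. i < (n::nat) \<Longrightarrow> c i \<in> A \<and> d i \<in> A" "\<And>x y. \<phi> (x * y) = (\<Sum>i<n. c i x * d i y)"
    using A_comult[OF Aw_A[OF assms]] unfolding comult_in_def by blast
  have "finite (c ` {..<n})" by simp
  then obtain Bs where Bs: "Bs \<subseteq> c ` {..<n}" "finite Bs" "cvec.independent Bs"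
    and rep: "\<And>a. a \<in> c ` {..<n} \<Longrightarrow> a = (\<Sum>s\<in>Bs. cvec.representation Bs a s *\<^sub>C s)"
    using finite_basis by blast
  define b where "b s = (\<Sum>i<n. cvec.representation Bs (c i) s *\<^sub>C d i)" for s
  have eq: "\<phi> (x * y) = (\<Sum>s\<in>Bs. s x * b s y)" for x y
  proof -
    have "c i x = (\<Sum>s\<in>Bs. cvec.representation Bs (c i) s * s x)" if "i < n" for i
      using fun_cong[OF rep[of "c i"], of x] that
      by (simp add: sum_fun_apply scaleC_fun_apply scaleC_complex_def)
    then have "\<phi> (x * y) = (\<Sum>i<n. \<Sum>s\<in>Bs. cvec.representation Bs (c i) s * s x * d i y)"
      by (simp add: n(2) sum_distrib_right)
    also have "\<dots> = (\<Sum>s\<in>Bs. \<Sum>i<n. cvec.representation Bs (c i) s * s x * d i y)"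
      by (rule sum.swap)
    also have "\<dots> = (\<Sum>s\<in>Bs. s x * b s y)"
      by (simp add: b_def sum_fun_apply scaleC_fun_apply scaleC_complex_def sum_distrib_left mult_ac)
    finally show ?thesis .
  qed
  have bA: "b s \<in> A" for s unfolding b_def using n(1) by (intro A_sum A_scale) auto
  have "b s \<in> Aw \<alpha>" if "s \<in> Bs" for s
    unfolding Aw_def
  proof (intro CollectI conjI allI bA ext)
    fix i y
    have "(\<Sum>s\<in>Bs. s x * ((K i \<triangleright> b s) y - qpow q (\<alpha> i) * b s y)) = 0" for x
    proof -
      have "\<phi> (x * (y * K i)) = (K i \<triangleright> \<phi>) (x * y)" by (simp add: act_def mult.assoc)
      also have "\<dots> = qpow q (\<alpha> i) * \<phi> (x * y)"
        using assms by (simp add: Aw_def scaleC_fun_apply scaleC_complex_def)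
      finally show ?thesis
        by (simp add: eq act_def right_diff_distrib sum_subtractf sum_distrib_left mult_ac)
    qed
    from independent_pointwise[OF Bs(2,3) this that]
    show "(K i \<triangleright> b s) y = (qpow q (\<alpha> i) *\<^sub>C b s) y" by (simp add: scaleC_fun_apply scaleC_complex_def)
  qed
  then show thesis using that[OF Bs(2) _ _ eq] Bs(1) n(1) by auto
qed

lemma splits_exists:
  assumes "\<omega> \<in> Om"
  obtains I a \<eta> where "splits \<omega> I a \<eta>"
proof -
  have "\<forall>k. \<exists>Bs b. finite Bs \<and> Bs \<subseteq> A \<and> (\<forall>s\<in>Bs. b s \<in> Aw (wt k)) \<and>
      (\<forall>x y. \<omega> k (x * y) = (\<Sum>s\<in>Bs. s x * b s y))"
  proof
    fix k
    show "\<exists>Bs b. finite Bs \<and> Bs \<subseteq> A \<and> (\<forall>s\<in>Bs. b s \<in> Aw (wt k)) \<and>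
        (\<forall>x y. \<omega> k (x * y) = (\<Sum>s\<in>Bs. s x * b s y))"
      by (rule Aw_split[OF OmD[OF assms, of k]]) blast
  qed
  then obtain Bs b where "\<forall>k. finite (Bs k) \<and> Bs k \<subseteq> A \<and> (\<forall>s\<in>Bs k. b k s \<in> Aw (wt k)) \<and>
      (\<forall>x y. \<omega> k (x * y) = (\<Sum>s\<in>Bs k. s x * b k s y))"
    unfolding choice_iff by blast
  then have Bs: "\<And>k. finite (Bs k)" "\<And>k. Bs k \<subseteq> A" "\<And>k s. s \<in> Bs k \<Longrightarrow> b k s \<in> Aw (wt k)"
    "\<And>k x y. \<omega> k (x * y) = (\<Sum>s\<in>Bs k. s x * b k s y)" by blast+
  have "splits \<omega> (Sigma UNIV Bs) snd (\<lambda>(k, s). bas (b k s) k)"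
    unfolding splits_def
  proof (intro conjI allI ballI)
    fix k x y
    have "(\<Sum>i\<in>Sigma UNIV Bs. snd i x * (case i of (k, s) \<Rightarrow> bas (b k s) k) k y) =
        (\<Sum>j\<in>UNIV. \<Sum>s\<in>Bs j. s x * bas (b j s) j k y)"
      by (subst sum.Sigma) (auto simp: Bs split_def)
    also have "\<dots> = (\<Sum>j\<in>UNIV. if j = k then \<Sum>s\<in>Bs j. s x * b j s y else 0)"
      by (intro sum.cong refl) (simp add: bas_def)
    also have "\<dots> = \<omega> k (x * y)" by (simp add: Bs(4))
    finally show "\<omega> k (x * y) = (\<Sum>i\<in>Sigma UNIV Bs. snd i x * (case i of (k, s) \<Rightarrow> bas (b k s) k) k y)" by simp
  qed (use Bs(1,3) subsetD[OF Bs(2)] bas_Om in auto)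
  then show thesis by (rule that)
qed

lemma relsA1_eq: "relsA1 q = bilinear_rels A Om" by (simp add: relsA1_def Om1_eq)
lemma relsA2_eq: "relsA2 q = bilinear_rels A TT" by (simp add: relsA2_def)

lemma relsA1_singles: "relsA1 q \<subseteq> singles A Om"
  unfolding relsA1_eq by (rule bilinear_rels_singles[OF A_subspace Omw_subspace])

lemma relsA2_singles: "relsA2 q \<subseteq> singles A TT"
  unfolding relsA2_eq by (rule bilinear_rels_singles[OF A_subspace TT_subspace])

lemma eval1_bilin: "bilin_on A Om (\<lambda>a \<eta>. a x * \<eta> k y)"
  unfolding bilin_on_def by (auto simp: scaleC_fun_apply scaleC_complex_def algebra_simps)

text \<open>The definite description in \<open>coact1\<close> is justified by
  \<open>tens_eval_inj\<close>, as elements of the tensor product are separated by their values on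
  pairs.\<close>

lemma coact1_eq:
  assumes "splits \<omega> I a \<eta>"
  shows "coact1 q \<omega> = (\<Sum>i\<in>I. tens (relsA1 q) (a i) (\<eta> i))"
  unfolding coact1_def Om1_eq
proof (rule the_equality)
  let ?t = "\<Sum>i\<in>I. tens (relsA1 q) (a i) (\<eta> i)"
  have kill: "lext (\<lambda>(a, \<eta>). a x * \<eta> k y) r = 0" if "r \<in> relsA1 q" for r x k y
    using lext_bilinear_rels[OF eval1_bilin] that unfolding relsA1_eq by blast
  have ev: "lext (\<lambda>(a, \<eta>). a x * \<eta> k y) ?t = \<omega> k (x * y)" for k x y
    using assms by (simp add: lext_sum lext_tens[OF kill] splits_def)
  have t: "?t \<in> tens_space (relsA1 q) A Om"
    using assms unfolding splits_def by (intro cvec.subspace_sum[OF subspace_tens_space] tens_in_tens_space) auto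
  show "?t \<in> tens_space (relsA1 q) A Om \<and> (\<forall>k x y. \<omega> k (x * y) = lext (\<lambda>(a, \<eta>). a x * \<eta> k y) ?t)"
    using t ev by simp
  fix t' assume t': "t' \<in> tens_space (relsA1 q) A Om \<and> (\<forall>k x y. \<omega> k (x * y) = lext (\<lambda>(a, \<eta>). a x * \<eta> k y) t')"
  have d: "t' - ?t \<in> tens_space (relsA1 q) A Om" using t t' by (simp add: cvec.subspace_diff[OF subspace_tens_space])
  have "t' - ?t \<in> cvec.span (bilinear_rels A Om)"
  proof (rule tens_eval_inj[OF A_subspace Omw_subspace])
    show "clinear (\<lambda>\<eta> :: form. \<lambda>(k, y). \<eta> k y)"
      by (rule clinearI) (auto simp: fun_eq_iff scaleC_fun_apply)
    show "\<eta> = 0" if "(\<lambda>(k, y). \<eta> k y) = 0" for \<eta> :: form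
      using that by (auto simp: fun_eq_iff)
    show "t' - ?t \<in> singles A Om" by (rule tens_space_singles[OF relsA1_singles d])
    show "lext (\<lambda>(a, n). a x * (case y of (k, y) \<Rightarrow> n k y)) (t' - ?t) = 0" for x y
      using t' ev by (cases y) (simp add: lext_diff)
  qed
  then show "t' = ?t"
    using tens_space_inj[OF relsA1_singles d] unfolding relsA1_eq by simp
qed

lemma lext_coact1:
  assumes "splits \<omega> I a \<eta>" "bilin_on A Om G"
  shows "lext (\<lambda>(a, \<eta>). G a \<eta>) (coact1 q \<omega>) = (\<Sum>i\<in>I. G (a i) (\<eta> i))"
proof -
  have kill: "lext (\<lambda>(a, \<eta>). G a \<eta>) r = 0" if "r \<in> relsA1 q" for r
    using lext_bilinear_rels[OF assms(2)] that unfolding relsA1_eq by blast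
  show ?thesis by (simp add: coact1_eq[OF assms(1)] lext_sum lext_tens[OF kill])
qed

section \<open>Evaluating the coaction on the tensor square\<close>

abbreviation evA2 :: "tix \<Rightarrow> tix \<Rightarrow> free \<Rightarrow> free \<Rightarrow> (func \<times> form2 \<Rightarrow>\<^sub>0 complex) \<Rightarrow> complex"
  where "evA2 l k x y \<equiv> lext (\<lambda>(a, \<theta>). a x * mu \<theta> l k y)"

lemma evA2_bilin: "bilin_on A TT (\<lambda>a \<theta>. a x * mu \<theta> l k y)"
  unfolding bilin_on_def
  by (auto simp: clinear_add[OF clinear_mu] clinear_scale[OF clinear_mu] scaleC_fun_apply scaleC_complex_def
      algebra_simps)

lemma evA2_tens: "evA2 l k x y (tens (relsA2 q) a \<theta>) = a x * mu \<theta> l k y"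
proof -
  have kill: "evA2 l k x y r = 0" if "r \<in> relsA2 q" for r
    using lext_bilinear_rels[OF evA2_bilin] that unfolding relsA2_eq by blast
  show ?thesis by (subst lext_tens[OF kill]) auto
qed

abbreviation AT :: "(func \<times> form2 \<Rightarrow>\<^sub>0 complex) set"
  where "AT \<equiv> tens_space (relsA2 q) A TT"

text \<open>An instance of \<open>tens_eval_inj\<close>, where injectivity of \<open>mu\<close>
  makes the components of \<open>mu \<theta>\<close> separate points.\<close>

lemma evA2_inj:
  assumes "s \<in> AT" "t \<in> AT" "\<And>l k x y. evA2 l k x y s = evA2 l k x y t"
  shows "s = t"
proof -
  have d: "s - t \<in> AT" using assms by (simp add: cvec.subspace_diff[OF subspace_tens_space])
  have "s - t \<in> cvec.span (bilinear_rels A TT)"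
  proof (rule tens_eval_inj[OF A_subspace TT_subspace])
    show "clinear (\<lambda>\<theta>. \<lambda>(l, k, y). mu \<theta> l k y)"
      by (rule clinearI) (auto simp: fun_eq_iff scaleC_fun_apply clinear_add[OF clinear_mu] clinear_scale[OF clinear_mu])
    show "\<theta> = 0" if "\<theta> \<in> TT" "(\<lambda>(l, k, y). mu \<theta> l k y) = 0" for \<theta>
    proof (rule mu_inj[OF that(1) cvec.subspace_0[OF TT_subspace]])
      have "mu \<theta> l k y = 0" for l k y
        using fun_cong[OF that(2), of "(l, k, y)"] by simp
      then show "mu \<theta> = mu 0" unfolding clinear_zero[OF clinear_mu] by (simp add: fun_eq_iff)
    qed
    show "s - t \<in> singles A TT" by (rule tens_space_singles[OF relsA2_singles d])
    show "lext (\<lambda>(a, n). a x * (case y of (l, k, y) \<Rightarrow> mu n l k y)) (s - t) = 0" for x y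
      using assms(3) by (cases y) (simp add: lext_diff)
  qed
  then show ?thesis
    using tens_space_inj[OF relsA2_singles d] unfolding relsA2_eq by simp
qed

lemma tensA2_bilin: "bilin_on A TT (tens (relsA2 q))"
  by (rule tens_bilin) (simp add: relsA2_eq)

lemma coact2_single:
  assumes "splits \<omega> I a \<omega>s" "splits \<eta> J b \<eta>s" "\<omega> \<in> Om" "\<eta> \<in> Om"
  shows "coact2 q (Poly_Mapping.single (\<omega>, \<eta>) 1) =
    (\<Sum>i\<in>I. \<Sum>j\<in>J. tens (relsA2 q) (a i \<star> b j) (tensB q (\<omega>s i) (\<eta>s j)))"
proof -
  define H where "H a \<omega>' = lext (\<lambda>(b, \<eta>'). tens (relsA2 q) (a \<star> b) (tensB q \<omega>' \<eta>')) (coact1 q \<eta>)" for a \<omega>'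
  have bj: "b j \<in> A" "\<eta>s j \<in> Om" if "j \<in> J" for j using assms(2) that by (auto simp: splits_def)
  have H: "H a \<omega>' = (\<Sum>j\<in>J. tens (relsA2 q) (a \<star> b j) (tensB q \<omega>' (\<eta>s j)))" if "a \<in> A" "\<omega>' \<in> Om" for a \<omega>'
    unfolding H_def
  proof (rule lext_coact1[OF assms(2)])
    show "bilin_on A Om (\<lambda>b \<eta>'. tens (relsA2 q) (a \<star> b) (tensB q \<omega>' \<eta>'))"
      using tensA2_bilin tensB_bilin that tensB_TT A_conv unfolding bilin_on_def
      by (simp add: conv_add_right conv_scale_right del: plus_fun_apply)
  qed
  have "coact2 q (Poly_Mapping.single (\<omega>, \<eta>) 1) = lext (\<lambda>(a, \<omega>'). H a \<omega>') (coact1 q \<omega>)"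
    unfolding coact2_def H_def by (simp add: scaleC_one)
  also have "\<dots> = (\<Sum>i\<in>I. H (a i) (\<omega>s i))"
  proof (rule lext_coact1[OF assms(1)])
    have *: "bilin_on A Om (\<lambda>a \<omega>'. tens (relsA2 q) (a \<star> b j) (tensB q \<omega>' (\<eta>s j)))" if "j \<in> J" for j
      using tensA2_bilin tensB_bilin bj[OF that] tensB_TT A_conv unfolding bilin_on_def
      by (simp add: conv_add_left conv_scale_left del: plus_fun_apply)
    have "bilin_on A Om (\<lambda>a \<omega>'. \<Sum>j\<in>J. tens (relsA2 q) (a \<star> b j) (tensB q \<omega>' (\<eta>s j)))"
      using * unfolding bilin_on_def
      by (simp add: sum.distrib cvec.scale_sum_right del: plus_fun_apply)
    then show "bilin_on A Om H"
      unfolding bilin_on_def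
      by (simp add: H A_add A_scale cvec.subspace_add[OF Omw_subspace] cvec.subspace_scale[OF Omw_subspace]
          del: plus_fun_apply)
  qed
  also have "\<dots> = (\<Sum>i\<in>I. \<Sum>j\<in>J. tens (relsA2 q) (a i \<star> b j) (tensB q (\<omega>s i) (\<eta>s j)))"
    using assms(1) unfolding splits_def by (intro sum.cong refl H) auto
  finally show ?thesis .
qed

text \<open>\<open>Tmat\<close> acts on the second Sweedler leg only, so the map \<open>mu\<close>
  is covariant for the coaction on both factors.\<close>

lemma rmul_split:
  assumes s: "splits \<omega> I a \<omega>s" "splits \<eta> J b \<eta>s" and \<omega>: "\<omega> \<in> Om" and \<eta>: "\<eta> \<in> Om"
  shows "rmul q \<omega> (\<eta> l) k (x * y) = (\<Sum>i\<in>I. \<Sum>j\<in>J. (a i \<star> b j) x * rmul q (\<omega>s i) (\<eta>s j l) k y)"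
proof -
  have ai: "a i \<in> A" "\<omega>s i \<in> Om" if "i \<in> I" for i using s(1) that by (auto simp: splits_def)
  have bj: "b j \<in> A" "\<eta>s j \<in> Om" if "j \<in> J" for j using s(2) that by (auto simp: splits_def)
  have one: "(\<omega> m \<star> (Tmat m k \<triangleright> \<eta> l)) (x * y) =
      (\<Sum>i\<in>I. \<Sum>j\<in>J. (a i \<star> b j) x * (\<omega>s i m \<star> (Tmat m k \<triangleright> \<eta>s j l)) y)" for m
  proof (rule conv_split)
    show "(Tmat m k \<triangleright> \<eta> l) (x * y) = (\<Sum>j\<in>J. b j x * (Tmat m k \<triangleright> \<eta>s j l) y)" for x y
    proof -
      have "\<eta> l (x * (y * Tmat m k)) = (\<Sum>j\<in>J. b j x * \<eta>s j l (y * Tmat m k))"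
        using s(2) unfolding splits_def by blast
      then show ?thesis by (simp only: act_def mult.assoc)
    qed
    show "\<omega> m (x * y) = (\<Sum>i\<in>I. a i x * \<omega>s i m y)" for x y
      using s(1) by (simp add: splits_def)
  qed (use ai bj \<omega> \<eta> in \<open>blast intro: A_clinear Omw_A A_act\<close>)+
  have "rmul q \<omega> (\<eta> l) k (x * y) = (\<Sum>m\<in>UNIV. \<Sum>i\<in>I. \<Sum>j\<in>J. (a i \<star> b j) x * (\<omega>s i m \<star> (Tmat m k \<triangleright> \<eta>s j l)) y)"
    by (simp add: rmul_eq Omw_A[OF \<eta>] sum_fun_apply one)
  also have "\<dots> = (\<Sum>i\<in>I. \<Sum>j\<in>J. \<Sum>m\<in>UNIV. (a i \<star> b j) x * (\<omega>s i m \<star> (Tmat m k \<triangleright> \<eta>s j l)) y)"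
    by (rule sum_swap3)
  also have "\<dots> = (\<Sum>i\<in>I. \<Sum>j\<in>J. (a i \<star> b j) x * rmul q (\<omega>s i) (\<eta>s j l) k y)"
    by (intro sum.cong refl) (simp add: rmul_eq Omw_A[OF bj(2)] sum_fun_apply sum_distrib_left)
  finally show ?thesis .
qed

lemma coact2_eval:
  assumes "\<theta> \<in> singles Om Om"
  shows "coact2 q \<theta> \<in> AT \<and> (\<forall>l k x y. evA2 l k x y (coact2 q \<theta>) = mu \<theta> l k (x * y))"
  using assms
proof (induction rule: singles_induct)
  case zero
  show ?case
    by (simp add: coact2_def clinear_zero[OF clinear_mu] cvec.subspace_0[OF subspace_tens_space])
next
  case (step c \<omega> \<eta> \<theta>)
  obtain I a \<omega>s where s1: "splits \<omega> I a \<omega>s" using splits_exists[OF step(1)] .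
  obtain J b \<eta>s where s2: "splits \<eta> J b \<eta>s" using splits_exists[OF step(2)] .
  note eq = coact2_single[OF s1 s2 step(1,2)]
  have mem: "coact2 q (Poly_Mapping.single (\<omega>, \<eta>) 1) \<in> AT"
    unfolding eq using s1 s2 unfolding splits_def
    by (intro cvec.subspace_sum[OF subspace_tens_space] tens_in_tens_space A_conv tensB_TT) auto
  have ev: "evA2 l k x y (coact2 q (Poly_Mapping.single (\<omega>, \<eta>) 1)) = rmul q \<omega> (\<eta> l) k (x * y)" for l k x y
    unfolding eq by (simp add: lext_sum evA2_tens mu_tensB rmul_split[OF s1 s2 step(1,2)])
  have lin: "coact2 q (c *\<^sub>C Poly_Mapping.single (\<omega>, \<eta>) 1 + \<theta>) =
      c *\<^sub>C coact2 q (Poly_Mapping.single (\<omega>, \<eta>) 1) + coact2 q \<theta>"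
    unfolding coact2_def by (simp only: lext_add lext_scale)
  show ?case
    unfolding lin using step mem
    by (auto simp: lext_add lext_scale ev clinear_add[OF clinear_mu] clinear_scale[OF clinear_mu] mu_single
        scaleC_fun_apply intro!: cvec.subspace_add[OF subspace_tens_space] cvec.subspace_scale[OF subspace_tens_space])
qed

text \<open>Both sides of covariance lie in the tensor product separated by \<open>evA2\<close>, so
  covariance becomes an identity of functions in two variables.\<close>

lemma left_covariant_iff:
  assumes "\<And>\<omega>. \<omega> \<in> Om \<Longrightarrow> D \<omega> \<in> TT"
    "\<And>\<omega> \<eta>. \<omega> \<in> Om \<Longrightarrow> \<eta> \<in> Om \<Longrightarrow> D (\<omega> + \<eta>) = D \<omega> + D \<eta>"
    "\<And>c \<omega>. \<omega> \<in> Om \<Longrightarrow> D (c *\<^sub>C \<omega>) = c *\<^sub>C D \<omega>"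
  shows "left_covariant q D \<longleftrightarrow> (\<forall>\<omega>\<in>Om. \<forall>I a \<eta>. splits \<omega> I a \<eta> \<longrightarrow>
    (\<forall>l k x y. mu (D \<omega>) l k (x * y) = (\<Sum>i\<in>I. a i x * mu (D (\<eta> i)) l k y)))"
proof -
  have bil: "bilin_on A Om (\<lambda>a \<eta>. tens (relsA2 q) a (D \<eta>))"
    using tensA2_bilin assms unfolding bilin_on_def by (simp del: plus_fun_apply)
  have main: "coact2 q (D \<omega>) = lext (\<lambda>(a, \<eta>). tens (relsA2 q) a (D \<eta>)) (coact1 q \<omega>) \<longleftrightarrow>
    (\<forall>l k x y. mu (D \<omega>) l k (x * y) = (\<Sum>i\<in>I. a i x * mu (D (\<eta> i)) l k y))"
    if \<omega>: "\<omega> \<in> Om" and s: "splits \<omega> I a \<eta>" for \<omega> I a \<eta>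
  proof -
    have c2: "coact2 q (D \<omega>) \<in> AT" "evA2 l k x y (coact2 q (D \<omega>)) = mu (D \<omega>) l k (x * y)" for l k x y
      using coact2_eval[OF TT_singles[OF assms(1)[OF \<omega>]]] by auto
    let ?R = "lext (\<lambda>(a, \<eta>). tens (relsA2 q) a (D \<eta>)) (coact1 q \<omega>)"
    have R: "?R = (\<Sum>i\<in>I. tens (relsA2 q) (a i) (D (\<eta> i)))"
      by (rule lext_coact1[OF s bil])
    have R1: "?R \<in> AT"
      unfolding R using s assms(1) unfolding splits_def
      by (intro cvec.subspace_sum[OF subspace_tens_space] tens_in_tens_space) auto
    have R2: "evA2 l k x y ?R = (\<Sum>i\<in>I. a i x * mu (D (\<eta> i)) l k y)" for l k x y
      unfolding R by (simp add: lext_sum evA2_tens)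
    show ?thesis
    proof
      assume "coact2 q (D \<omega>) = ?R"
      then show "\<forall>l k x y. mu (D \<omega>) l k (x * y) = (\<Sum>i\<in>I. a i x * mu (D (\<eta> i)) l k y)"
        by (simp only: c2(2)[symmetric] R2[symmetric] simp_thms)
    next
      assume "\<forall>l k x y. mu (D \<omega>) l k (x * y) = (\<Sum>i\<in>I. a i x * mu (D (\<eta> i)) l k y)"
      then show "coact2 q (D \<omega>) = ?R"
        by (intro evA2_inj c2(1) R1) (simp only: c2(2) R2)
    qed
  qed
  show ?thesis
    unfolding left_covariant_def Om1_eq
  proof (intro ball_cong refl iffI allI impI)
    fix \<omega> I a \<eta> assume "\<omega> \<in> Om" "splits \<omega> I a \<eta>"
      "coact2 q (D \<omega>) = lext (\<lambda>(a, \<eta>). tens (relsA2 q) a (D \<eta>)) (coact1 q \<omega>)"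
    then show "mu (D \<omega>) l k (x * y) = (\<Sum>i\<in>I. a i x * mu (D (\<eta> i)) l k y)" for l k x y
      using main by blast
  next
    fix \<omega> assume \<omega>: "\<omega> \<in> Om" and *: "\<forall>I a \<eta>. splits \<omega> I a \<eta> \<longrightarrow>
      (\<forall>l k x y. mu (D \<omega>) l k (x * y) = (\<Sum>i\<in>I. a i x * mu (D (\<eta> i)) l k y))"
    obtain I a \<eta> where "splits \<omega> I a \<eta>" using splits_exists[OF \<omega>] .
    then show "coact2 q (D \<omega>) = lext (\<lambda>(a, \<eta>). tens (relsA2 q) a (D \<eta>)) (coact1 q \<omega>)"
      using main[OF \<omega>] * by blast
  qed
qed

end

text \<open>Absence of linear relations over the index set also makes \<open>v\<close> injective, so
  the index set counts a basis.\<close>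

lemma has_affine_dimI:
  fixes v :: "'i \<Rightarrow> 'a::complex_vector"
  assumes "finite I" "\<And>c i. (\<Sum>i\<in>I. c i *\<^sub>C v i) = 0 \<Longrightarrow> i \<in> I \<Longrightarrow> c i = 0"
    "S = {x0 + (\<Sum>i\<in>I. c i *\<^sub>C v i) | c. True}"
  shows "has_affine_dim S (card I)"
proof -
  have inj: "inj_on v I"
  proof (rule inj_onI, rule ccontr)
    fix i j assume ij: "i \<in> I" "j \<in> I" "v i = v j" "i \<noteq> j"
    let ?c = "\<lambda>k. (if k = i then 1 else 0) - (if k = j then 1 else 0 :: complex)"
    have "(\<Sum>k\<in>I. ?c k *\<^sub>C v k) = (\<Sum>k\<in>I. if k = i then v k else 0) - (\<Sum>k\<in>I. if k = j then v k else 0)"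
      by (simp only: cvec.scale_left_diff_distrib sum_subtractf if_distribR if_distrib[of "\<lambda>c. c *\<^sub>C _"]
          cvec.scale_zero_left scaleC_one)
    also have "\<dots> = 0" using ij assms(1) by (simp only: sum.delta if_True diff_self)
    finally have "?c i = 0" by (rule assms(2)[of ?c, OF _ ij(1)])
    then show False using ij(4) by simp
  qed
  have sum_v: "(\<Sum>w\<in>v ` I. d w *\<^sub>C w) = (\<Sum>i\<in>I. d (v i) *\<^sub>C v i)" for d
    using sum.reindex[OF inj, of "\<lambda>w. d w *\<^sub>C w"] by (simp add: comp_def)
  have ind: "cvec.independent (v ` I)"
  proof (rule cvec.independent_if_scalars_zero)
    show "finite (v ` I)" using assms(1) by simp
    fix d w assume "(\<Sum>w\<in>v ` I. d w *\<^sub>C w) = 0" "w \<in> v ` I"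
    then show "d w = 0" using assms(2)[of "\<lambda>i. d (v i)"] unfolding sum_v by blast
  qed
  have "cvec.span (v ` I) = {\<Sum>i\<in>I. c i *\<^sub>C v i | c. True}"
  proof (intro subset_antisym subsetI)
    fix w assume "w \<in> cvec.span (v ` I)"
    then obtain d where "w = (\<Sum>w\<in>v ` I. d w *\<^sub>C w)"
      using cvec.span_finite[of "v ` I"] assms(1) by auto
    then show "w \<in> {\<Sum>i\<in>I. c i *\<^sub>C v i | c. True}"
      unfolding sum_v by (intro CollectI exI[of _ "\<lambda>i. d (v i)"] conjI TrueI)
  next
    fix w assume "w \<in> {\<Sum>i\<in>I. c i *\<^sub>C v i | c. True}"
    then show "w \<in> cvec.span (v ` I)"
      by (auto intro!: cvec.span_sum cvec.span_scale intro: cvec.span_base)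
  qed
  then have "S = (\<lambda>v. x0 + v) ` cvec.span (v ` I)" unfolding assms(3) by (auto simp: image_iff)
  then show ?thesis
    unfolding has_affine_dim_def using ind assms(1) card_image[OF inj] by blast
qed

lemma add_add_diff: "x + y = (x + z) + (y - z)" for x :: "'a::ab_group_add"
  by simp

context quantum_flag
begin

section \<open>Covariant connections\<close>

lemma lmul2_mu:
  assumes "t \<in> singles Om Om" "b \<in> Aw 0"
  shows "lmul2 q b t \<in> TT \<and> mu (lmul2 q b t) = (\<lambda>l. lmul b (mu t l))"
  using assms(1)
proof (induction rule: singles_induct)
  case zero
  have "lmul b 0 = 0" using lmul_scale_right[of b 0 0] by (simp del: zero_fun_apply)
  then show ?case
    by (simp add: lmul2_def cvec.subspace_0[OF TT_subspace] clinear_zero[OF clinear_mu] zero_fun_def)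
next
  case (step c \<omega> \<eta> t)
  have lin: "lmul2 q b (c *\<^sub>C Poly_Mapping.single (\<omega>, \<eta>) 1 + t) = c *\<^sub>C tensB q (lmul b \<omega>) \<eta> + lmul2 q b t"
    unfolding lmul2_def by (simp only: lext_add lext_scale lext_single prod.case scaleC_one)
  have "lmul b (rmul q \<omega> (\<eta> l)) = rmul q (lmul b \<omega>) (\<eta> l)" for l
    by (rule lmul_rmul) (use step assms(2) in \<open>auto intro: Omw_A Aw_A\<close>)
  moreover have "(c *\<^sub>C \<Theta> + \<Theta>') l = c *\<^sub>C \<Theta> l + \<Theta>' l" for \<Theta> \<Theta>' :: "tix \<Rightarrow> form" and l
    by (simp add: scaleC_fun_apply)
  ultimately have "mu (lmul2 q b (c *\<^sub>C Poly_Mapping.single (\<omega>, \<eta>) 1 + t)) =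
      (\<lambda>l. lmul b (mu (c *\<^sub>C Poly_Mapping.single (\<omega>, \<eta>) 1 + t) l))"
    unfolding lin clinear_add[OF clinear_mu] clinear_scale[OF clinear_mu] mu_tensB mu_single
    by (intro ext) (simp only: step lmul_add_right lmul_scale_right)
  moreover have "lmul2 q b (c *\<^sub>C Poly_Mapping.single (\<omega>, \<eta>) 1 + t) \<in> TT"
    unfolding lin using step assms(2)
    by (intro cvec.subspace_add[OF TT_subspace] cvec.subspace_scale[OF TT_subspace] tensB_TT lmul_Om) auto
  ultimately show ?case by blast
qed

lemma lmul2_TT: "t \<in> TT \<Longrightarrow> b \<in> Aw 0 \<Longrightarrow> lmul2 q b t \<in> TT"
  and mu_lmul2: "t \<in> TT \<Longrightarrow> b \<in> Aw 0 \<Longrightarrow> mu (lmul2 q b t) l = lmul b (mu t l)"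
  using lmul2_mu[OF TT_singles] by auto

section \<open>The family of connections with constant coefficients\<close>

definition ddf :: "form \<Rightarrow> tix \<Rightarrow> form" where "ddf \<omega> = (\<lambda>l. dd q (\<omega> l))"

text \<open>The Boolean tells which of the two roots with sum \<open>m\<close> belongs to the first
  tensor factor: \<open>True\<close> means \<open>pr1 m\<close>.\<close>

definition pc :: "tix \<Rightarrow> tix \<Rightarrow> (tix \<times> bool \<Rightarrow> complex) \<Rightarrow> tix \<Rightarrow> complex"
  where "pc l k c m = of_bool (l = pr2 m \<and> k = pr1 m) * c (m, True) +
    of_bool (l = pr1 m \<and> k = pr2 m) * c (m, False)"

definition Phi :: "(tix \<times> bool \<Rightarrow> complex) \<Rightarrow> form \<Rightarrow> tix \<Rightarrow> form"
  where "Phi c \<omega> = (\<lambda>l k. \<Sum>m\<in>UNIV. pc l k c m *\<^sub>C \<omega> m)"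

definition Dc :: "(tix \<times> bool \<Rightarrow> complex) \<Rightarrow> form \<Rightarrow> form2"
  where "Dc c \<omega> = (if \<omega> \<in> Om then nu (ddf \<omega> + Phi c \<omega>) else 0)"

definition Vc :: "tix \<times> bool \<Rightarrow> form \<Rightarrow> form2"
  where "Vc i \<omega> = (if \<omega> \<in> Om then nu (Phi (\<lambda>j. of_bool (j = i)) \<omega>) else 0)"

lemma dd_add: "dd q (a + b) = dd q a + dd q b"
  and dd_scale: "dd q (s *\<^sub>C a) = s *\<^sub>C dd q a"
  by (simp_all add: dd_def fun_eq_iff act_add act_scale scaleC_fun_apply)

lemma ddf_WW: "\<omega> \<in> Om \<Longrightarrow> ddf \<omega> \<in> WW"
  unfolding ddf_def WW_def using dd_Omw OmD by blast

lemma Phi_WW: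
  assumes "\<omega> \<in> Om"
  shows "Phi c \<omega> \<in> WW"
  unfolding WW_def Omw_def Phi_def
proof (intro CollectI allI Aw_sum)
  fix l k m
  show "pc l k c m *\<^sub>C \<omega> m \<in> Aw (wt l + wt k)"
  proof (cases "l = pr2 m \<and> k = pr1 m \<or> l = pr1 m \<and> k = pr2 m")
    case True
    then have w: "wt l + wt k = wt m" using wt_sum_iff[of m l k] by presburger
    show ?thesis unfolding w by (rule Aw_scale[OF OmD[OF assms]])
  next
    case False
    then have n: "\<not> (l = pr2 m \<and> k = pr1 m)" "\<not> (l = pr1 m \<and> k = pr2 m)" by blast+
    have "pc l k c m = 0" unfolding pc_def by (simp only: n of_bool_eq mult_zero_left add_0)
    then show ?thesis by (simp only: cvec.scale_zero_left Aw_zero)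
  qed
qed

lemma Phi_pr:
  "Phi c \<omega> (pr2 m) (pr1 m) = c (m, True) *\<^sub>C \<omega> m"
  "Phi c \<omega> (pr1 m) (pr2 m) = c (m, False) *\<^sub>C \<omega> m"
  by (cases m rule: tix_cases; simp add: Phi_def pc_def sum_tix)+

lemma Phi_add: "Phi c (\<omega> + \<eta>) = Phi c \<omega> + Phi c \<eta>"
  by (intro ext) (simp add: Phi_def sum_fun_apply scaleC_fun_apply scaleC_complex_def distrib_left sum.distrib)

lemma Phi_scale: "Phi c (s *\<^sub>C \<omega>) = s *\<^sub>C Phi c \<omega>"
  by (intro ext) (simp add: Phi_def sum_fun_apply scaleC_fun_apply scaleC_complex_def sum_distrib_left
      mult_ac)

lemma Phi_coeff_sum: "Phi (\<lambda>j. \<Sum>i\<in>I. c i * d i j) \<omega> = (\<Sum>i\<in>I. c i *\<^sub>C Phi (d i) \<omega>)"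
proof (intro ext)
  fix l k x
  have pcs: "pc l k (\<lambda>j. \<Sum>i\<in>I. c i * d i j) m = (\<Sum>i\<in>I. c i * pc l k (d i) m)" for m
    by (simp only: pc_def distrib_left sum.distrib sum_distrib_left mult.left_commute)
  have "Phi (\<lambda>j. \<Sum>i\<in>I. c i * d i j) \<omega> l k x = (\<Sum>m\<in>UNIV. \<Sum>i\<in>I. c i * pc l k (d i) m * \<omega> m x)"
    by (simp add: Phi_def pcs sum_fun_apply scaleC_fun_apply scaleC_complex_def sum_distrib_right)
  also have "\<dots> = (\<Sum>i\<in>I. \<Sum>m\<in>UNIV. c i * pc l k (d i) m * \<omega> m x)"
    by (rule sum.swap)
  finally show "Phi (\<lambda>j. \<Sum>i\<in>I. c i * d i j) \<omega> l k x = (\<Sum>i\<in>I. c i *\<^sub>C Phi (d i) \<omega>) l k x"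
    by (simp add: Phi_def sum_fun_apply scaleC_fun_apply scaleC_complex_def sum_distrib_left mult.assoc)
qed

lemma Phi_unit_sum: "Phi c \<omega> = (\<Sum>i\<in>UNIV. c i *\<^sub>C Phi (\<lambda>j. of_bool (j = i)) \<omega>)"
proof -
  have "(\<Sum>i\<in>UNIV. c i * of_bool (j = i)) = c j" for j by (simp add: of_bool_def if_distrib cong: if_cong)
  then show ?thesis
    using Phi_coeff_sum[where I = UNIV and c = c and d = "\<lambda>i j. of_bool (j = i)" and \<omega> = \<omega>] by (simp only:)
qed

lemma nu_sum:
  assumes "\<And>i. i \<in> I \<Longrightarrow> \<Theta> i \<in> WW"
  shows "nu (\<Sum>i\<in>I. c i *\<^sub>C \<Theta> i) = (\<Sum>i\<in>I. c i *\<^sub>C nu (\<Theta> i))"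
proof (rule mu_inj)
  have mem: "(\<Sum>i\<in>I. c i *\<^sub>C \<Theta> i) \<in> WW"
    using assms by (intro cvec.subspace_sum[OF WW_subspace] cvec.subspace_scale[OF WW_subspace])
  then show "nu (\<Sum>i\<in>I. c i *\<^sub>C \<Theta> i) \<in> TT" by (rule nu_TT)
  show "(\<Sum>i\<in>I. c i *\<^sub>C nu (\<Theta> i)) \<in> TT"
    using assms by (intro cvec.subspace_sum[OF TT_subspace] cvec.subspace_scale[OF TT_subspace] nu_TT)
  show "mu (nu (\<Sum>i\<in>I. c i *\<^sub>C \<Theta> i)) = mu (\<Sum>i\<in>I. c i *\<^sub>C nu (\<Theta> i))"
    unfolding mu_nu[OF mem] clinear_sum[OF clinear_mu] clinear_scale[OF clinear_mu]
    by (intro sum.cong refl) (simp only: mu_nu[OF assms])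
qed

text \<open>The base point \<open>d\<close> is arbitrary because two are used: zero for all
  covariant connections, and a torsion-free one for the second dimension.\<close>

lemma Dc_expand: "Dc c = Dc d + (\<Sum>i\<in>UNIV. (c i - d i) *\<^sub>C Vc i)"
proof
  fix \<omega>
  have at: "(Dc d + (\<Sum>i\<in>UNIV. (c i - d i) *\<^sub>C Vc i)) \<omega> = Dc d \<omega> + (\<Sum>i\<in>UNIV. (c i - d i) *\<^sub>C Vc i \<omega>)"
    by (simp add: sum_fun_apply scaleC_fun_apply)
  show "Dc c \<omega> = (Dc d + (\<Sum>i\<in>UNIV. (c i - d i) *\<^sub>C Vc i)) \<omega>"
  proof (cases "\<omega> \<in> Om")
    case True
    have eq: "ddf \<omega> + Phi c \<omega> = (ddf \<omega> + Phi d \<omega>) + (\<Sum>i\<in>UNIV. (c i - d i) *\<^sub>C Phi (\<lambda>j. of_bool (j = i)) \<omega>)"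
      unfolding cvec.scale_left_diff_distrib sum_subtractf Phi_unit_sum[symmetric] by (rule add_add_diff)
    have mem: "ddf \<omega> + Phi d \<omega> \<in> WW"
      using True by (intro cvec.subspace_add[OF WW_subspace] ddf_WW Phi_WW)
    have mem': "(\<Sum>i\<in>UNIV. (c i - d i) *\<^sub>C Phi (\<lambda>j. of_bool (j = i)) \<omega>) \<in> WW"
      using True by (intro cvec.subspace_sum[OF WW_subspace] cvec.subspace_scale[OF WW_subspace] Phi_WW)
    show ?thesis
      unfolding at Dc_def Vc_def using True
      by (simp only: if_True eq nu_add[OF mem mem'] nu_sum Phi_WW)
  next
    case False
    then show ?thesis unfolding at by (simp add: Dc_def Vc_def)
  qed
qed

lemma Vc_independent:
  assumes "(\<Sum>i\<in>UNIV. c i *\<^sub>C Vc i) = 0"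
  shows "c i = 0"
proof -
  obtain m b where i: "i = (m, b)" by fastforce
  \<comment> \<open>This function has weight \<open>wt m\<close> and value 1 at the unit, so the
    form \<open>bas ?a m\<close> detects exactly the two coefficients at \<open>m\<close>.\<close>
  let ?a = "cz m (top_ix m) (bot_ix m)"
  let ?\<omega> = "bas ?a m"
  have \<omega>: "?\<omega> \<in> Om" by (rule bas_cz_Om[OF ix_123])
  have a1: "?a 1 = 1" by (simp add: cz_def conv_one U_one V_one)
  have "(\<Sum>i\<in>UNIV. c i *\<^sub>C Vc i ?\<omega>) = 0"
    using fun_cong[OF assms, of ?\<omega>] by (simp add: sum_fun_apply scaleC_fun_apply)
  then have "nu (Phi c ?\<omega>) = 0"
    unfolding Vc_def using \<omega> by (subst Phi_unit_sum) (simp only: nu_sum Phi_WW if_True)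
  then have P: "Phi c ?\<omega> = 0"
    using mu_nu[OF Phi_WW[OF \<omega>, of c]] clinear_zero[OF clinear_mu] by simp
  have "c (m, True) *\<^sub>C ?\<omega> m = 0" "c (m, False) *\<^sub>C ?\<omega> m = 0"
    unfolding Phi_pr[symmetric] P by simp_all
  then have "c (m, True) * ?a 1 = 0" "c (m, False) * ?a 1 = 0"
    by (auto simp: bas_def fun_eq_iff scaleC_fun_apply scaleC_complex_def)
  then show ?thesis using a1 i by (cases b) auto
qed

lemma Dc_Om: "\<omega> \<in> Om \<Longrightarrow> Dc c \<omega> \<in> TT"
  and mu_Dc: "\<omega> \<in> Om \<Longrightarrow> mu (Dc c \<omega>) = ddf \<omega> + Phi c \<omega>"
  unfolding Dc_def by (simp_all only: if_True nu_TT mu_nu cvec.subspace_add[OF WW_subspace] ddf_WW Phi_WW)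

lemma Dc_connection: "connection q (Dc c)"
  unfolding connection_def Om1_eq OF3_eq
proof (intro conjI ballI allI impI)
  note sub = cvec.subspace_add[OF TT_subspace] cvec.subspace_scale[OF TT_subspace]
  note subOm = cvec.subspace_add[OF Omw_subspace] cvec.subspace_scale[OF Omw_subspace]
  show "Dc c \<omega> = 0" if "\<omega> \<notin> Om" for \<omega> unfolding Dc_def using that by (rule if_not_P)
  show "Dc c \<omega> \<in> TT" if "\<omega> \<in> Om" for \<omega> using that by (rule Dc_Om)
  show "Dc c (\<omega> + \<eta>) = Dc c \<omega> + Dc c \<eta>" if \<omega>: "\<omega> \<in> Om" and \<eta>: "\<eta> \<in> Om" for \<omega> \<eta>
  proof (rule mu_inj)
    have d: "ddf (\<omega> + \<eta>) = ddf \<omega> + ddf \<eta>"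
      by (rule ext) (simp only: ddf_def plus_fun_apply dd_add)
    show "mu (Dc c (\<omega> + \<eta>)) = mu (Dc c \<omega> + Dc c \<eta>)"
      unfolding clinear_add[OF clinear_mu] mu_Dc[OF \<omega>] mu_Dc[OF \<eta>] mu_Dc[OF subOm(1)[OF \<omega> \<eta>]] d Phi_add
      by (simp only: add_ac)
    show "Dc c (\<omega> + \<eta>) \<in> TT" by (rule Dc_Om[OF subOm(1)[OF \<omega> \<eta>]])
    show "Dc c \<omega> + Dc c \<eta> \<in> TT" by (rule sub(1)[OF Dc_Om[OF \<omega>] Dc_Om[OF \<eta>]])
  qed
  show "Dc c (s *\<^sub>C \<omega>) = s *\<^sub>C Dc c \<omega>" if \<omega>: "\<omega> \<in> Om" for s \<omega>
  proof (rule mu_inj)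
    have d: "ddf (s *\<^sub>C \<omega>) = s *\<^sub>C ddf \<omega>"
      by (rule ext) (simp only: ddf_def scaleC_fun_apply dd_scale)
    show "mu (Dc c (s *\<^sub>C \<omega>)) = mu (s *\<^sub>C Dc c \<omega>)"
      unfolding clinear_scale[OF clinear_mu] mu_Dc[OF \<omega>] mu_Dc[OF subOm(2)[OF \<omega>]] d Phi_scale
      by (rule scaleC_add_right[symmetric])
    show "Dc c (s *\<^sub>C \<omega>) \<in> TT" by (rule Dc_Om[OF subOm(2)[OF \<omega>]])
    show "s *\<^sub>C Dc c \<omega> \<in> TT" by (rule sub(2)[OF Dc_Om[OF \<omega>]])
  qed
  show "Dc c (lmul b \<omega>) = tensB q (dd q b) \<omega> + lmul2 q b (Dc c \<omega>)" if b: "b \<in> Aw 0" and \<omega>: "\<omega> \<in> Om" for b \<omega>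
  proof (rule mu_inj)
    have d: "dd q b \<in> Om" by (rule dd_Omw[OF b])
    \<comment> \<open>The Leibniz rule of \<open>dd\<close> on each component of \<omega>; its first
      term is the component of \<open>mu (tensB q (dd q b) \<omega>)\<close>.\<close>
    have 1: "ddf (lmul b \<omega>) l = rmul q (dd q b) (\<omega> l) + lmul b (ddf \<omega> l)" for l
      unfolding ddf_def lmul_def by (rule dd_conv[unfolded lmul_def, OF Aw_A[OF b] Omw_A[OF \<omega>]])
    have 2: "Phi c (lmul b \<omega>) l = lmul b (Phi c \<omega> l)" for l
      unfolding Phi_def lmul_def by (rule ext) (simp only: conv_sum_right conv_scale_right)
    have 3: "mu (lmul2 q b (Dc c \<omega>)) l = lmul b (ddf \<omega> l + Phi c \<omega> l)" for l
      unfolding mu_lmul2[OF Dc_Om[OF \<omega>] b] mu_Dc[OF \<omega>] by simp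
    show "mu (Dc c (lmul b \<omega>)) = mu (tensB q (dd q b) \<omega> + lmul2 q b (Dc c \<omega>))"
    proof
      fix l
      have "mu (Dc c (lmul b \<omega>)) l = ddf (lmul b \<omega>) l + Phi c (lmul b \<omega>) l"
        using mu_Dc[OF lmul_Om[OF b \<omega>]] by simp
      also have "\<dots> = rmul q (dd q b) (\<omega> l) + lmul b (ddf \<omega> l + Phi c \<omega> l)"
        unfolding 1 2 lmul_add_right by (rule add.assoc)
      also have "\<dots> = mu (tensB q (dd q b) \<omega>) l + mu (lmul2 q b (Dc c \<omega>)) l"
        unfolding 3 mu_tensB by (rule refl)
      finally show "mu (Dc c (lmul b \<omega>)) l = mu (tensB q (dd q b) \<omega> + lmul2 q b (Dc c \<omega>)) l"
        by (simp add: clinear_add[OF clinear_mu])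
    qed
    show "Dc c (lmul b \<omega>) \<in> TT" by (rule Dc_Om[OF lmul_Om[OF b \<omega>]])
    show "tensB q (dd q b) \<omega> + lmul2 q b (Dc c \<omega>) \<in> TT"
      by (intro sub tensB_TT lmul2_TT Dc_Om d b \<omega>)
  qed
qed

lemma connectionD:
  assumes "connection q D"
  shows "\<omega> \<notin> Om \<Longrightarrow> D \<omega> = 0" "\<omega> \<in> Om \<Longrightarrow> D \<omega> \<in> TT"
    "\<omega> \<in> Om \<Longrightarrow> \<eta> \<in> Om \<Longrightarrow> D (\<omega> + \<eta>) = D \<omega> + D \<eta>"
    "\<omega> \<in> Om \<Longrightarrow> D (s *\<^sub>C \<omega>) = s *\<^sub>C D \<omega>"
    "b \<in> Aw 0 \<Longrightarrow> \<omega> \<in> Om \<Longrightarrow> D (lmul b \<omega>) = tensB q (dd q b) \<omega> + lmul2 q b (D \<omega>)"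
  using assms unfolding connection_def Om1_eq OF3_eq by blast+

text \<open>Tangent vectors act on the second leg of the coproduct and the coefficients of
  \<open>Phi c\<close> are constants, so both parts respect a decomposition of \<omega>.\<close>

lemma Dc_left_covariant: "left_covariant q (Dc c)"
proof (rule iffD2[OF left_covariant_iff[OF connectionD(2)[OF Dc_connection] connectionD(3)[OF Dc_connection]
        connectionD(4)[OF Dc_connection]]], assumption+, intro ballI allI impI)
  fix \<omega> I a \<eta> l k x y
  assume \<omega>: "\<omega> \<in> Om" and s: "splits \<omega> I a \<eta>"
  have i: "\<eta> i \<in> Om" if "i \<in> I" for i using s that by (simp add: splits_def)
  have sp: "\<omega> m (x * y) = (\<Sum>i\<in>I. a i x * \<eta> i m y)" for m x y using s by (simp add: splits_def)
  have 1: "ddf \<omega> l k (x * y) = (\<Sum>i\<in>I. a i x * ddf (\<eta> i) l k y)"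
    using sp[of l x "y * T k"] by (simp only: ddf_def dd_def act_def mult.assoc)
  have P: "Phi c \<omega>' l k z = (\<Sum>m\<in>UNIV. pc l k c m * \<omega>' m z)" for \<omega>' z
    by (simp only: Phi_def sum_fun_apply scaleC_fun_apply scaleC_complex_def)
  have "(\<Sum>i\<in>I. a i x * (\<Sum>m\<in>UNIV. pc l k c m * \<eta> i m y)) = (\<Sum>i\<in>I. \<Sum>m\<in>UNIV. pc l k c m * (a i x * \<eta> i m y))"
    by (simp only: sum_distrib_left mult.left_commute)
  also have "\<dots> = (\<Sum>m\<in>UNIV. \<Sum>i\<in>I. pc l k c m * (a i x * \<eta> i m y))" by (rule sum.swap)
  finally have 2: "Phi c \<omega> l k (x * y) = (\<Sum>i\<in>I. a i x * Phi c (\<eta> i) l k y)"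
    unfolding P by (simp only: sp sum_distrib_left)
  have "mu (Dc c \<omega>) l k (x * y) = ddf \<omega> l k (x * y) + Phi c \<omega> l k (x * y)"
    using mu_Dc[OF \<omega>] by simp
  also have "\<dots> = (\<Sum>i\<in>I. a i x * (ddf (\<eta> i) l k y + Phi c (\<eta> i) l k y))"
    unfolding 1 2 by (simp only: distrib_left sum.distrib)
  also have "\<dots> = (\<Sum>i\<in>I. a i x * mu (Dc c (\<eta> i)) l k y)"
    by (intro sum.cong refl) (simp add: mu_Dc[OF i])
  finally show "mu (Dc c \<omega>) l k (x * y) = (\<Sum>i\<in>I. a i x * mu (Dc c (\<eta> i)) l k y)" .
qed


text \<open>
  A covariant left linear map is determined by its value at the counit, and the functional
  obtained there factors through the fibre of the one-forms over the counit.
\<close>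

lemma covariant_linear_classify:
  assumes WW: "\<And>\<omega>. \<omega> \<in> Om \<Longrightarrow> \<Psi> \<omega> \<in> WW"
    and add: "\<And>\<omega> \<eta>. \<omega> \<in> Om \<Longrightarrow> \<eta> \<in> Om \<Longrightarrow> \<Psi> (\<omega> + \<eta>) = \<Psi> \<omega> + \<Psi> \<eta>"
    and lin: "\<And>b \<omega> l. b \<in> Aw 0 \<Longrightarrow> \<omega> \<in> Om \<Longrightarrow> \<Psi> (lmul b \<omega>) l = lmul b (\<Psi> \<omega> l)"
    and cov: "\<And>\<omega> I a \<eta> l k x y. \<omega> \<in> Om \<Longrightarrow> splits \<omega> I a \<eta> \<Longrightarrow>
      \<Psi> \<omega> l k (x * y) = (\<Sum>i\<in>I. a i x * \<Psi> (\<eta> i) l k y)"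
  obtains c where "\<And>\<omega>. \<omega> \<in> Om \<Longrightarrow> \<Psi> \<omega> = Phi c \<omega>"
proof -
  have zero: "\<Psi> 0 = 0"
    using add[OF cvec.subspace_0[OF Omw_subspace] cvec.subspace_0[OF Omw_subspace]]
    by (simp only: add_0 add_cancel_right_right)
  have sum: "\<Psi> (\<Sum>i\<in>I. f i) = (\<Sum>i\<in>I. \<Psi> (f i))" if "\<And>i. i \<in> I \<Longrightarrow> f i \<in> Om" for I :: "'z set" and f
    using that
  proof (induction I rule: infinite_finite_induct)
    case (insert i I)
    have I: "(\<Sum>i\<in>I. f i) \<in> Om" by (rule cvec.subspace_sum[OF Omw_subspace]) (use insert in blast)
    have i: "f i \<in> Om" and IH: "\<Psi> (\<Sum>i\<in>I. f i) = (\<Sum>i\<in>I. \<Psi> (f i))" using insert by blast+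
    show ?case unfolding sum.insert[OF insert.hyps] add[OF i I] IH by (rule refl)
  qed (simp_all add: zero del: zero_fun_apply)
  \<comment> \<open>Expanding \<omega> by the partition of unity leaves \<open>\<omega> m 1\<close>
    times this constant in the fibre, by left linearity.\<close>
  define C where "C m l k = (\<Sum>p\<in>{1..3}. \<Sum>n\<in>{1..3}. tz m p n 1 * \<Psi> (bas (cz m p n) m) l k 1)" for m l k
  have fib: "\<Psi> \<omega> l k 1 = (\<Sum>m\<in>UNIV. C m l k * \<omega> m 1)" if \<omega>: "\<omega> \<in> Om" for \<omega> l k
  proof -
    have B: "\<omega> m \<star> tz m p n \<in> Aw 0" if "p \<in> {1..3}" "n \<in> {1..3}" for m p n
      using that by (intro tz_coeff_Aw OmD \<omega>)
    have "\<Psi> \<omega> = (\<Sum>m\<in>UNIV. \<Psi> (bas (\<omega> m) m))"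
      by (subst form_sum_bas) (rule sum[OF bas_Om[OF OmD[OF \<omega>]]])
    also have "\<dots> = (\<Sum>m\<in>UNIV. \<Sum>p\<in>{1..3}. \<Sum>n\<in>{1..3}. \<Psi> (lmul (\<omega> m \<star> tz m p n) (bas (cz m p n) m)))"
    proof (intro sum.cong refl)
      fix m
      have mem: "lmul (\<omega> m \<star> tz m p n) (bas (cz m p n) m) \<in> Om" if "p \<in> {1..3}" "n \<in> {1..3}" for p n
        by (rule lmul_Om[OF B[OF that] bas_cz_Om[OF that]])
      have "\<Psi> (bas (\<omega> m) m) = (\<Sum>p\<in>{1..3}. \<Psi> (\<Sum>n\<in>{1..3}. lmul (\<omega> m \<star> tz m p n) (bas (cz m p n) m)))"
        unfolding bas_cz_expand[OF OmD[OF \<omega>]]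
        by (rule sum) (rule cvec.subspace_sum[OF Omw_subspace mem])
      also have "\<dots> = (\<Sum>p\<in>{1..3}. \<Sum>n\<in>{1..3}. \<Psi> (lmul (\<omega> m \<star> tz m p n) (bas (cz m p n) m)))"
        by (intro sum.cong refl sum mem)
      finally show "\<Psi> (bas (\<omega> m) m) = (\<Sum>p\<in>{1..3}. \<Sum>n\<in>{1..3}. \<Psi> (lmul (\<omega> m \<star> tz m p n) (bas (cz m p n) m)))" .
    qed
    finally have "\<Psi> \<omega> l k 1 = (\<Sum>m\<in>UNIV. \<Sum>p\<in>{1..3}. \<Sum>n\<in>{1..3}. \<Psi> (lmul (\<omega> m \<star> tz m p n) (bas (cz m p n) m)) l k 1)"
      by (simp only: sum_fun_apply)
    also have "\<dots> = (\<Sum>m\<in>UNIV. \<Sum>p\<in>{1..3}. \<Sum>n\<in>{1..3}. \<omega> m 1 * (tz m p n 1 * \<Psi> (bas (cz m p n) m) l k 1))"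
      by (intro sum.cong refl) (simp only: lin[OF B bas_cz_Om], simp only: lmul_def conv_one mult.assoc)
    also have "\<dots> = (\<Sum>m\<in>UNIV. C m l k * \<omega> m 1)"
      unfolding C_def by (simp only: sum_distrib_left mult.commute[of _ "\<omega> _ 1"])
    finally show ?thesis .
  qed
  have form: "\<Psi> \<omega> l k = (\<Sum>m\<in>UNIV. C m l k *\<^sub>C \<omega> m)" if \<omega>: "\<omega> \<in> Om" for \<omega> l k
  proof
    fix x
    obtain I a \<eta> where s: "splits \<omega> I a \<eta>" using splits_exists[OF \<omega>] .
    have i: "\<eta> i \<in> Om" if "i \<in> I" for i using s that by (simp add: splits_def)
    have sp: "\<omega> m (x * y) = (\<Sum>i\<in>I. a i x * \<eta> i m y)" for m y using s unfolding splits_def by blast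
    \<comment> \<open>Covariance carries the formula from the fibre over the counit to every
      \<open>x\<close>.\<close>
    have "\<Psi> \<omega> l k (x * 1) = (\<Sum>i\<in>I. a i x * \<Psi> (\<eta> i) l k 1)" by (rule cov[OF \<omega> s])
    also have "\<dots> = (\<Sum>i\<in>I. \<Sum>m\<in>UNIV. C m l k * (a i x * \<eta> i m 1))"
      by (intro sum.cong refl) (simp only: fib[OF i] sum_distrib_left mult.left_commute)
    also have "\<dots> = (\<Sum>m\<in>UNIV. \<Sum>i\<in>I. C m l k * (a i x * \<eta> i m 1))" by (rule sum.swap)
    also have "\<dots> = (\<Sum>m\<in>UNIV. C m l k * \<omega> m (x * 1))"
      by (simp only: sp sum_distrib_left)
    finally show "\<Psi> \<omega> l k x = (\<Sum>m\<in>UNIV. C m l k *\<^sub>C \<omega> m) x"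
      by (simp only: mult_1_right sum_fun_apply scaleC_fun_apply scaleC_complex_def)
  qed
  \<comment> \<open>On a test form \<Psi> has a component that is a multiple of a function of weight
    \<open>wt m\<close> and yet has weight \<open>wt l + wt k\<close>; a nonzero function has only
    one weight.\<close>
  have supp: "wt m = wt l + wt k" if "C m l k \<noteq> 0" for m l k
  proof (rule Aw_disjoint)
    let ?a = "cz m (top_ix m) (bot_ix m)"
    let ?\<omega> = "bas ?a m"
    have \<omega>: "?\<omega> \<in> Om" by (rule bas_cz_Om[OF ix_123])
    have "\<Psi> ?\<omega> l k = (\<Sum>j\<in>UNIV. if j = m then C m l k *\<^sub>C ?a else 0)"
      unfolding form[OF \<omega>] by (intro sum.cong refl) (simp add: bas_def)
    also have "\<dots> = C m l k *\<^sub>C ?a" by simp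
    finally have eq: "\<Psi> ?\<omega> l k = C m l k *\<^sub>C ?a" .
    have "\<Psi> ?\<omega> l k \<in> Aw (wt l + wt k)" using WW[OF \<omega>] unfolding WW_def Omw_def by blast
    then show "C m l k *\<^sub>C ?a \<in> Aw (wt l + wt k)" unfolding eq .
    show "C m l k *\<^sub>C ?a \<in> Aw (wt m)" by (rule Aw_scale[OF cz_Aw[OF ix_123]])
    have "(C m l k *\<^sub>C ?a) 1 = C m l k"
      by (simp add: cz_def conv_one U_one V_one scaleC_fun_apply scaleC_complex_def)
    then show "C m l k *\<^sub>C ?a \<noteq> 0" using that by auto
  qed
  define c where "c i = (case i of (m, b) \<Rightarrow> if b then C m (pr2 m) (pr1 m) else C m (pr1 m) (pr2 m))" for i :: "tix \<times> bool"
  have pcC: "pc l k c m = C m l k" for l k m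
  proof (cases "wt m = wt l + wt k")
    case True
    then consider "l = pr1 m" "k = pr2 m" | "l = pr2 m" "k = pr1 m"
      using wt_sum_iff[of m l k] by blast
    then show ?thesis using pr_neq[of m] by cases (simp_all add: pc_def c_def)
  next
    case False
    then have "\<not> (l = pr2 m \<and> k = pr1 m)" "\<not> (l = pr1 m \<and> k = pr2 m)"
      using wt_sum_iff[of m l k] by blast+
    then have "pc l k c m = 0" unfolding pc_def by (simp only: of_bool_eq mult_zero_left add_0)
    then show ?thesis using supp[of m l k] False by auto
  qed
  have "\<Psi> \<omega> = Phi c \<omega>" if "\<omega> \<in> Om" for \<omega>
    by (intro ext[where f = "\<Psi> \<omega>"] ext) (simp only: form[OF that] Phi_def pcC)
  then show thesis by (rule that)
qed

text \<open>In the difference with \<open>Dc 0\<close> the term \<open>db \<otimes> \<omega>\<close>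
  cancels, leaving a covariant left linear map to which the classification applies.\<close>

lemma covariant_connection_Dc:
  assumes con: "connection q D" and cov: "left_covariant q D"
  obtains c where "D = Dc c"
proof -
  note D = connectionD[OF con]
  define \<Psi> where "\<Psi> \<omega> = mu (D \<omega>) - mu (Dc 0 \<omega>)" for \<omega>
  note D0 = connectionD[OF Dc_connection[of 0]]
  have at: "(\<Theta> - \<Theta>') l = \<Theta> l - \<Theta>' l" for \<Theta> \<Theta>' :: "tix \<Rightarrow> form" and l by simp
  have lmul_diff: "lmul b (\<omega> - \<eta>) = lmul b \<omega> - lmul b \<eta>" for b \<omega> \<eta>
    by (rule ext) (simp add: lmul_def conv_diff_right)
  obtain c where c: "\<And>\<omega>. \<omega> \<in> Om \<Longrightarrow> \<Psi> \<omega> = Phi c \<omega>"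
  proof (rule covariant_linear_classify[of \<Psi>])
    show "\<Psi> \<omega> \<in> WW" if "\<omega> \<in> Om" for \<omega>
      unfolding \<Psi>_def using that by (intro cvec.subspace_diff[OF WW_subspace] mu_WW TT_singles D D0)
    show "\<Psi> (\<omega> + \<eta>) = \<Psi> \<omega> + \<Psi> \<eta>" if "\<omega> \<in> Om" "\<eta> \<in> Om" for \<omega> \<eta>
      unfolding \<Psi>_def D(3)[OF that] D0(3)[OF that] clinear_add[OF clinear_mu] by (rule add_diff_add)
    show "\<Psi> (lmul b \<omega>) l = lmul b (\<Psi> \<omega> l)" if b: "b \<in> Aw 0" and \<omega>: "\<omega> \<in> Om" for b \<omega> l
      unfolding \<Psi>_def D(5)[OF b \<omega>] D0(5)[OF b \<omega>] clinear_add[OF clinear_mu] add_diff_cancel_left at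
        mu_lmul2[OF D(2)[OF \<omega>] b] mu_lmul2[OF D0(2)[OF \<omega>] b] lmul_diff by (rule refl)
    fix \<omega> I a \<eta> l k x y assume \<omega>: "\<omega> \<in> Om" and s: "splits \<omega> I a \<eta>"
    have 1: "mu (D \<omega>) l k (x * y) = (\<Sum>i\<in>I. a i x * mu (D (\<eta> i)) l k y)"
      using cov left_covariant_iff[of D, OF D(2) D(3) D(4)] \<omega> s by blast
    have 2: "mu (Dc 0 \<omega>) l k (x * y) = (\<Sum>i\<in>I. a i x * mu (Dc 0 (\<eta> i)) l k y)"
      using Dc_left_covariant left_covariant_iff[of "Dc 0", OF D0(2) D0(3) D0(4)] \<omega> s by blast
    show "\<Psi> \<omega> l k (x * y) = (\<Sum>i\<in>I. a i x * \<Psi> (\<eta> i) l k y)"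
      by (simp add: \<Psi>_def 1 2 right_diff_distrib sum_subtractf)
  qed blast
  have P0: "Phi 0 \<omega> = 0" for \<omega>
    by (intro ext) (simp add: Phi_def pc_def sum_fun_apply)
  have "D \<omega> = Dc c \<omega>" for \<omega>
  proof (cases "\<omega> \<in> Om")
    case True
    have "mu (D \<omega>) = mu (Dc 0 \<omega>) + \<Psi> \<omega>" unfolding \<Psi>_def by (simp only: add_diff_eq add_diff_cancel_left')
    also have "\<dots> = mu (Dc c \<omega>)" unfolding mu_Dc[OF True] P0 c[OF True] by (simp only: add_0_right)
    finally show ?thesis by (rule mu_inj[OF D(2)[OF True] Dc_Om[OF True]])
  next
    case False
    then show ?thesis using D(1) D0(1) connectionD(1)[OF Dc_connection] by simp
  qed
  then show thesis using that by blast
qed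

theorem covariant_connections_dim: "has_affine_dim {D. connection q D \<and> left_covariant q D} 12"
proof -
  have "has_affine_dim {D. connection q D \<and> left_covariant q D} (card (UNIV :: (tix \<times> bool) set))"
  proof (rule has_affine_dimI[where v = Vc and ?x0.0 = "Dc 0"])
    show "c i = 0" if "(\<Sum>i\<in>UNIV. c i *\<^sub>C Vc i) = 0" for c i by (rule Vc_independent[OF that])
    show "{D. connection q D \<and> left_covariant q D} = {Dc 0 + (\<Sum>i\<in>UNIV. c i *\<^sub>C Vc i) |c. True}"
    proof (intro subset_antisym subsetI)
      fix D assume "D \<in> {D. connection q D \<and> left_covariant q D}"
      then obtain c where "D = Dc c" using covariant_connection_Dc by blast
      then have "D = Dc 0 + (\<Sum>i\<in>UNIV. c i *\<^sub>C Vc i)"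
        using Dc_expand[of c 0] by (simp only: zero_fun_apply diff_0_right)
      then show "D \<in> {Dc 0 + (\<Sum>i\<in>UNIV. c i *\<^sub>C Vc i) |c. True}" by (intro CollectI exI[of _ c] conjI TrueI)
    next
      fix D assume "D \<in> {Dc 0 + (\<Sum>i\<in>UNIV. c i *\<^sub>C Vc i) |c. True}"
      then obtain c where "D = Dc 0 + (\<Sum>i\<in>UNIV. c i *\<^sub>C Vc i)" by blast
      then have "D = Dc c"
        using Dc_expand[of c 0] by (simp only: zero_fun_apply diff_0_right)
      then show "D \<in> {D. connection q D \<and> left_covariant q D}"
        using Dc_connection Dc_left_covariant by blast
    qed
  qed simp
  moreover have "card (UNIV :: (tix \<times> bool) set) = 12"
    by (simp add: UNIV_Times_UNIV[symmetric] card_cartesian_product UNIV_tix del: UNIV_Times_UNIV)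
  ultimately show ?thesis by simp
qed

end

lemma clinear_kernel: "clinear f \<Longrightarrow> cvec.subspace {t. f t = 0}"
  by (auto simp: cvec.subspace_def clinear_zero clinear_add clinear_scale)

context quantum_flag
begin

section \<open>The maximal prolongation and torsion\<close>

abbreviation P2 :: "form2 set" where "P2 \<equiv> prolong_rels q"

lemma P2_subspace: "cvec.subspace P2"
  by (simp add: prolong_rels_def cvec.subspace_span)

lemma dd_Om: "b \<in> Aw 0 \<Longrightarrow> dd q b \<in> Om"
  by (rule dd_Omw)

lemma counit_T: "counit (T k) = 0"
  by (cases k rule: tix_cases)
    (simp_all add: star_gn star_E12 clinear_diff[OF clinear_counit] clinear_scale[OF clinear_counit] counit_mult
      counit_gn scaleC_complex_def)

lemma dd_counit: "dd q counit = 0"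
  by (rule ext) (simp add: dd_def act_counit counit_T del: tangent.simps)

lemma tensB_zero_left: "\<eta> \<in> Om \<Longrightarrow> tensB q 0 \<eta> = 0"
  using tensB_scale_left[OF cvec.subspace_0[OF Omw_subspace], of \<eta> 0] by (simp del: zero_fun_apply)

lemma tensB_sum_left:
  assumes "\<eta> \<in> Om" "\<And>i. i \<in> I \<Longrightarrow> f i \<in> Om"
  shows "tensB q (\<Sum>i\<in>I. f i) \<eta> = (\<Sum>i\<in>I. tensB q (f i) \<eta>)"
  using assms(2)
proof (induction I rule: infinite_finite_induct)
  case (insert i I)
  have I: "(\<Sum>i\<in>I. f i) \<in> Om" by (rule cvec.subspace_sum[OF Omw_subspace]) (use insert in blast)
  have i: "f i \<in> Om" and IH: "tensB q (\<Sum>i\<in>I. f i) \<eta> = (\<Sum>i\<in>I. tensB q (f i) \<eta>)" using insert by blast+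
  show ?case unfolding sum.insert[OF insert.hyps] tensB_add_left[OF i I assms(1)] IH by (rule refl)
qed (simp_all add: tensB_zero_left[OF assms(1)] del: zero_fun_apply)

lemma tensB_diff_left: "\<omega> \<in> Om \<Longrightarrow> \<omega>' \<in> Om \<Longrightarrow> \<eta> \<in> Om \<Longrightarrow> tensB q (\<omega> - \<omega>') \<eta> = tensB q \<omega> \<eta> - tensB q \<omega>' \<eta>"
  using tensB_add_left[of \<omega> "(-1) *\<^sub>C \<omega>'" \<eta>] tensB_scale_left[of \<omega>' \<eta> "-1"] cvec.subspace_scale[OF Omw_subspace, of \<omega>' 0 "-1"]
  by (simp del: plus_fun_apply)

lemma tensB_diff_right: "\<omega> \<in> Om \<Longrightarrow> \<eta> \<in> Om \<Longrightarrow> \<eta>' \<in> Om \<Longrightarrow> tensB q \<omega> (\<eta> - \<eta>') = tensB q \<omega> \<eta> - tensB q \<omega> \<eta>'"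
  using tensB_add_right[of \<omega> \<eta> "(-1) *\<^sub>C \<eta>'"] tensB_scale_right[of \<omega> \<eta>' "-1"] cvec.subspace_scale[OF Omw_subspace, of \<eta>' 0 "-1"]
  by (simp del: plus_fun_apply)

text \<open>The right action on the second factor respects the balancing because left and right
  actions commute.\<close>

lemma rmul2_tensB:
  assumes "\<omega> \<in> Om" "\<eta> \<in> Om" and b: "b \<in> Aw 0"
  shows "rmul2 q (tensB q \<omega> \<eta>) b = tensB q \<omega> (rmul q \<eta> b)"
proof -
  have kill: "lext (\<lambda>(\<omega>, \<eta>). tensB q \<omega> (rmul q \<eta> b)) r = 0" if "r \<in> relsB q" for r
    using that unfolding relsB_def Om1_eq OF3_eq
  proof
    assume "r \<in> bilinear_rels Om Om"
    moreover have "bilin_on Om Om (\<lambda>\<omega> \<eta>. tensB q \<omega> (rmul q \<eta> b))"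
      using tensB_bilin rmul_Om[OF b] unfolding bilin_on_def
      by (simp add: rmul_add_left rmul_scale_left del: plus_fun_apply zero_fun_apply)
    ultimately show ?thesis by (intro lext_bilinear_rels)
  next
    assume "r \<in> balanced_rels (Aw 0) (rmul q) lmul Om Om"
    then obtain \<omega> b' \<eta> where r: "\<omega> \<in> Om" "b' \<in> Aw 0" "\<eta> \<in> Om"
      "r = Poly_Mapping.single (rmul q \<omega> b', \<eta>) 1 - Poly_Mapping.single (\<omega>, lmul b' \<eta>) 1"
      unfolding balanced_rels_def by blast
    have "lmul b' (rmul q \<eta> b) = rmul q (lmul b' \<eta>) b"
      by (rule lmul_rmul[OF Omw_A[OF r(3)] Aw_A[OF r(2)] Aw_A[OF b]])
    then have "tensB q (rmul q \<omega> b') (rmul q \<eta> b) = tensB q \<omega> (rmul q (lmul b' \<eta>) b)"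
      using tensB_balanced[OF r(1,2) rmul_Om[OF b r(3)]] by simp
    then show ?thesis by (simp add: r(4) lext_diff scaleC_one)
  qed
  have eq: "tensB q \<omega> \<eta> = tens (relsB q) \<omega> \<eta>" by (simp add: tensB_def)
  have "lext (\<lambda>(\<omega>, \<eta>). tensB q \<omega> (rmul q \<eta> b)) (tens (relsB q) \<omega> \<eta>) =
      (case (\<omega>, \<eta>) of (\<omega>, \<eta>) \<Rightarrow> tensB q \<omega> (rmul q \<eta> b))"
    by (rule lext_tens) (rule kill)
  then show ?thesis unfolding rmul2_def eq by (simp only: prod.case)
qed

lemma lmul2_counit: "t \<in> TT \<Longrightarrow> lmul2 q counit t = t"
proof (rule mu_inj[OF lmul2_TT])
  assume t: "t \<in> TT"
  have A: "mu t l k \<in> A" for l k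
    using mu_WW[OF TT_singles[OF t]] Omw_A unfolding WW_def by blast
  show "mu (lmul2 q counit t) = mu t"
    by (rule ext) (simp only: mu_lmul2[OF t Aw_counit] lmul_counit A)
qed (simp_all add: Aw_counit)

lemma lmul2_lmul2:
  assumes t: "t \<in> TT" and b: "b \<in> Aw 0" and c: "c \<in> Aw 0"
  shows "lmul2 q b (lmul2 q c t) = lmul2 q (b \<star> c) t"
proof (rule mu_inj)
  have bc: "b \<star> c \<in> Aw 0" by (rule Aw_conv'[OF b c]) simp
  have A: "mu t l k \<in> A" for l k
    using mu_WW[OF TT_singles[OF t]] Omw_A unfolding WW_def by blast
  show "mu (lmul2 q b (lmul2 q c t)) = mu (lmul2 q (b \<star> c) t)"
    by (rule ext) (simp only: mu_lmul2[OF lmul2_TT[OF t c] b] mu_lmul2[OF t c] mu_lmul2[OF t bc]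
        lmul_lmul[OF A Aw_A[OF b] Aw_A[OF c]])
  show "lmul2 q b (lmul2 q c t) \<in> TT" by (rule lmul2_TT[OF lmul2_TT[OF t c] b])
  show "lmul2 q (b \<star> c) t \<in> TT" by (rule lmul2_TT[OF t bc])
qed

lemma clinear_lmul2: "clinear (lmul2 q b)"
  by (simp add: lmul2_def lext_linear)

lemma clinear_rmul2: "clinear (\<lambda>t. rmul2 q t b)"
  unfolding rmul2_def by (rule lext_linear)

section \<open>The generators of the prolongation relations\<close>

lemma prolong_gensI:
  assumes "finite I" "\<And>i. i \<in> I \<Longrightarrow> b i \<in> Aw 0 \<and> c i \<in> Aw 0" "(\<Sum>i\<in>I. lmul (b i) (dd q (c i))) = 0"
  shows "(\<Sum>i\<in>I. tensB q (dd q (b i)) (dd q (c i))) \<in> prolong_gens q"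
proof -
  obtain h where h: "bij_betw h {..<card I} I"
    using ex_bij_betw_nat_finite[OF assms(1)] by (auto simp: lessThan_atLeast0)
  note re = sum.reindex_bij_betw[OF h]
  have "(\<Sum>i<card I. lmul (b (h i)) (dd q (c (h i)))) = 0"
    using re[of "\<lambda>i. lmul (b i) (dd q (c i))"] assms(3) by simp
  moreover have "\<forall>i<card I. b (h i) \<in> OF3 q \<and> c (h i) \<in> OF3 q"
    using bij_betwE[OF h] assms(2) unfolding OF3_eq by blast
  moreover have "(\<Sum>i\<in>I. tensB q (dd q (b i)) (dd q (c i))) = (\<Sum>i<card I. tensB q (dd q (b (h i))) (dd q (c (h i))))"
    using re[of "\<lambda>i. tensB q (dd q (b i)) (dd q (c i))"] by simp
  ultimately show ?thesis
    unfolding prolong_gens_def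
    by (intro CollectI exI[of _ "card I"] exI[of _ "\<lambda>i. b (h i)"] exI[of _ "\<lambda>i. c (h i)"] conjI)
qed

lemma prolong_gensE:
  assumes "t \<in> prolong_gens q"
  obtains n b c where "\<And>i. i < (n::nat) \<Longrightarrow> b i \<in> Aw 0 \<and> c i \<in> Aw 0" "(\<Sum>i<n. lmul (b i) (dd q (c i))) = 0"
    "t = (\<Sum>i<n. tensB q (dd q (b i)) (dd q (c i)))"
  using assms unfolding prolong_gens_def OF3_eq by blast

lemma prolong_gens_TT: "t \<in> prolong_gens q \<Longrightarrow> t \<in> TT"
  by (elim prolong_gensE) (auto intro!: cvec.subspace_sum[OF TT_subspace] tensB_TT dd_Om)

lemma neg_Aw: "b \<in> Aw \<alpha> \<Longrightarrow> - b \<in> Aw \<alpha>"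
  using Aw_scale[of b \<alpha> "-1"] by simp

lemma lmul_neg: "lmul (- b) \<omega> = - lmul b \<omega>"
  by (rule ext) (simp add: lmul_def conv_neg_left)

lemma dd_neg: "dd q (- b) = - dd q b"
  by (rule ext) (simp add: dd_def act_neg)

lemma tensB_neg: "\<omega> \<in> Om \<Longrightarrow> \<eta> \<in> Om \<Longrightarrow> tensB q (- \<omega>) \<eta> = - tensB q \<omega> \<eta>"
  using tensB_scale_left[of \<omega> \<eta> "-1"] by simp

lemma clinear_rmul_left: "clinear (\<lambda>\<omega>. rmul q \<omega> e)"
  by (rule clinearI) (rule rmul_add_left, rule rmul_scale_left)

lemma clinear_lmul_right: "clinear (\<lambda>\<omega>. lmul b \<omega>)"
  by (rule clinearI) (rule lmul_add_right, rule lmul_scale_right)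

text \<open>The Leibniz rule turns the right multiple of a generator into another generator.\<close>

lemma rmul2_prolong_gens:
  assumes "t \<in> prolong_gens q" and e: "e \<in> Aw 0"
  shows "rmul2 q t e \<in> prolong_gens q"
proof -
  obtain n b c where bc: "\<And>i. i < (n::nat) \<Longrightarrow> b i \<in> Aw 0 \<and> c i \<in> Aw 0"
    and zero: "(\<Sum>i<n. lmul (b i) (dd q (c i))) = 0"
    and t: "t = (\<Sum>i<n. tensB q (dd q (b i)) (dd q (c i)))"
    by (rule prolong_gensE[OF assms(1)]) blast
  \<comment> \<open>When \<open>\<Sum> b dc = 0\<close>, one has \<open>\<Sum> db \<otimes> (dc) e =
    \<Sum> db \<otimes> d(c e) - \<Sum> d(b c) \<otimes> de\<close>, since the remaining term
    \<open>\<Sum> b dc \<otimes> de\<close> vanishes. The new pairs are therefore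
    \<open>(b, c e)\<close> and \<open>(- b c, e)\<close>.\<close>
  define b' where "b' = case_sum b (\<lambda>i. - (b i \<star> c i))"
  define c' where "c' = case_sum (\<lambda>i. c i \<star> e) (\<lambda>i :: nat. e)"
  have mem: "b i \<in> Aw 0" "c i \<in> Aw 0" "b i \<star> c i \<in> Aw 0" "c i \<star> e \<in> Aw 0" if "i < n" for i
    using bc[OF that] e by (auto intro: Aw_conv')
  have dce: "rmul q (dd q (c i)) e = dd q (c i \<star> e) - lmul (c i) (dd q e)" if "i < n" for i
    unfolding dd_conv[OF Aw_A[OF mem(2)[OF that]] Aw_A[OF e]] by (rule add_diff_cancel_right'[symmetric])
  have dbc: "rmul q (dd q (b i)) (c i) = dd q (b i \<star> c i) - lmul (b i) (dd q (c i))" if "i < n" for i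
    unfolding dd_conv[OF Aw_A[OF mem(1)[OF that]] Aw_A[OF mem(2)[OF that]]] by (rule add_diff_cancel_right'[symmetric])
  have "(\<Sum>i<n. lmul (b i) (rmul q (dd q (c i)) e)) = rmul q (\<Sum>i<n. lmul (b i) (dd q (c i))) e"
  proof -
    have "rmul q (\<Sum>i<n. lmul (b i) (dd q (c i))) e = (\<Sum>i<n. rmul q (lmul (b i) (dd q (c i))) e)"
      by (rule clinear_sum[OF clinear_rmul_left])
    moreover have "lmul (b i) (rmul q (dd q (c i)) e) = rmul q (lmul (b i) (dd q (c i))) e" if "i < n" for i
      by (rule lmul_rmul[OF dd_A[OF Aw_A[OF mem(2)[OF that]]] Aw_A[OF mem(1)[OF that]] Aw_A[OF e]])
    ultimately show ?thesis by simp
  qed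
  also have "\<dots> = 0" unfolding zero using rmul_scale_left[of 0 0 e] by (simp del: zero_fun_apply)
  finally have z: "(\<Sum>i<n. lmul (b i) (rmul q (dd q (c i)) e)) = 0" .
  have lz: "lmul (b i) (rmul q (dd q (c i)) e) = lmul (b i) (dd q (c i \<star> e)) + lmul (- (b i \<star> c i)) (dd q e)" if "i < n" for i
  proof -
    have "lmul (b i) (dd q (c i \<star> e) - lmul (c i) (dd q e)) = lmul (b i) (dd q (c i \<star> e)) - lmul (b i) (lmul (c i) (dd q e))"
      by (rule clinear_diff[OF clinear_lmul_right])
    then show ?thesis
      unfolding dce[OF that] lmul_neg
        lmul_lmul[OF dd_A[OF Aw_A[OF e]] Aw_A[OF mem(1)[OF that]] Aw_A[OF mem(2)[OF that]]] by simp
  qed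
  have "(\<Sum>i\<in>{..<n} <+> {..<n}. tensB q (dd q (b' i)) (dd q (c' i))) \<in> prolong_gens q"
  proof (rule prolong_gensI)
    show "b' i \<in> Aw 0 \<and> c' i \<in> Aw 0" if "i \<in> {..<n} <+> {..<n}" for i
      using that mem e neg_Aw by (auto simp: b'_def c'_def)
    have "(\<Sum>i\<in>{..<n} <+> {..<n}. lmul (b' i) (dd q (c' i))) =
      (\<Sum>i<n. lmul (b i) (dd q (c i \<star> e)) + lmul (- (b i \<star> c i)) (dd q e))"
      by (simp only: sum.Plus finite_lessThan b'_def c'_def comp_def sum.case sum.distrib)
    also have "\<dots> = (\<Sum>i<n. lmul (b i) (rmul q (dd q (c i)) e))"
      by (rule sum.cong) (use lz in auto)
    finally show "(\<Sum>i\<in>{..<n} <+> {..<n}. lmul (b' i) (dd q (c' i))) = 0" unfolding z .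
  qed simp
  also have "(\<Sum>i\<in>{..<n} <+> {..<n}. tensB q (dd q (b' i)) (dd q (c' i))) =
      (\<Sum>i<n. tensB q (dd q (b i)) (dd q (c i \<star> e)) - tensB q (dd q (b i \<star> c i)) (dd q e))"
  proof -
    have "tensB q (dd q (- (b i \<star> c i))) (dd q e) = - tensB q (dd q (b i \<star> c i)) (dd q e)" if "i < n" for i
      unfolding dd_neg by (rule tensB_neg[OF dd_Om[OF mem(3)[OF that]] dd_Om[OF e]])
    then show ?thesis
      by (simp add: sum.Plus b'_def c'_def comp_def sum_negf sum_subtractf del: plus_fun_apply)
  qed
  also have "\<dots> = (\<Sum>i<n. tensB q (dd q (b i)) (rmul q (dd q (c i)) e) - tensB q (lmul (b i) (dd q (c i))) (dd q e))"
  proof (intro sum.cong refl)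
    fix i assume "i \<in> {..<n}"
    then have i: "i < n" by simp
    note Om = dd_Om[OF mem(1)[OF i]] dd_Om[OF mem(2)[OF i]] dd_Om[OF e]
    have "tensB q (dd q (b i)) (rmul q (dd q (c i)) e) =
        tensB q (dd q (b i)) (dd q (c i \<star> e)) - tensB q (dd q (b i)) (lmul (c i) (dd q e))"
      unfolding dce[OF i] by (rule tensB_diff_right[OF Om(1) dd_Om[OF mem(4)[OF i]] lmul_Om[OF mem(2)[OF i] Om(3)]])
    also have "tensB q (dd q (b i)) (lmul (c i) (dd q e)) = tensB q (rmul q (dd q (b i)) (c i)) (dd q e)"
      by (rule tensB_balanced[OF Om(1) mem(2)[OF i] Om(3), symmetric])
    also have "\<dots> = tensB q (dd q (b i \<star> c i)) (dd q e) - tensB q (lmul (b i) (dd q (c i))) (dd q e)"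
      unfolding dbc[OF i] by (rule tensB_diff_left[OF dd_Om[OF mem(3)[OF i]] lmul_Om[OF mem(1)[OF i] Om(2)] Om(3)])
    finally show "tensB q (dd q (b i)) (dd q (c i \<star> e)) - tensB q (dd q (b i \<star> c i)) (dd q e) =
        tensB q (dd q (b i)) (rmul q (dd q (c i)) e) - tensB q (lmul (b i) (dd q (c i))) (dd q e)"
      by (simp add: algebra_simps)
  qed
  also have "\<dots> = (\<Sum>i<n. tensB q (dd q (b i)) (rmul q (dd q (c i)) e)) - tensB q (\<Sum>i<n. lmul (b i) (dd q (c i))) (dd q e)"
  proof -
    have "tensB q (\<Sum>i<n. lmul (b i) (dd q (c i))) (dd q e) = (\<Sum>i<n. tensB q (lmul (b i) (dd q (c i))) (dd q e))"
      by (rule tensB_sum_left[OF dd_Om[OF e]]) (auto intro!: lmul_Om dd_Om mem)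
    then show ?thesis by (simp only: sum_subtractf)
  qed
  also have "\<dots> = rmul2 q t e"
    unfolding zero tensB_zero_left[OF dd_Om[OF e]] diff_0_right t clinear_sum[OF clinear_rmul2]
    by (rule sum.cong) (auto intro!: rmul2_tensB[symmetric] dd_Om mem e)
  finally show ?thesis .
qed

lemma rmul2_counit:
  assumes "t \<in> prolong_gens q"
  shows "rmul2 q t counit = t"
proof -
  obtain n b c where bc: "\<And>i. i < (n::nat) \<Longrightarrow> b i \<in> Aw 0 \<and> c i \<in> Aw 0"
    and t: "t = (\<Sum>i<n. tensB q (dd q (b i)) (dd q (c i)))"
    by (rule prolong_gensE[OF assms]) blast
  have "rmul2 q (tensB q (dd q b) (dd q c)) counit = tensB q (dd q b) (dd q c)" if "b \<in> Aw 0" "c \<in> Aw 0" for b c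
    unfolding rmul2_tensB[OF dd_Om[OF that(1)] dd_Om[OF that(2)] Aw_counit] rmul_counit[OF dd_A[OF Aw_A[OF that(2)]]]
    by (rule refl)
  then show ?thesis unfolding t clinear_sum[OF clinear_rmul2] using bc by (intro sum.cong) auto
qed

lemma gens_P2: "t \<in> prolong_gens q \<Longrightarrow> t \<in> P2"
proof -
  assume t: "t \<in> prolong_gens q"
  have "lmul2 q counit (rmul2 q t counit) \<in> P2"
    unfolding prolong_rels_def OF3_eq by (rule cvec.span_base) (use t Aw_counit in blast)
  then show ?thesis by (simp add: rmul2_counit[OF t] lmul2_counit[OF prolong_gens_TT[OF t]])
qed

text \<open>Right multiples of generators are again generators, so left multiples suffice to
  span.\<close>

lemma P2_induct:
  assumes "t \<in> P2" "cvec.subspace S" "\<And>b t. b \<in> Aw 0 \<Longrightarrow> t \<in> prolong_gens q \<Longrightarrow> lmul2 q b t \<in> S"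
  shows "t \<in> S"
proof -
  have "P2 \<subseteq> S"
    unfolding prolong_rels_def OF3_eq
    by (rule cvec.span_minimal[OF _ assms(2)]) (use assms(3) rmul2_prolong_gens in blast)
  then show ?thesis using assms(1) by blast
qed

lemma P2_TT: "t \<in> P2 \<Longrightarrow> t \<in> TT"
  by (erule P2_induct[OF _ TT_subspace]) (rule lmul2_TT[OF prolong_gens_TT])

lemma lmul2_P2:
  assumes "t \<in> P2" and b: "b \<in> Aw 0"
  shows "lmul2 q b t \<in> P2"
proof -
  have "cvec.subspace {t. lmul2 q b t \<in> P2}"
    unfolding cvec.subspace_def
    by (auto simp: clinear_zero[OF clinear_lmul2] clinear_add[OF clinear_lmul2] clinear_scale[OF clinear_lmul2]
        cvec.subspace_0[OF P2_subspace] cvec.subspace_add[OF P2_subspace] cvec.subspace_scale[OF P2_subspace])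
  then have "t \<in> {t. lmul2 q b t \<in> P2}"
  proof (rule P2_induct[OF assms(1)])
    fix b' t assume b': "b' \<in> Aw 0" and t: "t \<in> prolong_gens q"
    have "lmul2 q b (lmul2 q b' t) = lmul2 q (b \<star> b') (rmul2 q t counit)"
      by (simp add: lmul2_lmul2[OF prolong_gens_TT[OF t] b b'] rmul2_counit[OF t])
    moreover have "lmul2 q (b \<star> b') (rmul2 q t counit) \<in> P2"
    proof -
      have "b \<star> b' \<in> Aw 0" by (rule Aw_conv'[OF b b']) simp
      then show ?thesis
        unfolding prolong_rels_def OF3_eq by (intro cvec.span_base) (use t Aw_counit in blast)
    qed
    ultimately show "lmul2 q b' t \<in> {t. lmul2 q b t \<in> P2}" by simp
  qed
  then show ?thesis by simp
qed

text \<open>Applying \<open>T k\<close> to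
  \<open>\<Sum>i. b i (T l \<triangleright> c i) = 0\<close> turns the components of a generator
  into minus \<open>\<Sum>i. b i (T k \<triangleright> T l \<triangleright> c i)\<close>. The
  quadratic relation reduces their combination to the vanishing sum for \<open>T m\<close>.\<close>

lemma P2_relation:
  assumes "t \<in> P2"
  shows "mu t (pr2 m) (pr1 m) + xr m *\<^sub>C mu t (pr1 m) (pr2 m) = 0"
proof -
  let ?V = "{t. mu t (pr2 m) (pr1 m) + xr m *\<^sub>C mu t (pr1 m) (pr2 m) = 0}"
  have V: "cvec.subspace ?V"
  proof -
    have "clinear (\<lambda>t. mu t (pr2 m) (pr1 m) + xr m *\<^sub>C mu t (pr1 m) (pr2 m))"
      by (rule clinearI) (auto simp: clinear_add[OF clinear_mu] clinear_scale[OF clinear_mu] fun_eq_iff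
          scaleC_fun_apply scaleC_complex_def algebra_simps)
    then show ?thesis by (rule clinear_kernel)
  qed
  have "t \<in> ?V"
  proof (rule P2_induct[OF assms V])
    fix e t assume e: "e \<in> Aw 0" and t: "t \<in> prolong_gens q"
    obtain n b c where bc: "\<And>i. i < (n::nat) \<Longrightarrow> b i \<in> Aw 0 \<and> c i \<in> Aw 0"
      and zero: "(\<Sum>i<n. lmul (b i) (dd q (c i))) = 0"
      and teq: "t = (\<Sum>i<n. tensB q (dd q (b i)) (dd q (c i)))"
      by (rule prolong_gensE[OF t]) blast
    have z: "(\<Sum>i<n. b i \<star> (T l \<triangleright> c i)) = 0" for l
      using fun_cong[OF zero, of l] by (simp only: sum_fun_apply lmul_def dd_def zero_fun_apply)
    have mu: "mu t l k = - (\<Sum>i<n. b i \<star> (T k \<triangleright> T l \<triangleright> c i))" for l k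
    proof -
      have e: "rmul q (dd q (b i)) (dd q (c i) l) k = (T k \<triangleright> (b i \<star> (T l \<triangleright> c i))) - b i \<star> (T k \<triangleright> T l \<triangleright> c i)" if "i < n" for i
        using fun_cong[OF dd_conv[OF Aw_A A_act[OF Aw_A]], of "b i" 0 "c i" 0 "T l" k] bc[OF that]
        by (simp add: dd_def lmul_def del: tangent.simps)
      have m: "mu t l k = (\<Sum>i<n. rmul q (dd q (b i)) (dd q (c i) l) k)"
        unfolding teq clinear_sum[OF clinear_mu] mu_tensB by (rule ext) (simp only: sum_fun_apply)
      have "mu t l k = (\<Sum>i<n. (T k \<triangleright> (b i \<star> (T l \<triangleright> c i))) - b i \<star> (T k \<triangleright> T l \<triangleright> c i))"
        unfolding m by (rule sum.cong[OF refl e]) (simp only: lessThan_iff)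
      also have "\<dots> = T k \<triangleright> (\<Sum>i<n. b i \<star> (T l \<triangleright> c i)) - (\<Sum>i<n. b i \<star> (T k \<triangleright> T l \<triangleright> c i))"
        by (simp only: sum_subtractf act_sum)
      finally show ?thesis unfolding z act_zero diff_0 .
    qed
    have "(\<Sum>i<n. b i \<star> (T (pr1 m) \<triangleright> T (pr2 m) \<triangleright> c i)) + xr m *\<^sub>C (\<Sum>i<n. b i \<star> (T (pr2 m) \<triangleright> T (pr1 m) \<triangleright> c i))
        = (\<Sum>i<n. b i \<star> (T (pr1 m) \<triangleright> T (pr2 m) \<triangleright> c i + xr m *\<^sub>C (T (pr2 m) \<triangleright> T (pr1 m) \<triangleright> c i)))"
      by (simp only: cvec.scale_sum_right sum.distrib conv_add_right conv_scale_right)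
    also have "\<dots> = (\<Sum>i<n. kr m *\<^sub>C (b i \<star> (T m \<triangleright> c i)))"
      by (rule sum.cong[OF refl]) (use bc in \<open>simp only: lessThan_iff T_relation conv_scale_right\<close>)
    also have "\<dots> = 0" unfolding cvec.scale_sum_right[symmetric] z by (rule cvec.scale_zero_right)
    finally have r: "mu t (pr2 m) (pr1 m) + xr m *\<^sub>C mu t (pr1 m) (pr2 m) = 0"
      unfolding mu by (simp only: cvec.scale_minus_right minus_add_distrib[symmetric] neg_equal_0_iff_equal)
    have "mu (lmul2 q e t) l k = e \<star> mu t l k" for l k
      using mu_lmul2[OF prolong_gens_TT[OF t] e] by (simp add: lmul_def)
    then have "mu (lmul2 q e t) (pr2 m) (pr1 m) + xr m *\<^sub>C mu (lmul2 q e t) (pr1 m) (pr2 m) =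
        e \<star> (mu t (pr2 m) (pr1 m) + xr m *\<^sub>C mu t (pr1 m) (pr2 m))"
      by (simp only: conv_add_right conv_scale_right)
    then show "lmul2 q e t \<in> ?V" unfolding r by (simp only: conv_zero_right mem_Collect_eq)
  qed
  then show ?thesis by blast
qed

section \<open>The exterior derivative, and torsion on exact forms\<close>

lemma connection_sum:
  assumes "connection q D" "\<And>i. i \<in> I \<Longrightarrow> b i \<in> Aw 0 \<and> c i \<in> Aw 0"
  shows "D (\<Sum>i\<in>I. lmul (b i) (dd q (c i))) =
    (\<Sum>i\<in>I. tensB q (dd q (b i)) (dd q (c i))) + (\<Sum>i\<in>I. lmul2 q (b i) (D (dd q (c i))))"
  using assms(2)
proof (induction I rule: infinite_finite_induct)
  case (insert i I)
  note D = connectionD[OF assms(1)]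
  have i: "b i \<in> Aw 0" "c i \<in> Aw 0" and IH: "D (\<Sum>i\<in>I. lmul (b i) (dd q (c i))) =
    (\<Sum>i\<in>I. tensB q (dd q (b i)) (dd q (c i))) + (\<Sum>i\<in>I. lmul2 q (b i) (D (dd q (c i))))"
    using insert by blast+
  have I: "(\<Sum>i\<in>I. lmul (b i) (dd q (c i))) \<in> Om"
    by (rule cvec.subspace_sum[OF Omw_subspace], rule lmul_Om[OF _ dd_Om]) (use insert in blast)+
  show ?case
    unfolding sum.insert[OF insert.hyps] D(3)[OF lmul_Om[OF i(1) dd_Om[OF i(2)]] I]
      D(5)[OF i(1) dd_Om[OF i(2)]] IH by (simp only: add_ac)
next
  case empty
  have "D (0 *\<^sub>C 0) = 0 *\<^sub>C D 0" by (rule connectionD(4)[OF assms(1) cvec.subspace_0[OF Omw_subspace]])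
  then show ?case by (simp only: sum.empty cvec.scale_zero_left add_0)
next
  case (infinite I)
  have "D (0 *\<^sub>C 0) = 0 *\<^sub>C D 0" by (rule connectionD(4)[OF assms(1) cvec.subspace_0[OF Omw_subspace]])
  then show ?case using infinite(1) by (simp only: sum.infinite cvec.scale_zero_left add_0 not_False_eq_True)
qed

text \<open>The first representation together with the second, its coefficients negated, represents
  zero and so yields a generator. Hence the derivative of a one-form is well defined.\<close>

lemma reps_unique:
  assumes "finite I" "finite J" "\<And>i. i \<in> I \<Longrightarrow> b i \<in> Aw 0 \<and> c i \<in> Aw 0" "\<And>j. j \<in> J \<Longrightarrow> b' j \<in> Aw 0 \<and> c' j \<in> Aw 0"
    "(\<Sum>i\<in>I. lmul (b i) (dd q (c i))) = (\<Sum>j\<in>J. lmul (b' j) (dd q (c' j)))"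
  shows "(\<Sum>i\<in>I. tensB q (dd q (b i)) (dd q (c i))) - (\<Sum>j\<in>J. tensB q (dd q (b' j)) (dd q (c' j))) \<in> P2"
proof -
  define f where "f = case_sum b (\<lambda>j. - b' j)"
  define g where "g = case_sum c c'"
  have "(\<Sum>i\<in>I <+> J. tensB q (dd q (f i)) (dd q (g i))) \<in> P2"
  proof (rule gens_P2[OF prolong_gensI])
    show "f i \<in> Aw 0 \<and> g i \<in> Aw 0" if "i \<in> I <+> J" for i
      using that assms(3,4) neg_Aw by (auto simp: f_def g_def)
    show "(\<Sum>i\<in>I <+> J. lmul (f i) (dd q (g i))) = 0"
      using assms(5) by (simp only: sum.Plus assms(1,2) f_def g_def comp_def sum.case lmul_neg sum_negf add.right_inverse)
  qed (simp add: assms)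
  also have "(\<Sum>i\<in>I <+> J. tensB q (dd q (f i)) (dd q (g i))) =
      (\<Sum>i\<in>I. tensB q (dd q (b i)) (dd q (c i))) + (\<Sum>j\<in>J. tensB q (- dd q (b' j)) (dd q (c' j)))"
    by (simp only: sum.Plus assms(1,2) f_def g_def comp_def sum.case dd_neg)
  also have "(\<Sum>j\<in>J. tensB q (- dd q (b' j)) (dd q (c' j))) = - (\<Sum>j\<in>J. tensB q (dd q (b' j)) (dd q (c' j)))"
    unfolding sum_negf[symmetric]
    by (rule sum.cong[OF refl], rule tensB_neg[OF dd_Om dd_Om]) (use assms(4) in blast)+
  finally show ?thesis by (simp only: diff_conv_add_uminus)
qed

lemma clinear_wedge: "clinear (wedge q)"
  unfolding wedge_def by (rule qmap(1)[OF P2_subspace])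

lemma wedge_eq_iff: "wedge q s = wedge q t \<longleftrightarrow> s - t \<in> P2"
  using qmap(3)[OF P2_subspace, of "s - t"] clinear_diff[OF clinear_wedge, of s t] unfolding wedge_def by simp

lemma dd1_eq:
  assumes "finite I" "\<And>i. i \<in> I \<Longrightarrow> b i \<in> Aw 0 \<and> c i \<in> Aw 0" "\<omega> = (\<Sum>i\<in>I. lmul (b i) (dd q (c i)))"
  shows "dd1 q \<omega> = wedge q (\<Sum>i\<in>I. tensB q (dd q (b i)) (dd q (c i)))"
  unfolding dd1_def OF3_eq
proof (rule the_equality)
  obtain h where h: "bij_betw h {..<card I} I"
    using ex_bij_betw_nat_finite[OF assms(1)] by (auto simp: lessThan_atLeast0)
  note re = sum.reindex_bij_betw[OF h]
  show "\<exists>(n::nat) b' c'. (\<forall>i<n. b' i \<in> Aw 0 \<and> c' i \<in> Aw 0) \<and> \<omega> = (\<Sum>i<n. lmul (b' i) (dd q (c' i))) \<and>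
      wedge q (\<Sum>i\<in>I. tensB q (dd q (b i)) (dd q (c i))) = wedge q (\<Sum>i<n. tensB q (dd q (b' i)) (dd q (c' i)))"
  proof (rule exI[of _ "card I"], rule exI[of _ "\<lambda>i. b (h i)"], rule exI[of _ "\<lambda>i. c (h i)"], intro conjI)
    show "\<forall>i<card I. b (h i) \<in> Aw 0 \<and> c (h i) \<in> Aw 0"
      using bij_betwE[OF h] assms(2) by blast
    show "\<omega> = (\<Sum>i<card I. lmul (b (h i)) (dd q (c (h i))))"
      unfolding assms(3) by (rule re[symmetric])
    show "wedge q (\<Sum>i\<in>I. tensB q (dd q (b i)) (dd q (c i))) =
        wedge q (\<Sum>i<card I. tensB q (dd q (b (h i))) (dd q (c (h i))))"
      by (rule arg_cong[OF re[symmetric]])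
  qed
next
  fix \<theta> assume "\<exists>(n::nat) b' c'. (\<forall>i<n. b' i \<in> Aw 0 \<and> c' i \<in> Aw 0) \<and> \<omega> = (\<Sum>i<n. lmul (b' i) (dd q (c' i))) \<and>
      \<theta> = wedge q (\<Sum>i<n. tensB q (dd q (b' i)) (dd q (c' i)))"
  then obtain n b' c' where *: "\<forall>i<(n::nat). b' i \<in> Aw 0 \<and> c' i \<in> Aw 0" "\<omega> = (\<Sum>i<n. lmul (b' i) (dd q (c' i)))"
      "\<theta> = wedge q (\<Sum>i<n. tensB q (dd q (b' i)) (dd q (c' i)))" by blast
  show "\<theta> = wedge q (\<Sum>i\<in>I. tensB q (dd q (b i)) (dd q (c i)))"
    unfolding *(3) wedge_eq_iff
    by (rule reps_unique[OF finite_lessThan assms(1)]) (use * assms in auto)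
qed

text \<open>Indices for a fixed representation of \<omega> as a sum of \<open>b dc\<close>, the one
  provided by \<open>bas_expand\<close>: \<open>rb\<close> gives the coefficients and
  \<open>rc\<close> the functions.\<close>

definition RI :: "(tix \<times> nat \<times> nat) set" where "RI = UNIV \<times> {1..3} \<times> {1..3}"

definition rb :: "form \<Rightarrow> tix \<times> nat \<times> nat \<Rightarrow> func" where "rb \<omega> = (\<lambda>(k, m, n). \<omega> k \<star> tz k m n)"

definition rc :: "tix \<times> nat \<times> nat \<Rightarrow> func" where "rc = (\<lambda>(k, m, n). yz (zd k) m n)"

lemma RI_sum: "(\<Sum>i\<in>RI. f i) = (\<Sum>k\<in>UNIV. \<Sum>m\<in>{1..3}. \<Sum>n\<in>{1..3}. f (k, m, n))"
  unfolding RI_def by (simp only: sum.cartesian_product split_def prod.collapse)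

lemma R_mem: "\<omega> \<in> Om \<Longrightarrow> i \<in> RI \<Longrightarrow> rb \<omega> i \<in> Aw 0 \<and> rc i \<in> Aw 0"
  unfolding RI_def rb_def rc_def by (auto intro!: tz_coeff_Aw OmD yz_Aw simp del: atLeastAtMost_iff One_nat_def)

lemma finite_RI: "finite RI"
  by (simp add: RI_def)

lemma R_form:
  assumes "\<omega> \<in> Om"
  shows "\<omega> = (\<Sum>i\<in>RI. lmul (rb \<omega> i) (dd q (rc i)))"
proof -
  have "\<omega> = (\<Sum>k\<in>UNIV. bas (\<omega> k) k)" by (rule form_sum_bas)
  also have "\<dots> = (\<Sum>i\<in>RI. lmul (rb \<omega> i) (dd q (rc i)))"
    unfolding RI_sum rb_def rc_def prod.case by (rule sum.cong[OF refl bas_expand[OF OmD[OF assms]]])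
  finally show ?thesis .
qed

text \<open>For \<omega> a sum of \<open>b dc\<close>, the Leibniz rule makes
  \<open>D \<omega>\<close> the sum of \<open>db \<otimes> dc\<close>, which represents the
  derivative of \<omega>, plus the sum of \<open>b D(dc)\<close>. So exact forms decide, and on them
  the derivative vanishes.\<close>

lemma torsion_free_iff:
  assumes "connection q D"
  shows "torsion_free q D \<longleftrightarrow> (\<forall>y\<in>Aw 0. D (dd q y) \<in> P2)"
proof
  assume tf: "torsion_free q D"
  show "\<forall>y\<in>Aw 0. D (dd q y) \<in> P2"
  proof
    fix y assume y: "y \<in> Aw 0"
    have "dd1 q (dd q y) = wedge q (\<Sum>i\<in>{()}. tensB q (dd q counit) (dd q y))"
      by (rule dd1_eq) (use y Aw_counit lmul_counit[OF dd_A[OF Aw_A[OF y]]] in auto)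
    then have "wedge q (D (dd q y)) = wedge q 0"
      using tf dd_Om[OF y] unfolding torsion_free_def Om1_eq dd_counit by (simp add: tensB_zero_left dd_Om[OF y] del: zero_fun_apply)
    then show "D (dd q y) \<in> P2" unfolding wedge_eq_iff by simp
  qed
next
  assume *: "\<forall>y\<in>Aw 0. D (dd q y) \<in> P2"
  show "torsion_free q D"
    unfolding torsion_free_def Om1_eq
  proof
    fix \<omega> assume \<omega>: "\<omega> \<in> Om"
    note m = R_mem[OF \<omega>]
    have "D \<omega> = (\<Sum>i\<in>RI. tensB q (dd q (rb \<omega> i)) (dd q (rc i))) + (\<Sum>i\<in>RI. lmul2 q (rb \<omega> i) (D (dd q (rc i))))"
    proof -
      have "D (\<Sum>i\<in>RI. lmul (rb \<omega> i) (dd q (rc i))) =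
          (\<Sum>i\<in>RI. tensB q (dd q (rb \<omega> i)) (dd q (rc i))) + (\<Sum>i\<in>RI. lmul2 q (rb \<omega> i) (D (dd q (rc i))))"
        by (rule connection_sum[OF assms m])
      then show ?thesis unfolding R_form[OF \<omega>, symmetric] .
    qed
    moreover have "(\<Sum>i\<in>RI. lmul2 q (rb \<omega> i) (D (dd q (rc i)))) \<in> P2"
      by (rule cvec.subspace_sum[OF P2_subspace], rule lmul2_P2) (use m * in blast)+
    ultimately have "D \<omega> - (\<Sum>i\<in>RI. tensB q (dd q (rb \<omega> i)) (dd q (rc i))) \<in> P2" by simp
    moreover have "dd1 q \<omega> = wedge q (\<Sum>i\<in>RI. tensB q (dd q (rb \<omega> i)) (dd q (rc i)))"
      by (rule dd1_eq[OF finite_RI m R_form[OF \<omega>]])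
    ultimately show "wedge q (D \<omega>) = dd1 q \<omega>" by (simp only: wedge_eq_iff)
  qed
qed

subsection \<open>Torsion-free covariant connections\<close>

lemma pc_pr: "pc (pr2 m) (pr1 m) c m = c (m, True)" "pc (pr1 m) (pr2 m) c m = c (m, False)"
  using pr_neq[of m] by (auto simp: pc_def)

lemma pc_eq_0:
  assumes "wt m \<noteq> wt l + wt k"
  shows "pc l k c m = 0"
proof -
  have "\<not> (l = pr2 m \<and> k = pr1 m)" "\<not> (l = pr1 m \<and> k = pr2 m)"
    using assms wt_sum_iff[of m l k] by blast+
  then show ?thesis unfolding pc_def by (simp only: of_bool_eq mult_zero_left add_0)
qed

lemma mu_Dc_dd:
  assumes "y \<in> Aw 0"
  shows "mu (Dc c (dd q y)) l k = (T k * T l) \<triangleright> y + (\<Sum>m\<in>UNIV. pc l k c m *\<^sub>C (T m \<triangleright> y))"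
  using mu_Dc[OF dd_Om[OF assms], of c] by (simp add: ddf_def dd_def Phi_def act_mult del: tangent.simps)

lemma mu_D0_dd: "y \<in> Aw 0 \<Longrightarrow> mu (Dc 0 (dd q y)) l k = (T k * T l) \<triangleright> y"
  by (simp add: mu_Dc_dd pc_def del: tangent.simps)

text \<open>In Sweedler notation \<open>a S(y(1)) \<nabla>(dy(2))\<close> for
  \<open>y = y_elt z k\<close> and the base connection \<open>Dc 0\<close>. Its components are the
  values of \<open>y\<close> on products of two tangent vectors, times \<open>a\<close>.\<close>

definition Xel :: "func \<Rightarrow> (nat \<Rightarrow> complex) \<Rightarrow> tix \<Rightarrow> form2"
  where "Xel a z k = (\<Sum>i\<in>{1..3} \<times> {1..3}. lmul2 q (a \<star> tz k (fst i) (snd i)) (Dc 0 (dd q (yz z (fst i) (snd i)))))"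

lemma Xel_mem:
  assumes "a \<in> Aw (wt k)" "i \<in> {1..3} \<times> {1..3}"
  shows "a \<star> tz k (fst i) (snd i) \<in> Aw 0 \<and> yz z (fst i) (snd i) \<in> Aw 0"
proof -
  have "fst i \<in> {1..3}" "snd i \<in> {1..3}" using assms(2) by (auto simp del: atLeastAtMost_iff)
  then show ?thesis using tz_coeff_Aw[OF assms(1)] yz_Aw by blast
qed

lemma Xel_TT: "a \<in> Aw (wt k) \<Longrightarrow> Xel a z k \<in> TT"
  unfolding Xel_def using Xel_mem[of a k]
  by (intro cvec.subspace_sum[OF TT_subspace] lmul2_TT Dc_Om dd_Om) blast+

lemma sum_pairs: "(\<Sum>i\<in>M \<times> N. f (fst i) (snd i)) = (\<Sum>m\<in>M. \<Sum>n\<in>N. f m n)"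
  by (simp only: sum.cartesian_product split_def)

lemma mu_Xel:
  assumes a: "a \<in> Aw (wt k)"
  shows "mu (Xel a z k) l k' = y_elt z k (T k' * T l) *\<^sub>C a"
proof -
  have "mu (Xel a z k) l k' = (\<Sum>i\<in>{1..3} \<times> {1..3}. mu (lmul2 q (a \<star> tz k (fst i) (snd i)) (Dc 0 (dd q (yz z (fst i) (snd i))))) l k')"
    unfolding Xel_def clinear_sum[OF clinear_mu] by (rule ext) (simp only: sum_fun_apply)
  also have "\<dots> = (\<Sum>i\<in>{1..3} \<times> {1..3}. a \<star> tz k (fst i) (snd i) \<star> ((T k' * T l) \<triangleright> yz z (fst i) (snd i)))"
  proof (rule sum.cong[OF refl])
    fix i :: "nat \<times> nat" assume "i \<in> {1..3} \<times> {1..3}"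
    then have m: "a \<star> tz k (fst i) (snd i) \<in> Aw 0" "yz z (fst i) (snd i) \<in> Aw 0"
      using Xel_mem[OF a, of i z] by blast+
    show "mu (lmul2 q (a \<star> tz k (fst i) (snd i)) (Dc 0 (dd q (yz z (fst i) (snd i))))) l k' =
        a \<star> tz k (fst i) (snd i) \<star> ((T k' * T l) \<triangleright> yz z (fst i) (snd i))"
      unfolding mu_lmul2[OF Dc_Om[OF dd_Om[OF m(2)]] m(1)] lmul_def mu_D0_dd[OF m(2)] by (rule refl)
  qed
  also have "\<dots> = y_elt z k (T k' * T l) *\<^sub>C a"
    unfolding sum_pairs[of "\<lambda>m n. a \<star> tz k m n \<star> ((T k' * T l) \<triangleright> yz z m n)"] by (rule tz_yz[OF Aw_A[OF a]])
  finally show ?thesis .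
qed

text \<open>As \<open>y_elt (zr k) k\<close> vanishes on the tangent space, the form
  \<open>a S(y(1)) dy(2)\<close> is zero. Applying \<open>Dc 0\<close> to it, the Leibniz rule
  exhibits \<open>Xel\<close> as minus a generator.\<close>

lemma Xel_zr_P2:
  assumes a: "a \<in> Aw (wt k)"
  shows "Xel a (zr k) k \<in> P2"
proof -
  let ?I = "{1..3} \<times> {1..3} :: (nat \<times> nat) set"
  let ?b = "\<lambda>i. a \<star> tz k (fst i) (snd i)" and ?c = "\<lambda>i. yz (zr k) (fst i) (snd i)"
  have m: "?b i \<in> Aw 0 \<and> ?c i \<in> Aw 0" if "i \<in> ?I" for i by (rule Xel_mem[OF a that])
  have z: "(\<Sum>i\<in>?I. lmul (?b i) (dd q (?c i))) = 0"
  proof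
    fix j
    have "(\<Sum>i\<in>?I. lmul (?b i) (dd q (?c i))) j = (\<Sum>i\<in>?I. ?b i \<star> (T j \<triangleright> ?c i))"
      by (rule ext) (simp only: sum_fun_apply lmul_def dd_def)
    also have "\<dots> = y_elt (zr k) k (T j) *\<^sub>C a"
      unfolding sum_pairs[of "\<lambda>m n. a \<star> tz k m n \<star> (T j \<triangleright> yz (zr k) m n)"] by (rule tz_yz[OF Aw_A[OF a]])
    finally show "(\<Sum>i\<in>?I. lmul (?b i) (dd q (?c i))) j = 0 j"
      by (simp only: zr_T cvec.scale_zero_left zero_fun_apply)
  qed
  have fin: "finite ?I" by simp
  have g: "(\<Sum>i\<in>?I. tensB q (dd q (?b i)) (dd q (?c i))) \<in> P2"
    by (rule gens_P2[OF prolong_gensI[OF fin m z]])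
  have "Dc 0 (0 *\<^sub>C 0) = 0 *\<^sub>C Dc 0 0"
    by (rule connectionD(4)[OF Dc_connection cvec.subspace_0[OF Omw_subspace]])
  then have D0: "Dc 0 0 = 0" by (simp only: cvec.scale_zero_left)
  have "Dc 0 (\<Sum>i\<in>?I. lmul (?b i) (dd q (?c i))) =
      (\<Sum>i\<in>?I. tensB q (dd q (?b i)) (dd q (?c i))) + (\<Sum>i\<in>?I. lmul2 q (?b i) (Dc 0 (dd q (?c i))))"
    by (rule connection_sum[OF Dc_connection m])
  then have "(\<Sum>i\<in>?I. tensB q (dd q (?b i)) (dd q (?c i))) + Xel a (zr k) k = 0"
    unfolding z D0 Xel_def by (rule sym)
  then have "Xel a (zr k) k = - (\<Sum>i\<in>?I. tensB q (dd q (?b i)) (dd q (?c i)))"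
    by (rule minus_unique[symmetric])
  then show ?thesis using cvec.subspace_neg[OF P2_subspace g] by simp
qed

lemma torsion_free_Dc_iff:
  "torsion_free q (Dc c) \<longleftrightarrow> (\<forall>m. c (m, True) + xr m * c (m, False) = - kr m)"
  unfolding torsion_free_iff[OF Dc_connection]
proof (intro iffI allI ballI)
  fix m assume *: "\<forall>y\<in>Aw 0. Dc c (dd q y) \<in> P2"
  \<comment> \<open>The function dual to \<open>T m\<close>: at the unit its differential has only
    the component \<open>m\<close>, which isolates the coefficients of \<open>c\<close> at
    \<open>m\<close>.\<close>
  let ?y = "y_elt (zd m) m"
  have y: "?y \<in> Aw 0" by (rule yz_Aw[OF ix_123])
  have Phi: "(\<Sum>j\<in>UNIV. pc l k c j * ?y (T j)) = pc l k c m" for l k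
    by (simp add: zd_T of_bool_def if_distrib cong: if_cong del: tangent.simps)
  have ev: "mu (Dc c (dd q ?y)) l k 1 = ?y (T k * T l) + pc l k c m" for l k
  proof -
    have "mu (Dc c (dd q ?y)) l k 1 = ((T k * T l) \<triangleright> ?y) 1 + (\<Sum>j\<in>UNIV. pc l k c j * (T j \<triangleright> ?y) 1)"
      by (simp only: mu_Dc_dd[OF y] plus_fun_apply sum_fun_apply scaleC_fun_apply scaleC_complex_def)
    then show ?thesis using Phi[of l k] by (simp only: act_def mult_1_left)
  qed
  have "mu (Dc c (dd q ?y)) (pr2 m) (pr1 m) 1 + xr m * mu (Dc c (dd q ?y)) (pr1 m) (pr2 m) 1 = 0"
    using fun_cong[OF P2_relation[OF bspec[OF * y], of m], of 1]
    by (simp only: plus_fun_apply scaleC_fun_apply scaleC_complex_def zero_fun_apply)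
  then have "(?y (T (pr1 m) * T (pr2 m)) + xr m * ?y (T (pr2 m) * T (pr1 m))) + (c (m, True) + xr m * c (m, False)) = 0"
    unfolding ev pc_pr by (simp add: algebra_simps del: tangent.simps)
  then have "kr m + (c (m, True) + xr m * c (m, False)) = 0"
    unfolding T_relation_one[OF y] by (simp add: zd_T del: tangent.simps)
  then show "c (m, True) + xr m * c (m, False) = - kr m" by (simp add: add_eq_0_iff)
next
  fix y assume eqs: "\<forall>m. c (m, True) + xr m * c (m, False) = - kr m" and y: "y \<in> Aw 0"
  note \<omega> = dd_Om[OF y]
  note m = R_mem[OF \<omega>]
  have a: "T k \<triangleright> y \<in> Aw (wt k)" for k using Aw_act_T[OF y, of k] by simp
  let ?yd = "\<lambda>k. y_elt (zd k) k" and ?yr = "\<lambda>k. y_elt (zr k) k"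
  \<comment> \<open>In degree \<open>k\<close> the pairs of components annihilated by the transposed
    quadratic relation form a line. The function built from \<open>zr k\<close> gives a nonzero
    point on it, and the factor is read off at the first component.\<close>
  define r where "r k = (?yd k (T (pr1 k) * T (pr2 k)) + c (k, True)) / ?yr k (T (pr1 k) * T (pr2 k))" for k
  have key: "?yd k (T k' * T l) + pc l k' c k = r k * ?yr k (T k' * T l)" for k l k'
  proof (cases "wt k = wt l + wt k'")
    case True
    have yd: "?yd k (T (pr1 k) * T (pr2 k)) + xr k * ?yd k (T (pr2 k) * T (pr1 k)) = kr k"
      using T_relation_one[OF yz_Aw[OF ix_123], of "zd k" k k] by (simp add: zd_T del: tangent.simps)
    have yr: "?yr k (T (pr1 k) * T (pr2 k)) + xr k * ?yr k (T (pr2 k) * T (pr1 k)) = 0"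
      using T_relation_one[OF yz_Aw[OF ix_123], of "zr k" k k] by (simp add: zr_T del: tangent.simps)
    have r1: "r k * ?yr k (T (pr1 k) * T (pr2 k)) = ?yd k (T (pr1 k) * T (pr2 k)) + c (k, True)"
      unfolding r_def using zr_TT[of k] by simp
    consider "l = pr2 k" "k' = pr1 k" | "l = pr1 k" "k' = pr2 k"
      using True wt_sum_iff[of k l k'] by blast
    then show ?thesis
    proof cases
      case 1
      then show ?thesis using r1 pc_pr(1)[of k c] by simp
    next
      case 2
      \<comment> \<open>The second component follows from the first, since both sides satisfy the
        same relation: the left one by the assumed equation on \<open>c\<close>, the right one
        because \<open>y_elt (zr k) k\<close> vanishes at \<open>T k\<close>.\<close>
      have "xr k * (?yd k (T (pr2 k) * T (pr1 k)) + c (k, False)) = xr k * (r k * ?yr k (T (pr2 k) * T (pr1 k)))"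
      proof -
        have "xr k * (r k * ?yr k (T (pr2 k) * T (pr1 k))) = - (r k * ?yr k (T (pr1 k) * T (pr2 k)))"
          using arg_cong[OF yr, of "\<lambda>x. r k * x"] by (simp add: algebra_simps add_eq_0_iff del: tangent.simps)
        also have "\<dots> = - (?yd k (T (pr1 k) * T (pr2 k)) + c (k, True))" unfolding r1 by (rule refl)
        also have "\<dots> = xr k * (?yd k (T (pr2 k) * T (pr1 k)) + c (k, False))"
        proof -
          have 1: "?yd k (T (pr1 k) * T (pr2 k)) = kr k - xr k * ?yd k (T (pr2 k) * T (pr1 k))"
            unfolding eq_diff_eq by (rule yd)
          have 2: "c (k, True) = - kr k - xr k * c (k, False)"
            unfolding eq_diff_eq using eqs by blast
          show ?thesis unfolding 1 2 by (simp add: algebra_simps del: tangent.simps)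
        qed
        finally show ?thesis by (rule sym)
      qed
      then show ?thesis using xr_nonzero[of k] pc_pr(2)[of k c] 2 by (simp del: tangent.simps)
    qed
  next
    case False
    then have n: "wt k \<noteq> wt k' + wt l" by (simp only: add.commute not_False_eq_True)
    show ?thesis unfolding y_elt_TT_eq_0[OF n] pc_eq_0[OF False] by (simp only: add_0_right mult_zero_right)
  qed
  let ?S = "\<Sum>i\<in>RI. tensB q (dd q (rb (dd q y) i)) (dd q (rc i))"
  \<comment> \<open>\<open>?S\<close> differentiates one representation of \<open>dy\<close>; the
    other is \<open>1 dy\<close>, whose derivative \<open>d1 \<otimes> dy\<close> is zero.\<close>
  have S: "?S \<in> P2"
  proof -
    have e: "(\<Sum>i\<in>RI. lmul (rb (dd q y) i) (dd q (rc i))) = (\<Sum>i\<in>{()}. lmul counit (dd q y))"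
      using R_form[OF \<omega>] lmul_counit[OF dd_A[OF Aw_A[OF y]]] by simp
    have "?S - (\<Sum>i\<in>{()}. tensB q (dd q counit) (dd q y)) \<in> P2"
      by (rule reps_unique[OF finite_RI _ m _ e]) (use y Aw_counit in auto)
    then show ?thesis by (simp add: dd_counit tensB_zero_left[OF \<omega>] del: zero_fun_apply)
  qed
  have D0: "Dc 0 (dd q y) = ?S + (\<Sum>k\<in>UNIV. Xel (T k \<triangleright> y) (zd k) k)"
  proof -
    have "Dc 0 (\<Sum>i\<in>RI. lmul (rb (dd q y) i) (dd q (rc i))) =
        ?S + (\<Sum>i\<in>RI. lmul2 q (rb (dd q y) i) (Dc 0 (dd q (rc i))))"
      by (rule connection_sum[OF Dc_connection m])
    moreover have "(\<Sum>i\<in>RI. lmul2 q (rb (dd q y) i) (Dc 0 (dd q (rc i)))) = (\<Sum>k\<in>UNIV. Xel (T k \<triangleright> y) (zd k) k)"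
      unfolding RI_sum Xel_def rb_def rc_def prod.case dd_def
      by (rule sum.cong[OF refl], rule sum_pairs[symmetric])
    ultimately show ?thesis unfolding R_form[OF \<omega>, symmetric] by simp
  qed
  \<comment> \<open>By \<open>key\<close>, adding the constants of \<open>c\<close> to the dual
    functions amounts to replacing them by multiples of the functions from \<open>zr\<close>, whose
    \<open>Xel\<close> are prolongation relations.\<close>
  have "Dc c (dd q y) = ?S + (\<Sum>k\<in>UNIV. r k *\<^sub>C Xel (T k \<triangleright> y) (zr k) k)"
  proof (rule mu_inj[OF Dc_Om[OF \<omega>]])
    show "?S + (\<Sum>k\<in>UNIV. r k *\<^sub>C Xel (T k \<triangleright> y) (zr k) k) \<in> TT"
      by (intro cvec.subspace_add[OF TT_subspace] P2_TT[OF S] cvec.subspace_sum[OF TT_subspace]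
          cvec.subspace_scale[OF TT_subspace] Xel_TT a)
    show "mu (Dc c (dd q y)) = mu (?S + (\<Sum>k\<in>UNIV. r k *\<^sub>C Xel (T k \<triangleright> y) (zr k) k))"
    proof (intro ext)
      fix l k' x
      have "mu (Dc c (dd q y)) l k' x = mu (Dc 0 (dd q y)) l k' x + (\<Sum>k\<in>UNIV. pc l k' c k * (T k \<triangleright> y) x)"
        by (simp only: mu_Dc_dd[OF y, of c] mu_D0_dd[OF y] plus_fun_apply sum_fun_apply scaleC_fun_apply scaleC_complex_def)
      also have "mu (Dc 0 (dd q y)) l k' x = mu ?S l k' x + (\<Sum>k\<in>UNIV. mu (Xel (T k \<triangleright> y) (zd k) k) l k' x)"
        unfolding D0 clinear_add[OF clinear_mu] clinear_sum[OF clinear_mu, of _ UNIV] by (simp only: plus_fun_apply sum_fun_apply)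
      also have "\<dots> + (\<Sum>k\<in>UNIV. pc l k' c k * (T k \<triangleright> y) x) =
          mu ?S l k' x + (\<Sum>k\<in>UNIV. (?yd k (T k' * T l) + pc l k' c k) * (T k \<triangleright> y) x)"
        by (simp only: mu_Xel[OF a] scaleC_fun_apply scaleC_complex_def distrib_right sum.distrib add.assoc)
      also have "\<dots> = mu ?S l k' x + (\<Sum>k\<in>UNIV. r k * mu (Xel (T k \<triangleright> y) (zr k) k) l k' x)"
        by (simp only: key mu_Xel[OF a] scaleC_fun_apply scaleC_complex_def mult.assoc)
      also have "\<dots> = mu (?S + (\<Sum>k\<in>UNIV. r k *\<^sub>C Xel (T k \<triangleright> y) (zr k) k)) l k' x"
        unfolding clinear_add[OF clinear_mu] clinear_sum[OF clinear_mu, of _ UNIV] clinear_scale[OF clinear_mu]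
        by (simp only: plus_fun_apply sum_fun_apply scaleC_fun_apply scaleC_complex_def)
      finally show "mu (Dc c (dd q y)) l k' x = mu (?S + (\<Sum>k\<in>UNIV. r k *\<^sub>C Xel (T k \<triangleright> y) (zr k) k)) l k' x" .
    qed
  qed
  then show "Dc c (dd q y) \<in> P2"
    using S by (simp only: cvec.subspace_add[OF P2_subspace] cvec.subspace_sum[OF P2_subspace]
        cvec.subspace_scale[OF P2_subspace] Xel_zr_P2[OF a])
qed

theorem torsion_free_connections_dim:
  "has_affine_dim {D. connection q D \<and> left_covariant q D \<and> torsion_free q D} 6"
proof -
  \<comment> \<open>A particular solution of the torsion equations, while \<open>v m\<close> solves
    the homogeneous equation at \<open>m\<close>; the \<open>False\<close> coordinates are the free
    parameters.\<close>
  define c0 where "c0 = (\<lambda>(m, b). if b then - kr m else 0)"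
  define v where "v m = Vc (m, False) - xr m *\<^sub>C Vc (m, True)" for m
  have pairs: "(\<Sum>i\<in>UNIV. f i) = (\<Sum>m\<in>UNIV. f (m, True) + f (m, False))" for f :: "tix \<times> bool \<Rightarrow> form \<Rightarrow> form2"
  proof -
    have "(\<Sum>i\<in>UNIV. f i) = (\<Sum>i\<in>UNIV \<times> UNIV. f (fst i, snd i))"
      by (simp only: UNIV_Times_UNIV prod.collapse)
    also have "\<dots> = (\<Sum>m\<in>UNIV. \<Sum>b\<in>UNIV. f (m, b))" by (rule sum_pairs)
    finally show ?thesis by (simp only: UNIV_bool sum.insert finite.emptyI finite_insert sum.empty add_0_right add_0
        insert_iff empty_iff simp_thms add.commute bool.distinct)
  qed
  have comb: "(\<Sum>i\<in>UNIV. d i *\<^sub>C Vc i) = (\<Sum>m\<in>UNIV. s m *\<^sub>C v m)"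
    if "\<And>m. d (m, True) = - xr m * s m" "\<And>m. d (m, False) = s m" for d s
    unfolding pairs v_def
    by (rule sum.cong[OF refl]) (simp only: that cvec.scale_right_diff_distrib scaleC_scaleC cvec.scale_minus_left
        mult.commute[of "- xr _"] mult_minus_right mult.commute[of "xr _"] add.commute diff_conv_add_uminus
        scaleC_add_right cvec.scale_minus_right)
  have "has_affine_dim {D. connection q D \<and> left_covariant q D \<and> torsion_free q D} (card (UNIV :: tix set))"
  proof (rule has_affine_dimI[where v = v and ?x0.0 = "Dc c0"])
    show "s m = 0" if "(\<Sum>m\<in>UNIV. s m *\<^sub>C v m) = 0" for s m
    proof -
      have "(\<Sum>i\<in>UNIV. (case i of (m, b) \<Rightarrow> if b then - xr m * s m else s m) *\<^sub>C Vc i) = 0"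
        using comb[of "\<lambda>(m, b). if b then - xr m * s m else s m" s] that by simp
      from Vc_independent[OF this, of "(m, False)"] show ?thesis by simp
    qed
    show "{D. connection q D \<and> left_covariant q D \<and> torsion_free q D} = {Dc c0 + (\<Sum>m\<in>UNIV. s m *\<^sub>C v m) |s. True}"
    proof (intro subset_antisym subsetI)
      fix D assume "D \<in> {D. connection q D \<and> left_covariant q D \<and> torsion_free q D}"
      then have D: "connection q D" "left_covariant q D" "torsion_free q D" by blast+
      obtain c where c: "D = Dc c" using covariant_connection_Dc[OF D(1,2)] .
      have eq: "c (m, True) + xr m * c (m, False) = - kr m" for m
        using D(3) unfolding c torsion_free_Dc_iff by blast
      then have eq': "c (m, True) = - kr m - xr m * c (m, False)" for m by (simp only: eq_diff_eq)
      have "D = Dc c0 + (\<Sum>m\<in>UNIV. c (m, False) *\<^sub>C v m)"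
        unfolding c Dc_expand[of c c0]
        by (intro arg_cong[where f = "\<lambda>x. Dc c0 + x"] comb)
          (simp_all add: c0_def eq')
      then show "D \<in> {Dc c0 + (\<Sum>m\<in>UNIV. s m *\<^sub>C v m) |s. True}"
        by (intro CollectI exI[of _ "\<lambda>m. c (m, False)"] conjI TrueI)
    next
      fix D assume "D \<in> {Dc c0 + (\<Sum>m\<in>UNIV. s m *\<^sub>C v m) |s. True}"
      then obtain s where s: "D = Dc c0 + (\<Sum>m\<in>UNIV. s m *\<^sub>C v m)" by blast
      define c where "c = (\<lambda>(m, b). if b then - kr m - xr m * s m else s m)"
      have D: "D = Dc c"
        unfolding s Dc_expand[of c c0]
        by (intro arg_cong[where f = "\<lambda>x. Dc c0 + x"] comb[symmetric]) (simp_all add: c_def c0_def)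
      have "torsion_free q (Dc c)" unfolding torsion_free_Dc_iff by (simp add: c_def)
      then show "D \<in> {D. connection q D \<and> left_covariant q D \<and> torsion_free q D}"
        unfolding D using Dc_connection Dc_left_covariant by blast
    qed
  qed simp
  moreover have "card (UNIV :: tix set) = 6" by (simp add: UNIV_tix)
  ultimately show ?thesis by simp
qed

end

theorem corollary4p4:
  fixes q :: real
  assumes "q \<notin> {-1, 0, 1}"
  shows "has_affine_dim {D. connection q D \<and> left_covariant q D} 12 \<and>
    has_affine_dim {D. connection q D \<and> left_covariant q D \<and> torsion_free q D} 6"
proof -
  interpret quantum_flag q by unfold_locales (rule assms)
  show ?thesis using covariant_connections_dim torsion_free_connections_dim by blast
qed

end
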